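(* Let $2<p<5$, $\omega>0$, and take $T\ge4$ with $T^{2p-4}\ge3$. There exist $\alpha=\alpha(T)>0$ and $\beta=\beta(T)>0$, independent of $e$, $\rho$, $\lambda$, such that for every $e>0$, every $\rho$ satisfying the standing assumptions and every $u\in H^1(\mathbb{R}^3,\mathbb{C})$, writing \[ \mathcal{N}(\rho)=\|\rho\|_{\frac65}+\|x\cdot\nabla\rho\|_{\frac65}+\|x\cdot(D^2\rho\,x)\|_{\frac65}, \] one has for $0\le\lambda\le T$ \[ I(u)-I(u_\lambda)-\frac{1-\lambda^3}3J(u)\ge\frac{(1-\lambda)^2\omega}3\|u\|_2^2+\frac{\alpha}{6(p+1)}(1-\lambda)^2\|u\|_{p+1}^{p+1}-\beta(1-\lambda)^2e^2\mathcal{N}(\rho)\left(\|u\|_2^2+\|u\|_{p+1}^2\right), \] and for $\lambda\ge T$ \[ \begin{aligned} I(u)-I(u_\lambda)-\frac{1-\lambda^3}3J(u)\ge{}&\frac{(1-\lambda)^2\omega}6\|u\|_2^2+\frac{\lambda^3\omega}{3T}\|u\|_2^2+\frac{\alpha}{12(p+1)}(1-\lambda)^2\|u\|_{p+1}^{p+1}+\frac{\alpha}{6(p+1)}\lambda^3\|u\|_{p+1}^{p+1}\\ &-\beta\lambda^3e^2\mathcal{N}(\rho)\left(\|u\|_2^2+\|u\|_{p+1}^2\right). \end{aligned} \] Furthermore, for every $\delta>0$ (independent of $e$, $\rho$) there exists $\rho_0>0$, independent of $e$, $\rho$, $\lambda$, such that if $\|u\|_{p+1}\ge\delta$ and $e^2\mathcal{N}(\rho)\le\rho_0$,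 then \[ I(u)-I(u_\lambda)-\frac{1-\lambda^3}3J(u)\ge\frac{(1-\lambda)^2\omega}6\|u\|_2^2+\frac{\alpha\delta^{p-1}}{12(p+1)}(1-\lambda)^2\|u\|_{p+1}^2\qquad\text{for all }\lambda>0 . \]
   Context: $\|\cdot\|_r$ is the $L^r(\mathbb{R}^3)$ norm. Standing assumptions on $\rho:\mathbb{R}^3\to\mathbb{R}$ (weak derivatives): $\rho\in L^{6/5}(\mathbb{R}^3)\cap L^q_{loc}(\mathbb{R}^3)$ for some $q>3$, $x\cdot\nabla\rho\in L^{6/5}(\mathbb{R}^3)$, $x\cdot(D^2\rho\,x)\in L^{6/5}(\mathbb{R}^3)$, $\rho\ge0$, $\rho\not\equiv0$. For $u\in H^1(\mathbb{R}^3,\mathbb{C})$: $u_\lambda(x)=\lambda^2u(\lambda x)$ for $\lambda>0$ (and $u_\lambda=0$, $I(u_\lambda)=0$ for $\lambda=0$); $S_0(u)=\frac1{8\pi|x|}*|u|^2$; $A(u)=\|\nabla u\|_2^2$, $B(u)=\|u\|_2^2$, $C(u)=\|u\|_{p+1}^{p+1}$, \[ D(u)=\tfrac14\int_{\mathbb{R}^3}S_0(u)|u|^2dx,\quad E_1(u)=-\tfrac14\int_{\mathbb{R}^3}S_0(u)\rho\,dx,\quad E_2(u)=\tfrac12\int_{\mathbb{R}^3}S_0(u)\,x\cdot\nabla\rho\,dx, \] \[ I(u)=\tfrac12A(u)+\tfrac\omega2B(u)-\tfrac1{p+1}C(u)+e^2D(u)+2e^2E_1(u), \] \[ J(u)=\tfrac32A(u)+\tfrac\omega2B(u)-\tfrac{2p-1}{p+1}C(u)+3e^2D(u)-2e^2E_1(u)+e^2E_2(u).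 \] *)

theory Defs
  imports "HOL-Analysis.Analysis"
begin

text \<open>
  Functions are concrete representatives, not classes modulo null sets. On \<open>Lp r\<close> the integral
  below is finite and \<open>Lnorm r\<close> is the usual norm; outside it the value is meaningless.
\<close>

definition Lp :: "real \<Rightarrow> (real^'n \<Rightarrow> 'b::real_normed_vector) set" where
  "Lp r = {f. f \<in> borel_measurable lebesgue \<and> integrable lebesgue (\<lambda>x. norm (f x) powr r)}"

definition Lnorm :: "real \<Rightarrow> (real^'n \<Rightarrow> 'b::real_normed_vector) \<Rightarrow> real" where
  "Lnorm r f = (LINT x|lebesgue. norm (f x) powr r) powr (1 / r)"

definition Lp_loc :: "real \<Rightarrow> (real^'n \<Rightarrow> 'b::real_normed_vector) set" where
  "Lp_loc r = {f. \<forall>K. compact K \<longrightarrow> (\<lambda>x. indicat_real K x *\<^sub>R f x) \<in> Lp r}"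

definition partial :: "'n \<Rightarrow> (real^'n \<Rightarrow> real) \<Rightarrow> real^'n \<Rightarrow> real" where
  "partial i \<phi> x = frechet_derivative \<phi> (at x) (axis i 1)"

primrec Ck :: "nat \<Rightarrow> (real^'n \<Rightarrow> real) \<Rightarrow> bool" where
  "Ck 0 \<phi> \<longleftrightarrow> continuous_on UNIV \<phi>"
| "Ck (Suc k) \<phi> \<longleftrightarrow> (\<forall>x. \<phi> differentiable (at x)) \<and> (\<forall>i. Ck k (partial i \<phi>))"

definition test_function :: "(real^'n \<Rightarrow> real) \<Rightarrow> bool" where
  "test_function \<phi> \<longleftrightarrow> (\<forall>k. Ck k \<phi>) \<and> compact (closure {x. \<phi> x \<noteq> 0})"

definition has_weak_partial ::
    "'n \<Rightarrow> (real^'n \<Rightarrow> 'b::{banach,second_countable_topology}) \<Rightarrow> (real^'n \<Rightarrow> 'b) \<Rightarrow> bool" where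
  "has_weak_partial i f g \<longleftrightarrow> f \<in> Lp_loc 1 \<and> g \<in> Lp_loc 1 \<and>
     (\<forall>\<phi>. test_function \<phi> \<longrightarrow>
        (LINT x|lebesgue. partial i \<phi> x *\<^sub>R f x) = - (LINT x|lebesgue. \<phi> x *\<^sub>R g x))"

text \<open>
  Weak partial derivatives are unique up to null sets, so the choice below is immaterial for
  integrals and norms. It is meaningful only when a weak derivative exists.
\<close>

definition weak_partial ::
    "'n \<Rightarrow> (real^'n \<Rightarrow> 'b::{banach,second_countable_topology}) \<Rightarrow> real^'n \<Rightarrow> 'b" where
  "weak_partial i f = (SOME g. has_weak_partial i f g)"

definition weak_grad ::
    "(real^'n \<Rightarrow> 'b::{banach,second_countable_topology}) \<Rightarrow> real^'n \<Rightarrow> 'b^'n" where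
  "weak_grad f x = (\<chi> i. weak_partial i f x)"

definition weak_hess :: "(real^'n \<Rightarrow> real) \<Rightarrow> real^'n \<Rightarrow> real^'n^'n" where
  "weak_hess f x = (\<chi> i j. weak_partial i (weak_partial j f) x)"

definition H1 :: "(real^'n \<Rightarrow> complex) set" where
  "H1 = {u. u \<in> Lp 2 \<and> (\<forall>i. \<exists>g\<in>Lp 2. has_weak_partial i u g)}"

definition x_grad :: "(real^3 \<Rightarrow> real) \<Rightarrow> real^3 \<Rightarrow> real" where
  "x_grad \<rho> x = x \<bullet> weak_grad \<rho> x"

definition x_hess_x :: "(real^3 \<Rightarrow> real) \<Rightarrow> real^3 \<Rightarrow> real" where
  "x_hess_x \<rho> x = x \<bullet> (weak_hess \<rho> x *v x)"

text \<open>
  The weak derivatives of \<open>\<rho>\<close> up to second order exist as locally integrable functions.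
  Sign and nontriviality of \<open>\<rho>\<close> are understood almost everywhere.
\<close>

definition doping_profile :: "(real^3 \<Rightarrow> real) \<Rightarrow> bool" where
  "doping_profile \<rho> \<longleftrightarrow>
     \<rho> \<in> Lp (6/5) \<and> (\<exists>q>3. \<rho> \<in> Lp_loc q) \<and>
     (\<forall>i. \<exists>g. has_weak_partial i \<rho> g) \<and>
     (\<forall>i j. \<exists>g. has_weak_partial i (weak_partial j \<rho>) g) \<and>
     x_grad \<rho> \<in> Lp (6/5) \<and> x_hess_x \<rho> \<in> Lp (6/5) \<and>
     (AE x in lebesgue. \<rho> x \<ge> 0) \<and> \<not> (AE x in lebesgue. \<rho> x = 0)"

definition N_fun :: "(real^3 \<Rightarrow> real) \<Rightarrow> real" where
  "N_fun \<rho> = Lnorm (6/5) \<rho> + Lnorm (6/5) (x_grad \<rho>) + Lnorm (6/5) (x_hess_x \<rho>)"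

text \<open>For \<open>l = 0\<close> this is the zero function, on which \<open>I_fun\<close> below vanishes.\<close>

definition scaled :: "real \<Rightarrow> (real^3 \<Rightarrow> complex) \<Rightarrow> real^3 \<Rightarrow> complex" where
  "scaled l u x = l\<^sup>2 *\<^sub>R u (l *\<^sub>R x)"

definition conv :: "(real^3 \<Rightarrow> real) \<Rightarrow> (real^3 \<Rightarrow> real) \<Rightarrow> real^3 \<Rightarrow> real" where
  "conv f g x = (LINT y|lebesgue. f (x - y) * g y)"

definition S0 :: "(real^3 \<Rightarrow> complex) \<Rightarrow> real^3 \<Rightarrow> real" where
  "S0 u = conv (\<lambda>x. 1 / (8 * pi * norm x)) (\<lambda>x. (cmod (u x))\<^sup>2)"

definition A_fun :: "(real^3 \<Rightarrow> complex) \<Rightarrow> real" where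
  "A_fun u = (Lnorm 2 (weak_grad u))\<^sup>2"

definition B_fun :: "(real^3 \<Rightarrow> complex) \<Rightarrow> real" where
  "B_fun u = (Lnorm 2 u)\<^sup>2"

definition C_fun :: "real \<Rightarrow> (real^3 \<Rightarrow> complex) \<Rightarrow> real" where
  "C_fun p u = Lnorm (p + 1) u powr (p + 1)"

definition D_fun :: "(real^3 \<Rightarrow> complex) \<Rightarrow> real" where
  "D_fun u = 1/4 * (LINT x|lebesgue. S0 u x * (cmod (u x))\<^sup>2)"

definition E1_fun :: "(real^3 \<Rightarrow> real) \<Rightarrow> (real^3 \<Rightarrow> complex) \<Rightarrow> real" where
  "E1_fun \<rho> u = - (1/4) * (LINT x|lebesgue. S0 u x * \<rho> x)"

definition E2_fun :: "(real^3 \<Rightarrow> real) \<Rightarrow> (real^3 \<Rightarrow> complex) \<Rightarrow> real" where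
  "E2_fun \<rho> u = 1/2 * (LINT x|lebesgue. S0 u x * x_grad \<rho> x)"

definition I_fun :: "real \<Rightarrow> real \<Rightarrow> real \<Rightarrow> (real^3 \<Rightarrow> real) \<Rightarrow> (real^3 \<Rightarrow> complex) \<Rightarrow> real" where
  "I_fun p \<omega> e \<rho> u =
     1/2 * A_fun u + \<omega>/2 * B_fun u - 1/(p + 1) * C_fun p u
     + e\<^sup>2 * D_fun u + 2 * e\<^sup>2 * E1_fun \<rho> u"

definition J_fun :: "real \<Rightarrow> real \<Rightarrow> real \<Rightarrow> (real^3 \<Rightarrow> real) \<Rightarrow> (real^3 \<Rightarrow> complex) \<Rightarrow> real" where
  "J_fun p \<omega> e \<rho> u =
     3/2 * A_fun u + \<omega>/2 * B_fun u - (2*p - 1)/(p + 1) * C_fun p u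
     + 3 * e\<^sup>2 * D_fun u - 2 * e\<^sup>2 * E1_fun \<rho> u + e\<^sup>2 * E2_fun \<rho> u"

end

theory Submission
  imports Defs
begin

text \<open>
  Under \<open>u\<^sub>l x = l\<^sup>2 u (l x)\<close> the terms \<open>A\<close> and \<open>D\<close> scale like \<open>l\<^sup>3\<close>, \<open>B\<close> like \<open>l\<close> and \<open>C\<close> like
  \<open>l\<close> to the power \<open>2 p - 1\<close>, so that in \<open>I u - I u\<^sub>l - (1 - l\<^sup>3) / 3 * J u\<close> the terms \<open>A\<close> and \<open>D\<close>
  cancel. The coefficient of \<open>B\<close> becomes \<open>\<omega> (1 - l)\<^sup>2 (l + 2) / 6\<close>. The coefficient of \<open>C\<close> is, up to the
  factor \<open>1 / (p + 1)\<close>, the gap in Bernoulli's inequality for \<open>s = l\<^sup>3\<close> and the exponent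
  \<open>(2 p - 1) / 3\<close>, which lies strictly between \<open>1\<close> and \<open>3\<close>; on bounded intervals
  the gap is at least a positive multiple of \<open>(1 - l)\<^sup>2\<close>,
  and at infinity it dominates \<open>l\<^sup>3\<close> (\<open>power_gap_lower\<close>).

  The doping terms contribute \<open>e\<^sup>2 / 2\<close> times the remainder after subtracting from
  \<open>F l = m (1 / l) / l\<close>, \<open>m r = \<integral> S\<^sub>0(u) x * \<rho> (r x) dx\<close>, its first-order expansion at \<open>1\<close> in the variable
  \<open>l\<^sup>3\<close>. Along \<open>r = exp t\<close> the first two derivatives of \<open>m\<close> are pairings of \<open>S\<^sub>0(u)\<close> with dilates of
  \<open>x \<bullet> \<nabla>\<rho>\<close> and of \<open>x \<bullet> (D\<^sup>2\<rho> x) + x \<bullet> \<nabla>\<rho>\<close>, and this is what the three norms in \<open>N_fun\<close> control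
  (\<open>doping_dilation\<close>, \<open>remainder_bounds\<close>). Three ingredients make this rigorous for weak derivatives
  and for \<open>u\<close> in \<open>H1\<close>.

  Weak derivatives along a linear flow obey the fundamental theorem of calculus on almost every
  orbit (\<open>weak_flow\<close>): transporting a test function along the flow turns the weak identity into the
  integrated one, and a locally integrable function that all test functions annihilate vanishes
  (\<open>fundamental_lemma\<close>). Dilations give Taylor's formula for \<open>m\<close> (\<open>dilation_taylor\<close>), translations
  give the Sobolev embedding.

  A trilinear Young inequality for the kernel \<open>dist x y \<le> s\<close> follows from a three-term inequality of
  arithmetic and geometric means (\<open>ball_pairing\<close>). Writing \<open>1 / norm x\<close> as an integral over radii
  yields \<open>\<integral> S\<^sub>0(u) \<bar>h\<bar> \<le> const * (\<parallel>u\<parallel>\<^sub>2\<^sup>2 + \<parallel>u\<parallel>\<^sup>2) * \<parallel>h\<parallel>\<close> (\<open>S0_pairing\<close>), where the second norm of \<open>u\<close> has exponent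
  \<open>p + 1\<close> and the norm of \<open>h\<close> has exponent \<open>6/5\<close>.

  Finally \<open>u\<close> has to be integrable to the power \<open>p + 1 < 6\<close>, since otherwise \<open>Lnorm (p + 1) u\<close> would be
  meaningless. Averaging the translation estimate over a ball reduces this to \<open>ball_pairing\<close> again,
  and duality concludes (\<open>H1_Lp\<close>).
\<close>

section \<open>Smooth test functions\<close>

lemma partial_eqI:
  "(\<phi> has_derivative D) (at x) \<Longrightarrow> partial i \<phi> x = D (axis i 1)"
  unfolding partial_def by (metis frechet_derivative_at)

lemma Ck_Suc_D: "Ck (Suc k) \<phi> \<Longrightarrow> Ck k \<phi>"
proof (induction k arbitrary: \<phi>)
  case 0
  then show ?case
    by (auto intro!: continuous_at_imp_continuous_on differentiable_imp_continuous_within)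
qed auto

lemma Ck_const: "Ck k (\<lambda>x::real^'n. c)"
proof (induction k arbitrary: c)
  case (Suc k)
  have "partial i (\<lambda>x::real^'n. c) = (\<lambda>x. 0)" for i
    by (rule ext) (subst partial_eqI, rule has_derivative_const, simp)
  then show ?case using Suc by simp
qed (simp add: continuous_intros)

lemma Ck_add:
  assumes "Ck k f" "Ck k g" shows "Ck k (\<lambda>x. f x + g x)"
  using assms
proof (induction k arbitrary: f g)
  case (Suc k)
  then have d: "f differentiable at x" "g differentiable at x" for x by auto
  have "partial i (\<lambda>x. f x + g x) = (\<lambda>x. partial i f x + partial i g x)" for i
    using has_derivative_add[OF d[THEN frechet_derivative_works[THEN iffD1]]]
    by (intro ext) (subst partial_eqI, assumption, simp add: partial_def)
  with Suc d show ?case by (simp add: differentiable_add)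
qed (simp add: continuous_intros)

lemma partial_mult:
  assumes "f differentiable at x" "g differentiable at x"
  shows "partial i (\<lambda>x. f x * g x) x = f x * partial i g x + partial i f x * g x"
  using has_derivative_mult[OF assms[THEN frechet_derivative_works[THEN iffD1]]]
  by (subst partial_eqI, assumption) (simp add: partial_def)

lemma Ck_mult:
  assumes "Ck k f" "Ck k g" shows "Ck k (\<lambda>x. f x * g x)"
  using assms
proof (induction k arbitrary: f g)
  case (Suc k)
  then have d: "f differentiable at x" "g differentiable at x" for x by auto
  have "partial i (\<lambda>x. f x * g x) = (\<lambda>x. f x * partial i g x + partial i f x * g x)" for i
    by (intro ext partial_mult d)
  moreover have "Ck k f" "Ck k g" using Suc.prems Ck_Suc_D by blast+
  ultimately show ?case using Suc d by (simp add: differentiable_mult Ck_add)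
qed (simp add: continuous_intros)

lemma Ck_prod:
  assumes "finite A" "\<And>a. a \<in> A \<Longrightarrow> Ck k (f a)"
  shows "Ck k (\<lambda>x. \<Prod>a\<in>A. f a x)"
  using assms by (induction A) (auto simp: Ck_const intro!: Ck_mult)

lemma Ck_coord: "Ck k (\<lambda>x::real^'n. x $ i)"
proof (cases k)
  case (Suc k)
  have d: "((\<lambda>x::real^'n. x $ i) has_derivative (\<lambda>x. x $ i)) (at y)" for y
    by (rule bounded_linear_imp_has_derivative) (rule bounded_linear_vec_nth)
  have "partial j (\<lambda>x::real^'n. x $ i) = (\<lambda>x. axis j 1 $ i)" for j
    by (rule ext) (rule partial_eqI[OF d])
  then show ?thesis using d by (auto simp: Suc differentiable_def intro!: Ck_const)
qed (auto intro!: continuous_intros)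

lemma partial_affine:
  assumes "f differentiable at (c *\<^sub>R x + z)"
  shows "(\<lambda>x. f (c *\<^sub>R x + z)) differentiable at x"
    and "partial i (\<lambda>x. f (c *\<^sub>R x + z)) x = c * partial i f (c *\<^sub>R x + z)"
proof -
  let ?D = "frechet_derivative f (at (c *\<^sub>R x + z))"
  have D: "(f has_derivative ?D) (at (c *\<^sub>R x + z))"
    using assms by (rule frechet_derivative_works[THEN iffD1])
  have "((\<lambda>x. c *\<^sub>R x + z) has_derivative (\<lambda>h. c *\<^sub>R h)) (at x)"
    by (auto intro!: derivative_eq_intros)
  from has_derivative_compose[OF this D]
  have *: "((\<lambda>x. f (c *\<^sub>R x + z)) has_derivative (\<lambda>h. ?D (c *\<^sub>R h))) (at x)" .
  then show "(\<lambda>x. f (c *\<^sub>R x + z)) differentiable at x" by (rule differentiableI)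
  show "partial i (\<lambda>x. f (c *\<^sub>R x + z)) x = c * partial i f (c *\<^sub>R x + z)"
    using partial_eqI[OF *, of i] linear_scale[OF has_derivative_linear[OF D]]
    by (simp add: partial_def)
qed

lemma Ck_affine: "Ck k f \<Longrightarrow> Ck k (\<lambda>x. f (c *\<^sub>R x + z))"
proof (induction k arbitrary: f)
  case 0
  then show ?case
    by (auto intro!: continuous_on_compose2[of UNIV f UNIV] continuous_intros)
next
  case (Suc k)
  then have d: "f differentiable at x" for x by auto
  have "partial i (\<lambda>x. f (c *\<^sub>R x + z)) = (\<lambda>x. c * partial i f (c *\<^sub>R x + z))" for i
    by (intro ext partial_affine d)
  with Suc d show ?case by (auto intro!: partial_affine(1) Ck_mult Ck_const)
qed

text \<open>Dividing the classical bump \<open>exp (-1/t)\<close> by powers of \<open>t\<close> gives a family whose derivatives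
  are combinations of members of the family, so smoothness at \<open>0\<close> needs to be checked once.\<close>

definition bump :: "nat \<Rightarrow> real \<Rightarrow> real" where
  "bump m t = (if t > 0 then exp (- 1 / t) / t ^ m else 0)"

lemma bump_bound: "0 \<le> bump m t" "bump m t \<le> fact (m + 2) * t\<^sup>2"
proof -
  show "0 \<le> bump m t" by (simp add: bump_def)
  show "bump m t \<le> fact (m + 2) * t\<^sup>2"
  proof (cases "t > 0")
    case True
    have "(1 / t) ^ (m + 2) / fact (m + 2) \<le> exp (1 / t)"
    proof -
      have "(1 / t) ^ (m + 2) /\<^sub>R fact (m + 2) \<le> (\<Sum>n. (1 / t) ^ n /\<^sub>R fact n)"
        using True sum_le_suminf[OF summable_exp_generic[of "1/t"], of "{m+2}"] by simp
      then show ?thesis by (simp add: exp_def divide_inverse mult.commute)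
    qed
    moreover have "1 \<le> c * P * E" if "(1 / P) / c \<le> E" "P > 0" "c > 0" for P c E :: real
      using that by (simp add: field_simps)
    ultimately have "1 \<le> fact (m + 2) * t ^ (m + 2) * exp (1 / t)"
      using True by (metis fact_gt_zero power_one_over zero_less_power)
    then have "exp (- (1 / t)) \<le> fact (m + 2) * t ^ (m + 2)"
      by (simp only: exp_minus inverse_eq_divide pos_divide_le_eq[OF exp_gt_zero])
    then have "exp (- (1 / t)) / t ^ m \<le> fact (m + 2) * t ^ (m + 2) / t ^ m"
      using True by (intro divide_right_mono) auto
    then show ?thesis using True by (simp only: bump_def power_add) simp
  qed (simp add: bump_def)
qed

lemma bump_deriv:
  "(bump m has_real_derivative bump (m + 2) t - real m * bump (m + 1) t) (at t)"
proof -
  consider "t > 0" | "t = 0" | "t < 0" by linarith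
  then show ?thesis
  proof cases
    case 1
    have "((\<lambda>t. exp (- 1 / t) / t ^ m) has_real_derivative bump (m + 2) t - real m * bump (m + 1) t) (at t)"
    proof -
      have "real m * t ^ (m - 1) = real m * t ^ m / t" using 1 by (cases m) auto
      then have P: "((\<lambda>t. t ^ m) has_real_derivative real m * t ^ m / t) (at t)"
        using DERIV_pow[of m t] by simp
      have E: "((\<lambda>t. exp (- 1 / t)) has_real_derivative exp (- 1 / t) / t\<^sup>2) (at t)"
        using 1 by (auto intro!: derivative_eq_intros simp: power2_eq_square)
      show ?thesis using 1
        by (intro DERIV_cong[OF DERIV_divide[OF E P]])
          (auto simp: bump_def power_add field_simps power2_eq_square)
    qed
    moreover have "\<forall>\<^sub>F s in nhds t. s > 0"
      using 1 eventually_nhds_in_open[of "{0<..}" t] by simp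
    then have "\<forall>\<^sub>F s in nhds t. exp (- 1 / s) / s ^ m = bump m s"
      by eventually_elim (simp add: bump_def)
    ultimately show ?thesis by (rule DERIV_cong_ev[THEN iffD1, OF refl, rotated 2]) simp
  next
    case 2
    have "((\<lambda>h. bump m h / h) \<longlongrightarrow> 0) (at 0)"
    proof (rule Lim_null_comparison)
      show "\<forall>\<^sub>F h in at 0. norm (bump m h / h) \<le> fact (m + 2) * \<bar>h\<bar>"
        unfolding eventually_at_filter
      proof (intro always_eventually allI impI)
        fix h :: real assume "h \<noteq> 0"
        then show "norm (bump m h / h) \<le> fact (m + 2) * \<bar>h\<bar>"
          using bump_bound[of m h] by (simp add: divide_simps power2_eq_square abs_mult_self_eq mult.assoc)
      qed
      show "((\<lambda>h::real. fact (m + 2) * \<bar>h\<bar>) \<longlongrightarrow> 0) (at 0)"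
        by (auto intro!: tendsto_eq_intros)
    qed
    moreover have "bump m 0 = 0" "bump (m + 2) 0 = 0" "bump (m + 1) 0 = 0" by (simp_all add: bump_def)
    ultimately show ?thesis using 2 by (simp add: DERIV_def)
  next
    case 3
    then have "\<forall>\<^sub>F s in nhds t. s < 0" using eventually_nhds_in_open[of "{..<0}" t] by simp
    then have "\<forall>\<^sub>F s in nhds t. 0 = bump m s" by eventually_elim (simp add: bump_def)
    from DERIV_cong_ev[THEN iffD1, OF refl this refl DERIV_const]
    have "(bump m has_real_derivative 0) (at t)" .
    with 3 show ?thesis by (simp add: bump_def[of "Suc (Suc m)"] bump_def[of "Suc m"])
  qed
qed

lemma Ck_bump: "Ck k (\<lambda>x::real^'n. bump m (a * x $ i + b))"
proof (induction k arbitrary: m)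
  case 0
  have "continuous_on UNIV (bump m)"
    by (meson bump_deriv DERIV_isCont continuous_at_imp_continuous_on)
  then show ?case by (auto intro!: continuous_on_compose2[of UNIV "bump m" UNIV] continuous_intros)
next
  case (Suc k)
  have "((\<lambda>x. a * x $ i + b) has_derivative (\<lambda>h. a * h $ i)) (at x)" for x :: "real^'n"
    by (auto intro!: derivative_eq_intros bounded_linear_imp_has_derivative bounded_linear_vec_nth)
  from has_derivative_compose[OF this bump_deriv[unfolded has_field_derivative_def]]
  have D: "((\<lambda>x. bump m (a * x $ i + b)) has_derivative
     (\<lambda>h. (bump (m + 2) (a * x $ i + b) - m * bump (m + 1) (a * x $ i + b)) * (a * h $ i))) (at x)" for x :: "real^'n" .
  have "partial j (\<lambda>x::real^'n. bump m (a * x $ i + b)) =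
     (\<lambda>x. (bump (m + 2) (a * x $ i + b) + - m * bump (m + 1) (a * x $ i + b)) * (a * axis j 1 $ i))" for j
    by (rule ext) (subst partial_eqI[OF D], simp)
  moreover have "Ck k (\<lambda>x::real^'n. (bump (m + 2) (a * x $ i + b) + - m * bump (m + 1) (a * x $ i + b)) * (a * axis j 1 $ i))" for j
    by (intro Ck_mult Ck_add Ck_const Suc)
  ultimately show ?case using D by (auto simp: differentiable_def)
qed

lemma test_function_iff:
  "test_function \<phi> \<longleftrightarrow> (\<forall>k. Ck k \<phi>) \<and> (\<exists>R. \<forall>x. \<phi> x \<noteq> 0 \<longrightarrow> norm x \<le> R)"
proof -
  have "compact (closure {x. \<phi> x \<noteq> 0}) \<longleftrightarrow> bounded {x. \<phi> x \<noteq> 0}"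
    by (simp add: compact_closure)
  then show ?thesis by (auto simp: test_function_def bounded_iff)
qed

lemma test_function_D:
  assumes "test_function \<phi>"
  shows "\<phi> differentiable at x" "continuous_on UNIV \<phi>" "Ck k \<phi>"
  using assms Ck.simps(2)[of 0 \<phi>] Ck.simps(1)[of \<phi>] unfolding test_function_def by blast+

lemma test_function_mult: "test_function \<phi> \<Longrightarrow> (\<And>k. Ck k g) \<Longrightarrow> test_function (\<lambda>x. g x * \<phi> x)"
  unfolding test_function_iff using Ck_mult by (metis mult_zero_right)

lemma test_function_affine:
  assumes "test_function \<phi>" "c \<noteq> 0"
  shows "test_function (\<lambda>x. \<phi> (c *\<^sub>R x + z))"
proof -
  obtain R where R: "\<And>x. \<phi> x \<noteq> 0 \<Longrightarrow> norm x \<le> R" using assms by (auto simp: test_function_iff)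
  have "norm x \<le> (R + norm z) / \<bar>c\<bar>" if "\<phi> (c *\<^sub>R x + z) \<noteq> 0" for x
  proof -
    have "\<bar>c\<bar> * norm x \<le> norm (c *\<^sub>R x + z) + norm z"
      by (metis add_diff_cancel_right' norm_scaleR norm_triangle_ineq4)
    also have "\<dots> \<le> R + norm z" using R[OF that] by simp
    finally show ?thesis using assms by (simp add: field_simps)
  qed
  with assms show ?thesis by (auto simp: test_function_iff intro!: Ck_affine)
qed

lemma partial_zero_outside:
  assumes "\<And>x. \<phi> x \<noteq> 0 \<Longrightarrow> norm x \<le> R" "norm x > R"
  shows "partial i \<phi> x = 0"
proof -
  have "((\<lambda>x. 0) has_derivative (\<lambda>h. 0)) (at x)" by simp
  moreover have "open {y. norm y > R}" by (auto intro!: open_Collect_less continuous_intros)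
  ultimately have "(\<phi> has_derivative (\<lambda>h. 0)) (at x)"
    using assms by (intro has_derivative_transform_within_open[of "\<lambda>x. 0" _ _ _ "{y. norm y > R}" \<phi>]) force+
  from partial_eqI[OF this] show ?thesis by simp
qed

lemma test_function_partial: "test_function \<phi> \<Longrightarrow> test_function (partial i \<phi>)"
  unfolding test_function_iff using partial_zero_outside Ck.simps(2)
  by (metis leI)

lemma test_function_bounded:
  assumes "test_function \<phi>" obtains M where "\<And>x. \<bar>\<phi> x\<bar> \<le> M" "M \<ge> 0"
proof -
  obtain R where R: "\<And>x. \<phi> x \<noteq> 0 \<Longrightarrow> norm x \<le> R" using assms by (auto simp: test_function_iff)
  have "compact (\<phi> ` cball 0 R)"
    using continuous_on_subset[OF test_function_D(2)[OF assms]] by (intro compact_continuous_image) auto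
  then obtain M where M: "\<And>x. x \<in> cball 0 R \<Longrightarrow> \<bar>\<phi> x\<bar> \<le> M"
    using compact_imp_bounded bounded_iff by (metis image_eqI real_norm_def)
  have "\<bar>\<phi> x\<bar> \<le> max M 0" for x using M[of x] R[of x] by (cases "\<phi> x = 0") auto
  then show ?thesis using that by (meson max.cobounded2)
qed

lemma test_function_measurable: "test_function \<phi> \<Longrightarrow> \<phi> \<in> borel_measurable borel"
  by (intro borel_measurable_continuous_onI test_function_D)

text \<open>Each factor tends to \<open>1\<close> from below on its half-space and vanishes on the complement, so that these
  test functions approximate the indicator of the open box boundedly.\<close>

definition box_bump :: "real^'n \<Rightarrow> real^'n \<Rightarrow> nat \<Rightarrow> real^'n \<Rightarrow> real" where
  "box_bump a b n x =
     (\<Prod>i\<in>UNIV. bump 0 (real n * x $ i + - real n * a $ i) * bump 0 (- real n * x $ i + real n * b $ i))"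

lemma bump_0_le_1: "bump 0 t \<le> 1" by (simp add: bump_def)

lemma box_bump_bounds: "0 \<le> box_bump a b n x" "box_bump a b n x \<le> indicator (box a b) x"
proof -
  show "0 \<le> box_bump a b n x" unfolding box_bump_def by (intro prod_nonneg) (auto simp: bump_bound)
  show "box_bump a b n x \<le> indicator (box a b) x"
  proof (cases "x \<in> box a b")
    case True
    then show ?thesis unfolding box_bump_def
      by (auto intro!: prod_le_1 mult_le_one mult_nonneg_nonneg simp: bump_bound bump_0_le_1)
  next
    case False
    then obtain i where "x $ i \<le> a $ i \<or> b $ i \<le> x $ i" by (auto simp: mem_box_cart not_less)
    then have "real n * (x $ i - a $ i) \<le> 0 \<or> real n * (b $ i - x $ i) \<le> 0"
      by (auto simp: mult_nonneg_nonpos)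
    then have "bump 0 (real n * x $ i + - real n * a $ i) * bump 0 (- real n * x $ i + real n * b $ i) = 0"
      by (auto simp: bump_def algebra_simps)
    then have "box_bump a b n x = 0" unfolding box_bump_def by (intro prod_zero) auto
    then show ?thesis by simp
  qed
qed

lemma test_function_box_bump: "test_function (box_bump a b n)"
proof -
  have "Ck k (box_bump a b n)" for k
    unfolding box_bump_def[abs_def] by (intro Ck_prod Ck_mult Ck_bump) auto
  moreover obtain R where "\<And>x. x \<in> box a b \<Longrightarrow> norm x \<le> R"
    using bounded_box[of a b] by (auto simp: bounded_iff)
  moreover have "box_bump a b n x \<noteq> 0 \<Longrightarrow> x \<in> box a b" for x
    using box_bump_bounds[where a=a and b=b and n=n and x=x] by (auto split: split_indicator_asm)
  ultimately show ?thesis unfolding test_function_iff by blast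
qed

lemma box_bump_tendsto: "(\<lambda>n. box_bump a b n x) \<longlonglongrightarrow> indicator (box a b) x"
proof (cases "x \<in> box a b")
  case True
  have lim: "(\<lambda>n. bump 0 (real n * d)) \<longlonglongrightarrow> 1" if "d > 0" for d
  proof -
    have "(\<lambda>n. exp (- (1 / d) * (1 / real n))) \<longlonglongrightarrow> exp (- (1 / d) * 0)"
      by (intro tendsto_intros lim_1_over_n)
    moreover have "\<forall>\<^sub>F n in sequentially. exp (- (1 / d) * (1 / real n)) = bump 0 (real n * d)"
      using that by (intro eventually_mono[OF eventually_gt_at_top[of 0]]) (simp add: bump_def field_simps)
    ultimately show ?thesis using Lim_transform_eventually by force
  qed
  have "(\<lambda>n. \<Prod>i\<in>UNIV. bump 0 (real n * (x $ i - a $ i)) * bump 0 (real n * (b $ i - x $ i)))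
     \<longlonglongrightarrow> (\<Prod>i\<in>(UNIV::'a set). 1 * 1)"
    using True by (intro tendsto_prod tendsto_mult lim) (auto simp: mem_box_cart)
  then show ?thesis using True by (simp add: box_bump_def[abs_def] algebra_simps)
next
  case False
  then have "box_bump a b n x = 0" for n
    using box_bump_bounds[where a=a and b=b and n=n and x=x] by simp
  with False show ?thesis by simp
qed


section \<open>Local integrability and the fundamental lemma\<close>

definition loc_integrable :: "(real^'n \<Rightarrow> real) \<Rightarrow> bool" where
  "loc_integrable f \<longleftrightarrow> f \<in> borel_measurable borel \<and> (\<forall>R. set_integrable lborel (cball 0 R) f)"

lemma loc_integrable_measurable [measurable_dest]:
  "loc_integrable f \<Longrightarrow> f \<in> borel_measurable borel"
  by (simp add: loc_integrable_def)

lemma loc_integrable_bounded_support: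
  assumes f: "loc_integrable f" and [measurable]: "k \<in> borel_measurable borel"
    and M: "\<And>x. \<bar>k x\<bar> \<le> M" and R: "\<And>x. k x \<noteq> 0 \<Longrightarrow> norm x \<le> R"
  shows "integrable lborel (\<lambda>x. k x * f x)"
proof -
  have [measurable]: "f \<in> borel_measurable borel" using f by (rule loc_integrable_measurable)
  have "M \<ge> 0" using M[of 0] by linarith
  have "integrable lborel (\<lambda>x. M * (indicator (cball 0 R) x *\<^sub>R f x))"
    using f by (auto simp: loc_integrable_def set_integrable_def)
  then show ?thesis
  proof (rule Bochner_Integration.integrable_bound)
    show "AE x in lborel. norm (k x * f x) \<le> norm (M * (indicator (cball 0 R) x *\<^sub>R f x))"
    proof (rule AE_I2)
      fix x
      show "norm (k x * f x) \<le> norm (M * (indicator (cball 0 R) x *\<^sub>R f x))"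
        using M[of x] R[of x] \<open>M \<ge> 0\<close>
        by (cases "k x = 0") (auto simp: abs_mult intro!: mult_right_mono)
    qed
  qed simp
qed

lemma loc_integrable_test_function:
  assumes "loc_integrable f" "test_function \<phi>"
  shows "integrable lborel (\<lambda>x. \<phi> x * f x)"
proof -
  obtain M where "\<And>x. \<bar>\<phi> x\<bar> \<le> M" using test_function_bounded[OF assms(2)] by blast
  moreover obtain R where "\<And>x. \<phi> x \<noteq> 0 \<Longrightarrow> norm x \<le> R" using assms by (auto simp: test_function_iff)
  ultimately show ?thesis
    using assms by (intro loc_integrable_bounded_support[of f \<phi> M R] test_function_measurable) auto
qed

lemma fundamental_lemma_boxes:
  assumes h: "loc_integrable h"
    and z: "\<And>\<phi>. test_function \<phi> \<Longrightarrow> (LINT x|lborel. \<phi> x * h x) = 0"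
  shows "(LINT x|lborel. indicator (box a b) x * h x) = 0"
proof -
  obtain R where R: "\<And>x. x \<in> box a b \<Longrightarrow> norm x \<le> R"
    using bounded_box[of a b] by (auto simp: bounded_iff)
  have [measurable]: "h \<in> borel_measurable borel" using h by (rule loc_integrable_measurable)
  have [measurable]: "box_bump a b n \<in> borel_measurable borel" for n
    by (rule test_function_measurable[OF test_function_box_bump])
  have int: "integrable lborel (\<lambda>x. indicator (box a b) x * h x)"
    using R by (intro loc_integrable_bounded_support[OF h, of _ 1 R]) (auto split: split_indicator_asm)
  have "(\<lambda>n. LINT x|lborel. box_bump a b n x * h x) \<longlonglongrightarrow> (LINT x|lborel. indicator (box a b) x * h x)"
  proof (rule integral_dominated_convergence[where w="\<lambda>x. norm (indicator (box a b) x * h x)"])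
    show "AE x in lborel. (\<lambda>n. box_bump a b n x * h x) \<longlonglongrightarrow> indicator (box a b) x * h x"
      by (intro AE_I2 tendsto_intros box_bump_tendsto)
    show "AE x in lborel. norm (box_bump a b n x * h x) \<le> norm (indicator (box a b) x * h x)" for n
      using box_bump_bounds[of a b n]
      by (intro AE_I2) (auto simp: abs_mult intro!: mult_right_mono)
  qed (use int in auto)
  then show ?thesis by (simp add: z[OF test_function_box_bump] LIMSEQ_const_iff)
qed

text \<open>Vanishing on all boxes makes the positive and the negative part define the same measure.\<close>

lemma fundamental_lemma:
  fixes h :: "real^'n \<Rightarrow> real"
  assumes h: "loc_integrable h"
    and z: "\<And>\<phi>. test_function \<phi> \<Longrightarrow> (LINT x|lborel. \<phi> x * h x) = 0"
  shows "AE x in lborel. h x = 0"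
proof -
  have hm [measurable]: "h \<in> borel_measurable borel" using h by (rule loc_integrable_measurable)
  have loc: "AE x in lborel. indicator (cball 0 R) x * h x = 0" if "R > 0" for R :: real
  proof -
    define B where "B = (box (- (\<chi> i. R + 1)) (\<chi> i. R + 1) :: (real^'n) set)"
    have cball: "cball 0 R \<subseteq> B"
    proof
      fix x :: "real^'n" assume "x \<in> cball 0 R"
      then have "\<bar>x $ i\<bar> \<le> R" for i using component_le_norm_cart[of x i] by auto
      then show "x \<in> B" using that by (auto simp: B_def mem_box_cart abs_le_iff)
        (smt (verit, best))+
    qed
    obtain R' where R': "\<And>x. x \<in> B \<Longrightarrow> norm x \<le> R'"
      using bounded_box unfolding B_def bounded_iff by blast
    have [measurable]: "B \<in> sets borel" by (simp add: B_def)
    define P where "P = (\<lambda>x. ennreal (indicator B x * h x))"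
    define N where "N = (\<lambda>x. ennreal (- (indicator B x * h x)))"
    have [measurable]: "P \<in> borel_measurable borel" "N \<in> borel_measurable borel" by (auto simp: P_def N_def)
    have int: "integrable lborel (\<lambda>x. indicator B x * h x)"
      using R' by (intro loc_integrable_bounded_support[OF h, of _ 1 R']) (auto split: split_indicator_asm)
    have fin: "integral\<^sup>N lborel P \<noteq> \<infinity>" "integral\<^sup>N lborel N \<noteq> \<infinity>"
      using int unfolding P_def N_def real_integrable_def by auto
    have "density lborel P = density lborel N"
    proof (rule measure_eqI_generator_eq)
      let ?E = "range (\<lambda>(a, b). box a b::(real^'n) set)"
      show "Int_stable ?E" by (auto simp: Int_stable_def box_Int_box)
      show "?E \<subseteq> Pow UNIV" "sets (density lborel P) = sigma_sets UNIV ?E"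
        "sets (density lborel N) = sigma_sets UNIV ?E"
        by (simp_all add: borel_eq_box)
      let ?A = "\<lambda>n::nat. box (- (real n *\<^sub>R One)) (real n *\<^sub>R One) :: (real^'n) set"
      show "range ?A \<subseteq> ?E" "(\<Union>i. ?A i) = UNIV"
        unfolding UN_box_eq_UNIV by auto
      show "emeasure (density lborel P) (?A i) \<noteq> \<infinity>" for i
      proof -
        have "emeasure (density lborel P) (?A i) \<le> integral\<^sup>N lborel P"
          by (auto simp: emeasure_density intro!: nn_integral_mono split: split_indicator)
        with fin show ?thesis by (auto simp: top_unique)
      qed
      show "emeasure (density lborel P) X = emeasure (density lborel N) X" if "X \<in> ?E" for X
      proof -
        have [measurable]: "X \<in> sets borel" using that by auto
        from that obtain ab where "X = (case ab of (l, u) \<Rightarrow> box l u)" by blast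
        then have "X = box (fst ab) (snd ab)" by (simp add: case_prod_beta)
        from box_Int_box[of "fst ab" "snd ab" "- (\<chi> i. R + 1)" "\<chi> i. R + 1", folded B_def this]
        obtain a b where "X \<inter> B = box a b" by (rule that)
        with fundamental_lemma_boxes[OF h z]
        have "(LINT x|lborel. indicator (X \<inter> B) x * h x) = 0" by simp
        moreover have *: "(\<lambda>x. indicator (X \<inter> B) x * h x) = (\<lambda>x. indicator X x *\<^sub>R (indicator B x * h x))"
          by (auto split: split_indicator)
        moreover have int_X: "integrable lborel (\<lambda>x. indicator X x *\<^sub>R (indicator B x * h x))"
          by (rule integrable_mult_indicator[OF _ int]) simp
        moreover have "(\<integral>\<^sup>+x. ennreal (indicator X x *\<^sub>R (indicator B x * h x)) \<partial>lborel) = emeasure (density lborel P) X"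
          by (auto simp: emeasure_density P_def intro!: nn_integral_cong split: split_indicator)
        moreover have "(\<integral>\<^sup>+x. ennreal (- (indicator X x *\<^sub>R (indicator B x * h x))) \<partial>lborel) = emeasure (density lborel N) X"
          by (auto simp: emeasure_density N_def intro!: nn_integral_cong split: split_indicator)
        ultimately have "enn2real (emeasure (density lborel P) X) = enn2real (emeasure (density lborel N) X)"
          "emeasure (density lborel P) X \<noteq> \<infinity>" "emeasure (density lborel N) X \<noteq> \<infinity>"
          using real_lebesgue_integral_def[OF int_X] int_X unfolding real_integrable_def by auto
        then show ?thesis by (metis ennreal_enn2real infinity_ennreal_def less_top)
      qed
    qed
    then have "AE x in lborel. P x = N x"
      using fin by (subst (asm) finite_density_unique) auto
    then show ?thesis
    proof eventually_elim
      case (elim x)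
      then have "indicator B x * h x = 0"
        by (cases "indicator B x * h x \<ge> 0") (auto simp: P_def N_def ennreal_eq_0_iff ennreal_neg)
      then show ?case using cball by (auto split: split_indicator_asm split: split_indicator)
    qed
  qed
  have "AE x in lborel. \<forall>n::nat. indicator (cball 0 (real (Suc n))) x * h x = 0"
    using loc by (intro AE_all_countable[THEN iffD2] allI) simp
  then show ?thesis
  proof eventually_elim
    case (elim x)
    obtain n where "norm x \<le> real n" using real_arch_simple by blast
    with elim[rule_format, of n] show ?case by simp
  qed
qed

section \<open>Affine substitutions\<close>

lemma borel_measurable_indicator_cball [measurable]:
  "(indicator (cball 0 R) :: 'a::euclidean_space \<Rightarrow> real) \<in> borel_measurable borel"
  by (rule borel_measurable_indicator) simp

lemma nn_integral_affine:
  fixes f :: "real^'n \<Rightarrow> ennreal"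
  assumes [measurable]: "f \<in> borel_measurable borel" and c: "c \<noteq> 0"
  shows "(\<integral>\<^sup>+x. f (c *\<^sub>R x + z) \<partial>lborel) = ennreal (1 / \<bar>c\<bar> ^ CARD('n)) * (\<integral>\<^sup>+x. f x \<partial>lborel)"
proof -
  have "(\<integral>\<^sup>+x. f x \<partial>lborel) = ennreal (\<bar>c\<bar> ^ CARD('n)) * (\<integral>\<^sup>+x. f (c *\<^sub>R x + z) \<partial>lborel)"
    using c by (subst lborel_affine[OF c, of z])
      (simp add: nn_integral_density nn_integral_distr nn_integral_cmult add.commute)
  moreover have "ennreal (1 / \<bar>c\<bar> ^ CARD('n)) * ennreal (\<bar>c\<bar> ^ CARD('n)) = 1"
    using c by (subst ennreal_mult[symmetric]) auto
  ultimately show ?thesis by (simp add: mult.assoc[symmetric])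
qed

lemma integrable_affine:
  fixes f :: "real^'n \<Rightarrow> 'b::{banach,second_countable_topology}"
  assumes f: "integrable lborel f" and c: "c \<noteq> 0"
  shows "integrable lborel (\<lambda>x. f (c *\<^sub>R x + z))"
proof (rule integrableI_bounded)
  have [measurable]: "f \<in> borel_measurable borel" using f by (simp add: integrable_iff_bounded)
  show "(\<lambda>x. f (c *\<^sub>R x + z)) \<in> borel_measurable lborel" by measurable
  have "(\<integral>\<^sup>+x. norm (f x) \<partial>lborel) < \<infinity>" using f by (simp add: integrable_iff_bounded)
  then show "(\<integral>\<^sup>+x. norm (f (c *\<^sub>R x + z)) \<partial>lborel) < \<infinity>"
    using nn_integral_affine[of "\<lambda>x. norm (f x)" c z] c by (simp add: ennreal_mult_less_top)
qed

lemma integral_affine: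
  fixes f :: "real^'n \<Rightarrow> 'b::{banach,second_countable_topology}"
  assumes f: "integrable lborel f" and c: "c \<noteq> 0"
  shows "(LINT x|lborel. f (c *\<^sub>R x + z)) = (1 / \<bar>c\<bar> ^ CARD('n)) *\<^sub>R (LINT x|lborel. f x)"
proof -
  have [measurable]: "f \<in> borel_measurable borel" using f by (simp add: integrable_iff_bounded)
  have "(LINT x|lborel. f x) = (\<bar>c\<bar> ^ CARD('n)) *\<^sub>R (LINT x|lborel. f (c *\<^sub>R x + z))"
    using c integrable_affine[OF f c, of z] by (subst lborel_affine[OF c, of z])
      (simp add: integral_density integral_distr add.commute)
  then show ?thesis using c by simp
qed

lemma loc_integrable_affine:
  assumes f: "loc_integrable f" and c: "c \<noteq> 0"
  shows "loc_integrable (\<lambda>x. f (c *\<^sub>R x + z))"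
  unfolding loc_integrable_def
proof (intro conjI allI)
  have [measurable]: "f \<in> borel_measurable borel" using f by (rule loc_integrable_measurable)
  show "(\<lambda>x. f (c *\<^sub>R x + z)) \<in> borel_measurable borel" by measurable
  fix R :: real
  have "integrable lborel (\<lambda>x. indicator (cball 0 (\<bar>c\<bar> * R + norm z)) x *\<^sub>R f x)"
    using f by (simp add: loc_integrable_def set_integrable_def)
  from integrable_affine[OF this c, of z]
  show "set_integrable lborel (cball 0 R) (\<lambda>x. f (c *\<^sub>R x + z))"
    unfolding set_integrable_def
  proof (rule Bochner_Integration.integrable_bound, goal_cases)
    case 1
    show ?case unfolding indicator_def mem_cball_0 by measurable
  next
    case 2
    have "norm (c *\<^sub>R x + z) \<le> \<bar>c\<bar> * R + norm z" if "norm x \<le> R" for x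
    proof -
      have "norm (c *\<^sub>R x + z) \<le> \<bar>c\<bar> * norm x + norm z" by (metis norm_scaleR norm_triangle_ineq)
      with that show ?thesis by (smt (verit) abs_ge_zero mult_left_mono)
    qed
    then show ?case by (auto split: split_indicator)
  qed
qed

section \<open>Weak derivatives along linear flows\<close>

lemma frechet_expand:
  assumes "(\<phi> has_derivative D) (at (x::real^'n))"
  shows "D v = (\<Sum>i\<in>UNIV. v $ i * partial i \<phi> x)"
proof -
  interpret linear D using assms by (rule has_derivative_linear)
  have "D v = D (\<Sum>i\<in>UNIV. v $ i *\<^sub>R axis i 1)" by (metis basis_expansion scalar_mult_eq_scaleR)
  also have "\<dots> = (\<Sum>i\<in>UNIV. v $ i * D (axis i 1))" by (simp add: sum scale)
  finally show ?thesis by (simp add: partial_eqI[OF assms])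
qed

text \<open>The flow of the vector field \<open>x \<mapsto> c x + z\<close>. Translations (\<open>c = 0\<close>) and dilations
  (\<open>z = 0\<close>) are the two cases of interest, and in both \<open>exp (c * s) *\<^sub>R z = z\<close>.\<close>

definition flow :: "real \<Rightarrow> real^'n \<Rightarrow> real \<Rightarrow> real^'n \<Rightarrow> real^'n" where
  "flow c z s x = exp (c * s) *\<^sub>R x + s *\<^sub>R z"

lemma flow_0 [simp]: "flow c z 0 x = x" by (simp add: flow_def)

lemma exp_z:
  fixes z :: "real^'n"
  shows "c = 0 \<or> z = 0 \<Longrightarrow> exp (- (c * s)) *\<^sub>R z = z" by auto

lemma flow_inverse: "c = 0 \<or> z = 0 \<Longrightarrow> flow c z s (flow c z (- s) x) = x"
  by (auto simp: flow_def exp_minus)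

lemma norm_flow_le:
  assumes "\<bar>s\<bar> \<le> 1" shows "norm (flow c z s x) \<le> exp \<bar>c\<bar> * norm x + norm z"
proof -
  have "c * s \<le> \<bar>c\<bar>" 
    using assms mult_left_mono[of "\<bar>s\<bar>" 1 "\<bar>c\<bar>"] abs_ge_self[of "c * s"] by (simp add: abs_mult)
  then have "norm (exp (c * s) *\<^sub>R x) \<le> exp \<bar>c\<bar> * norm x" by (simp add: mult_right_mono)
  moreover have "norm (s *\<^sub>R z) \<le> norm z" using assms by (simp add: mult_left_le_one_le)
  ultimately show ?thesis unfolding flow_def by (smt (verit) norm_triangle_ineq)
qed

lemma borel_measurable_flow [measurable]:
  assumes [measurable]: "G \<in> borel_measurable borel"
  shows "(\<lambda>p. G (flow c z (fst p) (snd p))) \<in> borel_measurable (borel \<Otimes>\<^sub>M borel)"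
  unfolding flow_def by measurable

text \<open>The weak form of \<open>(c x + z) \<bullet> \<nabla>f = G\<close>; the term with \<open>CARD('n)\<close> is the divergence of the field.\<close>

definition weak_derivative_along ::
    "real \<Rightarrow> real^'n \<Rightarrow> (real^'n \<Rightarrow> real) \<Rightarrow> (real^'n \<Rightarrow> real) \<Rightarrow> bool" where
  "weak_derivative_along c z f G \<longleftrightarrow> loc_integrable f \<and> loc_integrable G \<and>
     (\<forall>\<phi>. test_function \<phi> \<longrightarrow>
        (LINT x|lborel. ((\<Sum>i\<in>UNIV. (c * x $ i + z $ i) * partial i \<phi> x) + real CARD('n) * c * \<phi> x) * f x)
        = - (LINT x|lborel. \<phi> x * G x))"

text \<open>On the unit time interval the flow moves balls into a fixed larger ball and changes volumes by a
  bounded factor, so local integrability survives averaging over time.\<close>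

lemma flow_integrable:
  fixes G :: "real^'n \<Rightarrow> real"
  assumes G: "loc_integrable G"
  shows "integrable (lborel \<Otimes>\<^sub>M lborel)
    (\<lambda>(s, x). indicator {0..1} s * (indicator (cball 0 R) x * G (flow c z s x)))"
proof (rule integrableI_bounded)
  have [measurable]: "G \<in> borel_measurable borel" using G by (rule loc_integrable_measurable)
  show m: "(\<lambda>(s, x). indicator {0..1} s * (indicator (cball 0 R) x * G (flow c z s x)))
      \<in> borel_measurable (lborel \<Otimes>\<^sub>M lborel)"
    unfolding case_prod_beta indicator_def mem_cball_0 by measurable
  define R' where "R' = exp \<bar>c\<bar> * R + norm z"
  define L where "L = (\<integral>\<^sup>+x. ennreal (indicator (cball 0 R') x * \<bar>G x\<bar>) \<partial>lborel)"
  have "L < \<infinity>"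
    using G by (simp add: loc_integrable_def set_integrable_def integrable_iff_bounded L_def abs_mult)
  have inner: "(\<integral>\<^sup>+x. ennreal (indicator (cball 0 R) x * \<bar>G (flow c z s x)\<bar>) \<partial>lborel)
      \<le> ennreal (exp (real CARD('n) * \<bar>c\<bar>)) * L" if s: "s \<in> {0..1}" for s
  proof -
    have "norm (flow c z s x) \<le> R'" if "norm x \<le> R" for x
    proof -
      have "norm (flow c z s x) \<le> exp \<bar>c\<bar> * norm x + norm z" using s by (intro norm_flow_le) auto
      moreover have "exp \<bar>c\<bar> * norm x \<le> exp \<bar>c\<bar> * R" using that by (intro mult_left_mono) auto
      ultimately show ?thesis unfolding R'_def by linarith
    qed
    then have "(\<integral>\<^sup>+x. ennreal (indicator (cball 0 R) x * \<bar>G (flow c z s x)\<bar>) \<partial>lborel)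
       \<le> (\<integral>\<^sup>+x. ennreal (indicator (cball 0 R') (flow c z s x) * \<bar>G (flow c z s x)\<bar>) \<partial>lborel)"
      by (auto intro!: nn_integral_mono split: split_indicator)
    also have "\<dots> = ennreal (1 / exp (c * s) ^ CARD('n)) * L"
      using borel_measurable_indicator_cball[of R']
      unfolding flow_def L_def by (subst nn_integral_affine[where f="\<lambda>x. ennreal (indicator (cball 0 R') x * \<bar>G x\<bar>)"]) auto
    also have "\<dots> \<le> ennreal (exp (real CARD('n) * \<bar>c\<bar>)) * L"
    proof (intro mult_right_mono ennreal_leI)
      have "1 / exp (c * s) ^ CARD('n) = exp (real CARD('n) * (- (c * s)))"
        by (simp only: exp_of_nat_mult exp_minus power_inverse inverse_eq_divide power_one_over)
      also have "- (c * s) \<le> \<bar>c\<bar>"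
        using s mult_left_mono[of "\<bar>s\<bar>" 1 "\<bar>c\<bar>"] abs_ge_minus_self[of "c * s"] by (simp add: abs_mult)
      finally show "1 / exp (c * s) ^ CARD('n) \<le> exp (real CARD('n) * \<bar>c\<bar>)" by simp
    qed simp
    finally show ?thesis .
  qed
  have "(\<integral>\<^sup>+p. ennreal (norm (case p of (s, x) \<Rightarrow> indicator {0..1} s * (indicator (cball 0 R) x * G (flow c z s x)))) \<partial>(lborel \<Otimes>\<^sub>M lborel))
     = (\<integral>\<^sup>+s. \<integral>\<^sup>+x. ennreal (norm (indicator {0..1} s * (indicator (cball 0 R) x * G (flow c z s x)))) \<partial>lborel \<partial>lborel)"
    using m by (subst lborel.nn_integral_fst[symmetric]) (auto simp: case_prod_beta)
  also have "\<dots> \<le> (\<integral>\<^sup>+s. ennreal (exp (real CARD('n) * \<bar>c\<bar>)) * L * indicator {0..1::real} s \<partial>lborel)"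
  proof (intro nn_integral_mono)
    fix s :: real
    show "(\<integral>\<^sup>+x. ennreal (norm (indicator {0..1} s * (indicator (cball 0 R) x * G (flow c z s x)))) \<partial>lborel)
      \<le> ennreal (exp (real CARD('n) * \<bar>c\<bar>)) * L * indicator {0..1::real} s"
      using inner[of s] by (cases "s \<in> {0..1}") (auto simp: abs_mult)
  qed
  also have "\<dots> < \<infinity>" using \<open>L < \<infinity>\<close> by (simp add: nn_integral_cmult ennreal_mult_less_top)
  finally show "(\<integral>\<^sup>+p. ennreal (norm (case p of (s, x) \<Rightarrow> indicator {0..1} s * (indicator (cball 0 R) x * G (flow c z s x)))) \<partial>(lborel \<Otimes>\<^sub>M lborel)) < \<infinity>" .
qed

text \<open>The transported density solves the continuity equation. Since the field commutes with its own flow,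
  its derivative is the expression that \<open>weak_derivative_along\<close> tests, evaluated for the transported test
  function, up to sign and the volume factor of the flow.\<close>

lemma flow_transport_derivative:
  fixes z :: "real^'n"
  assumes \<phi>: "test_function \<phi>" and cz: "c = 0 \<or> z = 0"
  shows "((\<lambda>s. exp (- (real CARD('n) * c * s)) * \<phi> (flow c z (- s) y)) has_real_derivative
     - (exp (- (real CARD('n) * c * s)) * ((\<Sum>i\<in>UNIV. (c * y $ i + z $ i) * (exp (- (c * s)) * partial i \<phi> (flow c z (- s) y)))
        + real CARD('n) * c * \<phi> (flow c z (- s) y)))) (at s)"
proof -
  let ?D = "frechet_derivative \<phi> (at (flow c z (- s) y))"
  let ?v = "- (exp (- (c * s)) *\<^sub>R (c *\<^sub>R y + z))"
  have D: "(\<phi> has_derivative ?D) (at (flow c z (- s) y))"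
    using test_function_D(1)[OF \<phi>] frechet_derivative_works by blast
  have "((\<lambda>s. flow c z (- s) y) has_vector_derivative ?v) (at s)"
    unfolding flow_def using exp_z[OF cz, of s]
    by (auto intro!: derivative_eq_intros simp: algebra_simps)
  then have "((\<lambda>s. flow c z (- s) y) has_derivative (\<lambda>h. h *\<^sub>R ?v)) (at s)"
    by (simp add: has_vector_derivative_def)
  from has_derivative_compose[OF this D]
  have "((\<lambda>s. \<phi> (flow c z (- s) y)) has_derivative (\<lambda>h. ?D (h *\<^sub>R ?v))) (at s)" .
  moreover have "?D (h *\<^sub>R ?v) = h * - (\<Sum>i\<in>UNIV. (c * y $ i + z $ i) * (exp (- (c * s)) * partial i \<phi> (flow c z (- s) y)))" for h
    by (subst frechet_expand[OF D]) (simp add: sum_distrib_left sum_negf[symmetric] algebra_simps)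
  ultimately have "((\<lambda>s. \<phi> (flow c z (- s) y)) has_real_derivative
      - (\<Sum>i\<in>UNIV. (c * y $ i + z $ i) * (exp (- (c * s)) * partial i \<phi> (flow c z (- s) y)))) (at s)"
    (is "(_ has_real_derivative - ?S) _")
    unfolding has_field_derivative_def mult.commute[of "- ?S", abs_def]
    by (simp only: mult.commute[of "- ?S"])
  from DERIV_mult[OF _ this, of "\<lambda>s. exp (- (real CARD('n) * c * s))" "- (real CARD('n) * c) * exp (- (real CARD('n) * c * s))"]
  show ?thesis
    by (rule DERIV_cong) (auto intro!: derivative_eq_intros simp: algebra_simps)
qed


text \<open>Pair both sides with a test function \<open>\<phi>\<close>. By Fubini and a change of variables the right-hand side becomes
  the time integral of \<open>G\<close> against transported copies of \<open>\<phi>\<close>; the weak identity moves the derivative onto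
  these copies, and the fundamental theorem of calculus in time leaves the left-hand side. As \<open>\<phi>\<close> is
  arbitrary, the two sides agree almost everywhere.\<close>

theorem weak_flow:
  fixes f G :: "real^'n \<Rightarrow> real"
  assumes w: "weak_derivative_along c z f G" and cz: "c = 0 \<or> z = 0"
  shows "AE x in lborel. set_integrable lborel {0..1} (\<lambda>s. G (flow c z s x)) \<and>
     f (flow c z 1 x) - f x = (LINT s:{0..1}|lborel. G (flow c z s x))"
proof -
  have f: "loc_integrable f" and G: "loc_integrable G" using w by (auto simp: weak_derivative_along_def)
  have [measurable]: "f \<in> borel_measurable borel" "G \<in> borel_measurable borel"
    using f G by (auto intro: loc_integrable_measurable)
  define n where "n = real CARD('n)"
  define E where "E x = (LINT s|lborel. indicator {0..1} s * G (flow c z s x))" for x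
  define h where "h x = f (flow c z 1 x) - f x - E x" for x
  have int: "integrable (lborel \<Otimes>\<^sub>M lborel)
    (\<lambda>(s, x). indicator {0..1} s * (indicator (cball 0 R) x * G (flow c z s x)))" for R
    by (rule flow_integrable[OF G])
  have E_meas [measurable]: "E \<in> borel_measurable borel"
    unfolding E_def[abs_def] flow_def by measurable
  have E: "loc_integrable E"
    unfolding loc_integrable_def
  proof (intro conjI allI)
    fix R
    have "integrable lborel (\<lambda>x. LINT s|lborel. indicator {0..1} s * (indicator (cball 0 R) x * G (flow c z s x)))"
      by (rule lborel_pair.integrable_snd[OF int])
    also have "(\<lambda>x. LINT s|lborel. indicator {0..1} s * (indicator (cball 0 R) x * G (flow c z s x)))
      = (\<lambda>x. indicator (cball 0 R) x *\<^sub>R E x)"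
      by (rule ext) (auto simp: E_def split: split_indicator)
    finally show "set_integrable lborel (cball 0 R) E" by (simp add: set_integrable_def)
  qed simp
  have f1: "loc_integrable (\<lambda>x. f (flow c z 1 x))"
    unfolding flow_def by (rule loc_integrable_affine[OF f]) simp
  have h: "loc_integrable h"
    using f f1 E unfolding h_def loc_integrable_def by (auto intro!: set_integral_diff)
  have "(LINT x|lborel. \<phi> x * h x) = 0" if \<phi>: "test_function \<phi>" for \<phi>
  proof -
    obtain R where R: "\<And>x. \<phi> x \<noteq> 0 \<Longrightarrow> norm x \<le> R" using \<phi> by (auto simp: test_function_iff)
    obtain M where M: "\<And>x. \<bar>\<phi> x\<bar> \<le> M" "M \<ge> 0" using test_function_bounded[OF \<phi>] by blast
    have "\<exists>N. (\<forall>x. \<bar>partial i \<phi> x\<bar> \<le> N) \<and> N \<ge> 0" for i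
      using test_function_bounded[OF test_function_partial[OF \<phi>]] by blast
    then obtain N where N: "\<And>i x. \<bar>partial i \<phi> x\<bar> \<le> N i" "\<And>i. N i \<ge> 0" by metis
    have [measurable]: "\<phi> \<in> borel_measurable borel" "\<And>i. partial i \<phi> \<in> borel_measurable borel"
      by (intro test_function_measurable test_function_partial \<phi>)+
    define \<psi> where "\<psi> s y = \<phi> (flow c z (- s) y)" for s y
    define W where "W s y = exp (- (n * c * s)) * ((\<Sum>i\<in>UNIV. (c * y $ i + z $ i) * (exp (- (c * s)) * partial i \<phi> (flow c z (- s) y)))
        + n * c * \<psi> s y)" for s y
    have \<psi>_test: "test_function (\<psi> s)" for s
    proof -
      have "\<psi> s = (\<lambda>y. \<phi> (exp (- (c * s)) *\<^sub>R y + (- s) *\<^sub>R z))"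
        by (rule ext) (simp add: \<psi>_def flow_def)
      then show ?thesis using test_function_affine[OF \<phi>, of "exp (- (c * s))" "(- s) *\<^sub>R z"] by simp
    qed
    have \<psi>_partial: "partial i (\<psi> s) y = exp (- (c * s)) * partial i \<phi> (flow c z (- s) y)" for i s y
      unfolding \<psi>_def[abs_def] flow_def
      using partial_affine(2)[where c="exp (- (c * s))" and x=y and z="(- s) *\<^sub>R z" and i=i, OF test_function_D(1)[OF \<phi>]]
      by simp
    \<comment> \<open>The weak identity, tested against \<open>\<phi>\<close> transported by the flow.\<close>
    have inner: "(LINT x|lborel. \<phi> x * G (flow c z s x)) = - (LINT y|lborel. W s y * f y)" for s
    proof -
      have "(LINT x|lborel. \<phi> x * G (flow c z s x)) = (LINT x|lborel. \<psi> s (exp (c * s) *\<^sub>R x + s *\<^sub>R z) * G (exp (c * s) *\<^sub>R x + s *\<^sub>R z))"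
        using flow_inverse[OF cz, of "- s"] by (intro Bochner_Integration.integral_cong) (auto simp: \<psi>_def flow_def)
      also have "\<dots> = (1 / exp (c * s) ^ CARD('n)) * (LINT y|lborel. \<psi> s y * G y)"
        using integral_affine[OF loc_integrable_test_function[OF G \<psi>_test], of "exp (c * s)" s "s *\<^sub>R z"] by simp
      also have "1 / exp (c * s) ^ CARD('n) = exp (- (n * c * s))"
        by (simp add: n_def exp_minus inverse_eq_divide exp_of_nat_mult[symmetric] mult.assoc)
      also have "(LINT y|lborel. \<psi> s y * G y) =
          - (LINT y|lborel. ((\<Sum>i\<in>UNIV. (c * y $ i + z $ i) * partial i (\<psi> s) y) + n * c * \<psi> s y) * f y)"
        using w \<psi>_test by (simp add: weak_derivative_along_def n_def)
      finally show ?thesis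
        unfolding W_def \<psi>_partial mult.assoc by (simp add: mult.assoc)
    qed
    define R' where "R' = exp \<bar>c\<bar> * R + norm z"
    define K where "K = exp (n * \<bar>c\<bar>) * ((\<Sum>i\<in>UNIV. (\<bar>c\<bar> * R' + norm z) * (exp \<bar>c\<bar> * N i)) + n * \<bar>c\<bar> * M)"
    have W_supp: "W s y = 0" if s: "s \<in> {0..1}" and y: "R' < norm y" for s y
    proof -
      have far: "R < norm (flow c z (- s) y)"
      proof -
        have "R' < exp \<bar>c\<bar> * norm (flow c z (- s) y) + norm z"
          using norm_flow_le[of s c z "flow c z (- s) y"] s y flow_inverse[OF cz, of s y] by simp
        then have "exp \<bar>c\<bar> * R < exp \<bar>c\<bar> * norm (flow c z (- s) y)" unfolding R'_def by linarith
        then show ?thesis by simp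
      qed
      have p0: "partial i \<phi> (flow c z (- s) y) = 0" for i
        by (rule partial_zero_outside) (fact R, fact far)
      have "\<phi> (flow c z (- s) y) = 0" using R far not_le by blast
      then show ?thesis unfolding W_def \<psi>_def p0 by simp
    qed
    have n: "n \<ge> 0" by (simp add: n_def)
    have W_bound: "\<bar>W s y\<bar> \<le> K" if s: "s \<in> {0..1}" and "W s y \<noteq> 0" for s y
    proof -
      have y: "norm y \<le> R'" using W_supp[OF s, of y] that by force
      have cs: "- (c * s) \<le> \<bar>c\<bar>"
        using s mult_left_mono[of "\<bar>s\<bar>" 1 "\<bar>c\<bar>"] abs_ge_minus_self[of "c * s"] by (simp add: abs_mult)
      then have e1: "exp (- (n * c * s)) \<le> exp (n * \<bar>c\<bar>)"
        using mult_left_mono[OF cs n] by (simp add: mult.assoc)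
      have e2: "exp (- (c * s)) \<le> exp \<bar>c\<bar>" using cs by simp
      have v: "\<bar>c * y $ i + z $ i\<bar> \<le> \<bar>c\<bar> * R' + norm z" for i
      proof -
        have "\<bar>c * y $ i\<bar> \<le> \<bar>c\<bar> * R'"
          using component_le_norm_cart[of y i] y by (simp add: abs_mult mult_left_mono)
        then show ?thesis using component_le_norm_cart[of z i] by linarith
      qed
      have "\<bar>\<Sum>i\<in>UNIV. (c * y $ i + z $ i) * (exp (- (c * s)) * partial i \<phi> (flow c z (- s) y))\<bar>
         \<le> (\<Sum>i\<in>UNIV. (\<bar>c\<bar> * R' + norm z) * (exp \<bar>c\<bar> * N i))"
      proof (rule order_trans[OF sum_abs sum_mono])
        fix i
        show "\<bar>(c * y $ i + z $ i) * (exp (- (c * s)) * partial i \<phi> (flow c z (- s) y))\<bar>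
          \<le> (\<bar>c\<bar> * R' + norm z) * (exp \<bar>c\<bar> * N i)"
          unfolding abs_mult using v[of i] e2 N by (intro mult_mono) auto
      qed
      moreover have "\<bar>n * c * \<psi> s y\<bar> \<le> n * \<bar>c\<bar> * M"
        using M n by (simp add: abs_mult \<psi>_def mult_left_mono)
      ultimately have "\<bar>(\<Sum>i\<in>UNIV. (c * y $ i + z $ i) * (exp (- (c * s)) * partial i \<phi> (flow c z (- s) y))) + n * c * \<psi> s y\<bar>
        \<le> (\<Sum>i\<in>UNIV. (\<bar>c\<bar> * R' + norm z) * (exp \<bar>c\<bar> * N i)) + n * \<bar>c\<bar> * M"
        by linarith
      with e1 show ?thesis unfolding W_def K_def abs_mult by (intro mult_mono) auto
    qed
    have int_W: "integrable (lborel \<Otimes>\<^sub>M lborel) (\<lambda>(s, y). indicator {0..1} s * (W s y * f y))"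
    proof (rule Bochner_Integration.integrable_bound)
      show "integrable (lborel \<Otimes>\<^sub>M lborel) (\<lambda>p. K * (case p of (s::real, y) \<Rightarrow> indicator {0..1} s * (indicator (cball 0 R') y * f (flow 0 0 s y))))"
        using flow_integrable[OF f, of R' 0 0] by simp
      show "AE p in lborel \<Otimes>\<^sub>M lborel. norm (case p of (s, y) \<Rightarrow> indicator {0..1} s * (W s y * f y))
         \<le> norm (K * (case p of (s::real, y) \<Rightarrow> indicator {0..1} s * (indicator (cball 0 R') y * f (flow 0 0 s y))))"
      proof (intro AE_I2, clarify)
        fix s :: real and y
        show "norm (indicator {0..1} s * (W s y * f y))
         \<le> norm (K * (indicator {0..1} s * (indicator (cball 0 R') y * f (flow 0 0 s y))))"
        proof (cases "s \<in> {0..1} \<and> W s y \<noteq> 0")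
          case True
          then have "norm y \<le> R'" using W_supp[of s y] by force
          moreover have "\<bar>W s y\<bar> * \<bar>f y\<bar> \<le> \<bar>K\<bar> * \<bar>f y\<bar>"
            using W_bound[of s y] True by (intro mult_right_mono) auto
          ultimately show ?thesis using True by (simp add: flow_def abs_mult)
        next
          case False
          then have "indicator {0..1} s * (W s y * f y) = 0" by (auto split: split_indicator)
          then show ?thesis by (simp only: norm_zero norm_ge_zero)
        qed
      qed
      have fl: "(\<lambda>p. g (flow c z (- fst p) (snd p))) \<in> borel_measurable (lborel \<Otimes>\<^sub>M lborel)"
        if [measurable]: "g \<in> borel_measurable borel" for g :: "real^'n \<Rightarrow> real"
        unfolding flow_def by measurable
      have nth: "(\<lambda>p. snd p $ i) \<in> borel_measurable (lborel \<Otimes>\<^sub>M lborel)" for i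
        by (rule measurable_compose[OF measurable_snd])
          (simp add: borel_measurable_continuous_onI continuous_on_component)
      have "(\<lambda>p. W (fst p) (snd p)) \<in> borel_measurable (lborel \<Otimes>\<^sub>M lborel)"
        unfolding W_def \<psi>_def
        by (intro borel_measurable_times borel_measurable_add borel_measurable_sum borel_measurable_const
            fl nth test_function_measurable test_function_partial \<phi>) measurable
      then show "(\<lambda>(s, y). indicator {0..1} s * (W s y * f y)) \<in> borel_measurable (lborel \<Otimes>\<^sub>M lborel)"
        unfolding case_prod_beta by measurable
    qed
    have int_\<phi>: "integrable (lborel \<Otimes>\<^sub>M lborel) (\<lambda>(s, x). indicator {0..1} s * (\<phi> x * G (flow c z s x)))"
    proof (rule Bochner_Integration.integrable_bound)
      show "integrable (lborel \<Otimes>\<^sub>M lborel) (\<lambda>p. M * (case p of (s, x) \<Rightarrow> indicator {0..1} s * (indicator (cball 0 R) x * G (flow c z s x))))"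
        using int by simp
      show "AE p in lborel \<Otimes>\<^sub>M lborel. norm (case p of (s, x) \<Rightarrow> indicator {0..1} s * (\<phi> x * G (flow c z s x)))
         \<le> norm (M * (case p of (s, x) \<Rightarrow> indicator {0..1} s * (indicator (cball 0 R) x * G (flow c z s x))))"
      proof (intro AE_I2, clarify)
        fix s :: real and x
        show "norm (indicator {0..1} s * (\<phi> x * G (flow c z s x)))
         \<le> norm (M * (indicator {0..1} s * (indicator (cball 0 R) x * G (flow c z s x))))"
          using M R[of x]
          by (cases "s \<in> {0..1} \<and> \<phi> x \<noteq> 0") (auto simp: abs_mult intro!: mult_right_mono)
      qed
      show "(\<lambda>(s, x). indicator {0..1} s * (\<phi> x * G (flow c z s x))) \<in> borel_measurable (lborel \<Otimes>\<^sub>M lborel)"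
        unfolding flow_def case_prod_beta by measurable
    qed
    have ftc: "(LINT s|lborel. indicator {0..1} s * W s y) = \<phi> y - exp (- (n * c)) * \<psi> 1 y" for y
    proof -
      have "(LINT s|lborel. (- W s y) * indicator {0..1} s) = exp (- (n * c * 1)) * \<phi> (flow c z (- 1) y) - exp (- (n * c * 0)) * \<phi> (flow c z (- 0) y)"
      proof (rule integral_FTC_Icc_real)
        fix s
        show "((\<lambda>s. exp (- (n * c * s)) * \<phi> (flow c z (- s) y)) has_real_derivative - W s y) (at s)"
          using flow_transport_derivative[OF \<phi> cz, of y s] by (simp add: n_def W_def \<psi>_def)
        have c: "continuous_on UNIV (\<lambda>s. g (flow c z (- s) y))" if "test_function g" for g
          unfolding flow_def
          by (rule continuous_on_compose2[OF test_function_D(2)[OF that]]) (auto intro!: continuous_intros)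
        have "continuous_on UNIV (\<lambda>s. W s y)"
          unfolding W_def \<psi>_def
          by (intro continuous_on_mult continuous_on_add continuous_on_sum continuous_on_const
              c[OF \<phi>] c[OF test_function_partial[OF \<phi>]] continuous_on_exp continuous_on_minus continuous_on_id)
        then show "isCont (\<lambda>s. - W s y) s" by (simp add: continuous_on_eq_continuous_at)
      qed simp
      then show ?thesis by (simp add: \<psi>_def mult.commute)
    qed
    have "(LINT x|lborel. \<phi> x * E x) = (LINT x|lborel. LINT s|lborel. indicator {0..1} s * (\<phi> x * G (flow c z s x)))"
      unfolding E_def by (subst integral_mult_right_zero[symmetric]) (simp add: mult.left_commute)
    also have "\<dots> = (LINT s|lborel. LINT x|lborel. indicator {0..1} s * (\<phi> x * G (flow c z s x)))"
      by (rule lborel_pair.Fubini_integral[OF int_\<phi>])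
    also have "\<dots> = - (LINT s|lborel. LINT y|lborel. indicator {0..1} s * (W s y * f y))"
      by (simp add: inner)
    also have "(LINT s|lborel. LINT y|lborel. indicator {0..1} s * (W s y * f y)) =
       (LINT y|lborel. LINT s|lborel. indicator {0..1} s * (W s y * f y))"
      by (rule lborel_pair.Fubini_integral[OF int_W, symmetric])
    also have "(\<lambda>y. LINT s|lborel. indicator {0..1} s * (W s y * f y)) = (\<lambda>y. (\<phi> y - exp (- (n * c)) * \<psi> 1 y) * f y)"
      unfolding ftc[symmetric] by (simp add: mult.assoc[symmetric])
    also have "(LINT y|lborel. (\<phi> y - exp (- (n * c)) * \<psi> 1 y) * f y) =
       (LINT y|lborel. \<phi> y * f y) - exp (- (n * c)) * (LINT y|lborel. \<psi> 1 y * f y)"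
      using loc_integrable_test_function[OF f \<phi>] loc_integrable_test_function[OF f \<psi>_test[of 1]]
      by (simp add: left_diff_distrib mult.assoc)
    also have "exp (- (n * c)) * (LINT y|lborel. \<psi> 1 y * f y) = (LINT x|lborel. \<phi> x * f (flow c z 1 x))"
    proof -
      have "(LINT x|lborel. \<phi> x * f (flow c z 1 x)) = (LINT x|lborel. \<psi> 1 (exp (c * 1) *\<^sub>R x + 1 *\<^sub>R z) * f (exp (c * 1) *\<^sub>R x + 1 *\<^sub>R z))"
        using flow_inverse[OF cz, of "- 1"] by (intro Bochner_Integration.integral_cong) (auto simp: \<psi>_def flow_def)
      also have "\<dots> = (1 / exp (c * 1) ^ CARD('n)) * (LINT y|lborel. \<psi> 1 y * f y)"
        using integral_affine[OF loc_integrable_test_function[OF f \<psi>_test], of "exp (c * 1)" 1 "1 *\<^sub>R z"] by simp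
      also have "1 / exp (c * 1) ^ CARD('n) = exp (- (n * c))"
        by (simp add: n_def exp_minus inverse_eq_divide exp_of_nat_mult[symmetric] mult.assoc)
      finally show ?thesis by simp
    qed
    finally have "(LINT x|lborel. \<phi> x * E x) = (LINT x|lborel. \<phi> x * f (flow c z 1 x)) - (LINT y|lborel. \<phi> y * f y)"
      by simp
    then show ?thesis
      using loc_integrable_test_function[OF f \<phi>] loc_integrable_test_function[OF f1 \<phi>] loc_integrable_test_function[OF E \<phi>]
      by (simp add: h_def right_diff_distrib)
  qed
  from fundamental_lemma[OF h this] have 1: "AE x in lborel. h x = 0" .
  have 2: "AE x in lborel. \<forall>k::nat. integrable lborel (\<lambda>s. indicator {0..1} s * (indicator (cball 0 (real k)) x * G (flow c z s x)))"
    by (intro AE_all_countable[THEN iffD2] allI lborel_pair.AE_integrable_snd[OF int])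
  from 1 2 show ?thesis
  proof eventually_elim
    case (elim x)
    obtain k where "norm x \<le> real k" using real_arch_simple by blast
    with elim(2)[rule_format, of k] elim(1) show ?case
      by (simp add: set_integrable_def set_lebesgue_integral_def h_def E_def)
  qed
qed

section \<open>Pairings over balls and the Newtonian kernel\<close>

lemma weighted_am_gm3:
  fixes x y z \<alpha> \<beta> \<gamma> :: real
  assumes "x > 0" "y > 0" "z > 0" "\<alpha> \<ge> 0" "\<beta> \<ge> 0" "\<gamma> \<ge> 0" "\<alpha> + \<beta> + \<gamma> = 1"
  shows "x powr \<alpha> * y powr \<beta> * z powr \<gamma> \<le> \<alpha> * x + \<beta> * y + \<gamma> * z"
proof -
  define m where "m = \<alpha> * ln x + \<beta> * ln y + \<gamma> * ln z"
  have *: "exp m * (1 + (ln t - m)) \<le> t" if "t > 0" for t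
  proof -
    have "exp m * (1 + (ln t - m)) \<le> exp m * exp (ln t - m)"
      by (intro mult_left_mono exp_ge_add_one_self) auto
    also have "\<dots> = t" using that by (simp add: exp_add[symmetric])
    finally show ?thesis .
  qed
  have "x powr \<alpha> * y powr \<beta> * z powr \<gamma> = exp m"
    using assms(1-3) unfolding m_def exp_add powr_def by simp
  also have "exp m = exp m * ((\<alpha> + \<beta> + \<gamma>) * (1 - m) + m)" unfolding assms(7) by simp
  also have "\<dots> = exp m * ((\<alpha> + \<beta> + \<gamma>) * (1 - m) + (\<alpha> * ln x + \<beta> * ln y + \<gamma> * ln z))"
    by (simp only: m_def)
  also have "\<dots> = \<alpha> * (exp m * (1 + (ln x - m))) + \<beta> * (exp m * (1 + (ln y - m))) + \<gamma> * (exp m * (1 + (ln z - m)))"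
    by (simp only: algebra_simps)
  also have "\<dots> \<le> \<alpha> * x + \<beta> * y + \<gamma> * z"
    using assms(1-6) by (intro add_mono mult_left_mono *)
  finally show ?thesis .
qed

text \<open>The exponents are chosen so that every product below carries two of the three powers whose
  integrals are known. This is Young's inequality for a trilinear form, before integration.\<close>

lemma young_pointwise:
  fixes f k h :: real
  assumes "f \<ge> 0" "k \<ge> 0" "h \<ge> 0" "a \<ge> 1" "r \<ge> 1" "b \<ge> 1" "1 / a + 1 / r + 1 / b = 2"
  shows "f * k * h \<le> (1 - 1 / b) * (f powr a * k powr r) + (1 - 1 / a) * (k powr r * h powr b)
      + (1 - 1 / r) * (f powr a * h powr b)"
proof (cases "f = 0 \<or> k = 0 \<or> h = 0")
  case True
  have "1 - 1 / b \<ge> 0" "1 - 1 / a \<ge> 0" "1 - 1 / r \<ge> 0" using assms by auto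
  with True assms show ?thesis by auto
next
  case False
  then have pos: "f > 0" "k > 0" "h > 0" using assms by auto
  have e: "a * (1 - 1 / b) + a * (1 - 1 / r) = 1" "r * (1 - 1 / b) + r * (1 - 1 / a) = 1"
    "b * (1 - 1 / a) + b * (1 - 1 / r) = 1"
  proof -
    have "1 - 1 / b + (1 - 1 / r) = 1 / a" "1 - 1 / b + (1 - 1 / a) = 1 / r" "1 - 1 / a + (1 - 1 / r) = 1 / b"
      using assms(7) by auto
    then show "a * (1 - 1 / b) + a * (1 - 1 / r) = 1" "r * (1 - 1 / b) + r * (1 - 1 / a) = 1"
      "b * (1 - 1 / a) + b * (1 - 1 / r) = 1"
      using assms by (simp_all only: distrib_left[symmetric]) auto
  qed
  have "(f powr a * k powr r) powr (1 - 1 / b) * (k powr r * h powr b) powr (1 - 1 / a)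
      * (f powr a * h powr b) powr (1 - 1 / r)
     = (f powr (a * (1 - 1 / b)) * f powr (a * (1 - 1 / r))) * (k powr (r * (1 - 1 / b)) * k powr (r * (1 - 1 / a)))
      * (h powr (b * (1 - 1 / a)) * h powr (b * (1 - 1 / r)))"
    using pos by (simp only: powr_mult powr_powr powr_ge_zero mult_ac)
  also have "\<dots> = f * k * h" using pos by (simp only: powr_add[symmetric] e powr_one less_imp_le)
  finally have "f * k * h = (f powr a * k powr r) powr (1 - 1 / b) * (k powr r * h powr b) powr (1 - 1 / a)
      * (f powr a * h powr b) powr (1 - 1 / r)" by simp
  also have "\<dots> \<le> (1 - 1 / b) * (f powr a * k powr r) + (1 - 1 / a) * (k powr r * h powr b)
      + (1 - 1 / r) * (f powr a * h powr b)"
    using assms pos by (intro weighted_am_gm3) auto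
  finally show ?thesis .
qed

abbreviation ball_vol :: real where "ball_vol \<equiv> unit_ball_vol 3"

lemma nn_integral_cball_indicator:
  assumes "s > 0"
  shows "(\<integral>\<^sup>+y. ennreal (indicator (cball (x::real^3) s) y) \<partial>lborel) = ennreal (ball_vol * s ^ 3)"
proof -
  have "(\<integral>\<^sup>+y. ennreal (indicator (cball x s) y) \<partial>lborel) = emeasure lborel (cball x s)"
    by (simp add: ennreal_indicator)
  also have "\<dots> = ennreal (ball_vol * s ^ 3)" using assms by (subst emeasure_cball) auto
  finally show ?thesis .
qed

lemma ball_pairing_measurable:
  fixes f H :: "real^3 \<Rightarrow> real"
  assumes [measurable]: "f \<in> borel_measurable borel" "H \<in> borel_measurable borel"
  shows "(\<lambda>p. ennreal (indicator (cball (fst p) s) (snd p) * (f (snd p) * H (fst p))))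
    \<in> borel_measurable (lborel \<Otimes>\<^sub>M lborel)"
  unfolding indicator_def mem_cball dist_norm by measurable

text \<open>After normalization, \<open>young_pointwise\<close> bounds the integrand by three products of two factors, and
  by Tonelli each product has integral at most \<open>1\<close>; the weights add up to \<open>1\<close>.\<close>

lemma ball_pairing:
  fixes f H :: "real^3 \<Rightarrow> real"
  assumes [measurable]: "f \<in> borel_measurable borel" "H \<in> borel_measurable borel"
    and pos: "\<And>x. 0 \<le> f x" "\<And>x. 0 \<le> H x" "s > 0" "F > 0" "G > 0"
    and ex: "a \<ge> 1" "r \<ge> 1" "b \<ge> 1" "1 / a + 1 / r + 1 / b = 2"
    and f: "(\<integral>\<^sup>+x. ennreal (f x powr a) \<partial>lborel) \<le> ennreal (F powr a)"
    and H: "(\<integral>\<^sup>+x. ennreal (H x powr b) \<partial>lborel) \<le> ennreal (G powr b)"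
  shows "(\<integral>\<^sup>+x. \<integral>\<^sup>+y. ennreal (indicator (cball x s) y * (f y * H x)) \<partial>lborel \<partial>lborel)
    \<le> ennreal (F * (ball_vol * s ^ 3) powr (1 / r) * G)"
proof -
  define v where "v = ball_vol * s ^ 3"
  define K where "K = v powr (1 / r)"
  have v: "v > 0" using pos by (simp add: v_def)
  have K: "K > 0" "K powr r = v" using v ex by (auto simp: K_def powr_powr)
  define P where "P y = ennreal ((f y / F) powr a)" for y
  define Q where "Q x = ennreal ((H x / G) powr b)" for x
  define k where "k x y = ennreal (indicator (cball x s) y / v)" for x y :: "real^3"
  have [measurable]: "P \<in> borel_measurable borel" "Q \<in> borel_measurable borel"
    by (auto simp: P_def[abs_def] Q_def[abs_def])
  have km [measurable]: "(\<lambda>p. k (fst p) (snd p)) \<in> borel_measurable (lborel \<Otimes>\<^sub>M lborel)"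
    unfolding k_def indicator_def mem_cball dist_norm by measurable
  have P: "(\<integral>\<^sup>+y. P y \<partial>lborel) \<le> 1"
  proof -
    have "(\<integral>\<^sup>+y. P y \<partial>lborel) = (\<integral>\<^sup>+y. ennreal (f y powr a) * ennreal (1 / F powr a) \<partial>lborel)"
      using pos by (simp add: P_def powr_divide ennreal_mult[symmetric])
    also have "\<dots> = (\<integral>\<^sup>+y. ennreal (f y powr a) \<partial>lborel) * ennreal (1 / F powr a)"
      by (rule nn_integral_multc) measurable
    also have "\<dots> \<le> ennreal (F powr a) * ennreal (1 / F powr a)"
      by (intro mult_right_mono f) simp
    also have "\<dots> = 1" using pos by (simp add: ennreal_mult[symmetric])
    finally show ?thesis .
  qed
  have Q: "(\<integral>\<^sup>+x. Q x \<partial>lborel) \<le> 1"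
  proof -
    have "(\<integral>\<^sup>+y. Q y \<partial>lborel) = (\<integral>\<^sup>+y. ennreal (H y powr b) * ennreal (1 / G powr b) \<partial>lborel)"
      using pos by (simp add: Q_def powr_divide ennreal_mult[symmetric])
    also have "\<dots> = (\<integral>\<^sup>+y. ennreal (H y powr b) \<partial>lborel) * ennreal (1 / G powr b)"
      by (rule nn_integral_multc) measurable
    also have "\<dots> \<le> ennreal (G powr b) * ennreal (1 / G powr b)"
      by (intro mult_right_mono H) simp
    also have "\<dots> = 1" using pos by (simp add: ennreal_mult[symmetric])
    finally show ?thesis .
  qed
  have ky: "(\<integral>\<^sup>+y. k x y \<partial>lborel) = 1" for x
  proof -
    have "(\<integral>\<^sup>+y. k x y \<partial>lborel) = (\<integral>\<^sup>+y. ennreal (indicator (cball x s) y) * ennreal (1 / v) \<partial>lborel)"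
      using v by (simp add: k_def ennreal_mult[symmetric])
    also have "\<dots> = (\<integral>\<^sup>+y. ennreal (indicator (cball x s) y) \<partial>lborel) * ennreal (1 / v)"
      by (rule nn_integral_multc) (simp add: ennreal_indicator borel_measurable_indicator)
    also have "\<dots> = ennreal v * ennreal (1 / v)"
      using nn_integral_cball_indicator[OF pos(3), of x] by (simp add: v_def)
    also have "\<dots> = 1" using v by (simp add: ennreal_mult[symmetric])
    finally show ?thesis .
  qed
  have kx: "(\<integral>\<^sup>+x. k x y \<partial>lborel) = 1" for y
  proof -
    have "k x y = k y x" for x by (auto simp: k_def dist_commute indicator_def)
    then show ?thesis using ky by simp
  qed
  have k1: "(\<lambda>y. k x y) \<in> borel_measurable lborel" and k2: "(\<lambda>y. k y x) \<in> borel_measurable lborel" for x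
    unfolding k_def indicator_def mem_cball dist_norm by measurable
  define T where "T x = (\<integral>\<^sup>+y. P y * k x y \<partial>lborel)" for x
  have [measurable]: "T \<in> borel_measurable borel"
  proof -
    have "(\<lambda>(x, y). P y * k x y) \<in> borel_measurable (lborel \<Otimes>\<^sub>M lborel)"
      unfolding case_prod_beta by measurable
    then have "T \<in> borel_measurable lborel" unfolding T_def[abs_def] by (rule lborel.borel_measurable_nn_integral)
    then show ?thesis by simp
  qed
  have split: "ennreal (C * (\<alpha> * (p * j) + \<beta> * (j * q) + \<gamma> * (p * q))) =
      ennreal C * (ennreal \<alpha> * (ennreal p * ennreal j) + ennreal \<beta> * (ennreal j * ennreal q) + ennreal \<gamma> * (ennreal p * ennreal q))"
    if "C \<ge> 0" "\<alpha> \<ge> 0" "\<beta> \<ge> 0" "\<gamma> \<ge> 0" "p \<ge> 0" "j \<ge> 0" "q \<ge> 0" for C \<alpha> \<beta> \<gamma> p j q :: real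
    using that by (simp add: ennreal_mult ennreal_plus)
  have pw: "ennreal (indicator (cball x s) y * (f y * H x)) \<le>
     ennreal (F * K * G) * (ennreal (1 - 1 / b) * (P y * k x y) + ennreal (1 - 1 / a) * (k x y * Q x) + ennreal (1 - 1 / r) * (P y * Q x))"
    for x y
  proof -
    define i where "i = (indicator (cball x s) y :: real)"
    have i: "i \<ge> 0" by (simp add: i_def)
    have ipow: "(i / K) powr r = i / v" using K ex by (auto simp: i_def powr_divide split: split_indicator)
    have "i * (f y * H x) = F * K * G * ((f y / F) * (i / K) * (H x / G))" using pos K by (simp add: field_simps)
    also have "\<dots> \<le> F * K * G * ((1 - 1 / b) * ((f y / F) powr a * (i / K) powr r)
      + (1 - 1 / a) * ((i / K) powr r * (H x / G) powr b) + (1 - 1 / r) * ((f y / F) powr a * (H x / G) powr b))"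
      using pos K i ex by (intro mult_left_mono young_pointwise) auto
    finally have "ennreal (i * (f y * H x)) \<le> ennreal (F * K * G * ((1 - 1 / b) * ((f y / F) powr a * (i / v))
      + (1 - 1 / a) * ((i / v) * (H x / G) powr b) + (1 - 1 / r) * ((f y / F) powr a * (H x / G) powr b)))"
      unfolding ipow by (rule ennreal_leI)
    also have "\<dots> = ennreal (F * K * G) * (ennreal (1 - 1 / b) * (P y * k x y) + ennreal (1 - 1 / a) * (k x y * Q x) + ennreal (1 - 1 / r) * (P y * Q x))"
      unfolding P_def Q_def k_def i_def[symmetric] using pos K i ex v by (intro split) auto
    finally show ?thesis unfolding i_def .
  qed
  have c: "ennreal (1 - 1 / b) + ennreal (1 - 1 / a) + ennreal (1 - 1 / r) = 1"
  proof -
    have e: "1 - 1 / b + (1 - 1 / a) + (1 - 1 / r) = 1" using ex(4) by linarith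
    have "0 \<le> 1 - 1 / b" "0 \<le> 1 - 1 / a" "0 \<le> 1 - 1 / r" using ex(1-3) by simp_all
    then have "ennreal (1 - 1 / b + (1 - 1 / a) + (1 - 1 / r)) = ennreal (1 - 1 / b) + ennreal (1 - 1 / a) + ennreal (1 - 1 / r)"
      by (simp only: ennreal_plus add_nonneg_nonneg)
    then show ?thesis unfolding e by simp
  qed
  have "(\<integral>\<^sup>+x. \<integral>\<^sup>+y. ennreal (indicator (cball x s) y * (f y * H x)) \<partial>lborel \<partial>lborel)
    \<le> (\<integral>\<^sup>+x. \<integral>\<^sup>+y. ennreal (F * K * G) * (ennreal (1 - 1 / b) * (P y * k x y) + ennreal (1 - 1 / a) * (k x y * Q x) + ennreal (1 - 1 / r) * (P y * Q x)) \<partial>lborel \<partial>lborel)"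
    by (intro nn_integral_mono pw)
  also have "\<dots> = (\<integral>\<^sup>+x. ennreal (F * K * G) * (ennreal (1 - 1 / b) * T x + ennreal (1 - 1 / a) * Q x + ennreal (1 - 1 / r) * ((\<integral>\<^sup>+y. P y \<partial>lborel) * Q x)) \<partial>lborel)"
  proof (intro nn_integral_cong)
    fix x
    have [measurable]: "(\<lambda>y. P y * k x y) \<in> borel_measurable lborel" "(\<lambda>y. k x y * Q x) \<in> borel_measurable lborel"
      "(\<lambda>y. P y * Q x) \<in> borel_measurable lborel"
      using k1[of x] by measurable
    have "(\<integral>\<^sup>+y. k x y * Q x \<partial>lborel) = Q x" using nn_integral_multc[OF k1, of x "Q x"] ky[of x] by simp
    moreover have "(\<integral>\<^sup>+y. P y * Q x \<partial>lborel) = (\<integral>\<^sup>+y. P y \<partial>lborel) * Q x"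
      by (rule nn_integral_multc) simp
    ultimately show "(\<integral>\<^sup>+y. ennreal (F * K * G) * (ennreal (1 - 1 / b) * (P y * k x y) + ennreal (1 - 1 / a) * (k x y * Q x) + ennreal (1 - 1 / r) * (P y * Q x)) \<partial>lborel)
      = ennreal (F * K * G) * (ennreal (1 - 1 / b) * T x + ennreal (1 - 1 / a) * Q x + ennreal (1 - 1 / r) * ((\<integral>\<^sup>+y. P y \<partial>lborel) * Q x))"
      unfolding T_def by (subst nn_integral_cmult, measurable)+ (simp add: nn_integral_add nn_integral_cmult)
  qed
  also have "\<dots> = ennreal (F * K * G) * (ennreal (1 - 1 / b) * (\<integral>\<^sup>+x. T x \<partial>lborel)
     + ennreal (1 - 1 / a) * (\<integral>\<^sup>+x. Q x \<partial>lborel) + ennreal (1 - 1 / r) * ((\<integral>\<^sup>+y. P y \<partial>lborel) * (\<integral>\<^sup>+x. Q x \<partial>lborel)))"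
    by (simp add: nn_integral_cmult nn_integral_add)
  also have "(\<integral>\<^sup>+x. T x \<partial>lborel) = (\<integral>\<^sup>+y. \<integral>\<^sup>+x. P y * k x y \<partial>lborel \<partial>lborel)"
    unfolding T_def by (rule lborel_pair.Fubini'[symmetric]) (simp add: case_prod_beta)
  also have "\<dots> = (\<integral>\<^sup>+y. P y \<partial>lborel)"
    by (simp add: nn_integral_cmult[OF k2] kx)
  also have "ennreal (F * K * G) * (ennreal (1 - 1 / b) * (\<integral>\<^sup>+y. P y \<partial>lborel)
     + ennreal (1 - 1 / a) * (\<integral>\<^sup>+x. Q x \<partial>lborel) + ennreal (1 - 1 / r) * ((\<integral>\<^sup>+y. P y \<partial>lborel) * (\<integral>\<^sup>+x. Q x \<partial>lborel)))
    \<le> ennreal (F * K * G) * (ennreal (1 - 1 / b) * 1 + ennreal (1 - 1 / a) * 1 + ennreal (1 - 1 / r) * (1 * 1))"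
    by (intro mult_left_mono add_mono mult_mono P Q) auto
  also have "\<dots> = ennreal (F * K * G)" using c by simp
  finally show ?thesis by (simp add: K_def v_def)
qed

lemma nn_integral_powr_near_0:
  assumes "e > (-1::real)"
  shows "(\<integral>\<^sup>+s. ennreal (indicator {0<..1} s * s powr e) \<partial>lborel) = ennreal (1 / (e + 1))"
proof -
  have "((\<lambda>s. if s \<in> {0..1} then s powr e else 0) has_integral 1 / (e + 1)) UNIV"
    using has_integral_powr_from_0[OF assms, of 1] by (subst has_integral_restrict_UNIV) auto
  also have "(\<lambda>s. if s \<in> {0..1} then s powr e else 0) = (\<lambda>s. indicator {0<..1} s * s powr e)"
    by (rule ext) (auto simp: indicator_def)
  finally show ?thesis by (intro nn_integral_has_integral_lborel) auto
qed

lemma nn_integral_powr_at_infinity: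
  assumes "e < (-1::real)" "a > 0"
  shows "(\<integral>\<^sup>+s. ennreal (indicator {a..} s * s powr e) \<partial>lborel) = ennreal (- (a powr (e + 1)) / (e + 1))"
proof -
  have "((\<lambda>s. if s \<in> {a..} then s powr e else 0) has_integral - (a powr (e + 1)) / (e + 1)) UNIV"
    using has_integral_powr_to_inf[OF assms] by (subst has_integral_restrict_UNIV) auto
  also have "(\<lambda>s. if s \<in> {a..} then s powr e else 0) = (\<lambda>s. indicator {a..} s * s powr e)"
    by (rule ext) (auto simp: indicator_def)
  finally show ?thesis by (intro nn_integral_has_integral_lborel) auto
qed


lemma inverse_norm_layer_cake:
  assumes "d \<ge> 0"
  shows "ennreal (1 / d) \<le> (\<integral>\<^sup>+s. ennreal (indicator {0<..} s * s powr - 2) * ennreal (indicator {d..} s) \<partial>lborel)"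
proof (cases "d = 0")
  case False
  with assms have d: "d > 0" by simp
  have "ennreal (1 / d) = (\<integral>\<^sup>+s. ennreal (indicator {d..} s * s powr - 2) \<partial>lborel)"
    using d by (subst nn_integral_powr_at_infinity) (auto simp: powr_minus divide_inverse)
  also have "\<dots> = (\<integral>\<^sup>+s. ennreal (indicator {0<..} s * s powr - 2) * ennreal (indicator {d..} s) \<partial>lborel)"
    using d by (intro nn_integral_cong) (auto split: split_indicator)
  finally show ?thesis by simp
qed simp

text \<open>The kernel \<open>1 / norm x\<close> is only in weak \<open>L\<^sup>3\<close>. Decomposed into balls of radius \<open>s\<close>, it can be paired with
  \<open>f\<close> in \<open>L\<close> to the power \<open>3/2\<close> for \<open>s \<le> 1\<close>, which gives \<open>s powr (- 1/2)\<close>, and with \<open>f\<close> in \<open>L\<^sup>1\<close> for \<open>s \<ge> 1\<close>,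
  which gives \<open>s powr (- 3/2)\<close>; both are integrable.\<close>

lemma newton_pairing:
  fixes f H :: "real^3 \<Rightarrow> real"
  assumes [measurable]: "f \<in> borel_measurable borel" "H \<in> borel_measurable borel"
    and pos: "\<And>x. 0 \<le> f x" "\<And>x. 0 \<le> H x" "F > 0" "G > 0"
    and f: "(\<integral>\<^sup>+x. ennreal (f x powr (3/2)) \<partial>lborel) \<le> ennreal (F powr (3/2))"
      "(\<integral>\<^sup>+x. ennreal (f x) \<partial>lborel) \<le> ennreal F"
    and H: "(\<integral>\<^sup>+x. ennreal (H x powr (6/5)) \<partial>lborel) \<le> ennreal (G powr (6/5))"
  shows "(\<integral>\<^sup>+x. \<integral>\<^sup>+y. ennreal (f y * H x / norm (x - y)) \<partial>lborel \<partial>lborel)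
    \<le> ennreal (2 * (ball_vol powr (1/2) + ball_vol powr (1/6)) * F * G)"
proof -
  define w where "w s = ennreal (indicator {0<..} s * s powr - 2)" for s :: real
  define k where "k s x y = ennreal (indicator (cball x s) y * (f y * H x))" for s and x y :: "real^3"
  have [measurable]: "w \<in> borel_measurable borel" by (auto simp: w_def[abs_def])
  have km: "(\<lambda>p. k (fst p) (fst (snd p)) (snd (snd p))) \<in> borel_measurable (lborel \<Otimes>\<^sub>M (lborel \<Otimes>\<^sub>M lborel))"
    unfolding k_def indicator_def mem_cball dist_norm by measurable
  have km1: "(\<lambda>(s, y). w s * k s x y) \<in> borel_measurable (lborel \<Otimes>\<^sub>M lborel)" for x
  proof -
    have "(\<lambda>p. (fst p, x, snd p)) \<in> lborel \<Otimes>\<^sub>M lborel \<rightarrow>\<^sub>M lborel \<Otimes>\<^sub>M (lborel \<Otimes>\<^sub>M lborel)" by measurable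
    from measurable_compose[OF this km]
    have [measurable]: "(\<lambda>p. k (fst p) x (snd p)) \<in> borel_measurable (lborel \<Otimes>\<^sub>M lborel)" by simp
    show ?thesis unfolding case_prod_beta by measurable
  qed
  have km2: "(\<lambda>(s, x). \<integral>\<^sup>+y. w s * k s x y \<partial>lborel) \<in> borel_measurable (lborel \<Otimes>\<^sub>M lborel)"
  proof -
    have "(\<lambda>p. (fst (fst p), snd (fst p), snd p)) \<in> (lborel \<Otimes>\<^sub>M lborel) \<Otimes>\<^sub>M lborel \<rightarrow>\<^sub>M lborel \<Otimes>\<^sub>M (lborel \<Otimes>\<^sub>M lborel)" by measurable
    from measurable_compose[OF this km]
    have [measurable]: "(\<lambda>p. k (fst (fst p)) (snd (fst p)) (snd p)) \<in> borel_measurable ((lborel \<Otimes>\<^sub>M lborel) \<Otimes>\<^sub>M lborel)" by simp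
    have "(\<lambda>p. w (fst (fst p)) * k (fst (fst p)) (snd (fst p)) (snd p)) \<in> borel_measurable ((lborel \<Otimes>\<^sub>M lborel) \<Otimes>\<^sub>M lborel)" by measurable
    then have "(\<lambda>q. \<integral>\<^sup>+y. w (fst q) * k (fst q) (snd q) y \<partial>lborel) \<in> borel_measurable (lborel \<Otimes>\<^sub>M lborel)"
      by (intro lborel.borel_measurable_nn_integral) (simp add: case_prod_beta)
    then show ?thesis by (simp add: case_prod_beta)
  qed
  have km3: "(\<lambda>y. k s x y) \<in> borel_measurable lborel" for s x
    unfolding k_def indicator_def mem_cball dist_norm by measurable
  have km4: "(\<lambda>x. \<integral>\<^sup>+y. k s x y \<partial>lborel) \<in> borel_measurable lborel" for s
    using ball_pairing_measurable[of f H s] unfolding k_def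
    by (intro lborel.borel_measurable_nn_integral) (simp add: case_prod_beta)
  have layer: "ennreal (f y * H x / norm (x - y)) \<le> (\<integral>\<^sup>+s. w s * k s x y \<partial>lborel)" for x y
  proof -
    have "ennreal (f y * H x / norm (x - y)) = ennreal (1 / norm (x - y)) * ennreal (f y * H x)"
      using pos by (simp add: ennreal_mult[symmetric])
    also have "\<dots> \<le> (\<integral>\<^sup>+s. w s * ennreal (indicator {norm (x - y)..} s) \<partial>lborel) * ennreal (f y * H x)"
      unfolding w_def by (intro mult_right_mono inverse_norm_layer_cake) auto
    also have "\<dots> = (\<integral>\<^sup>+s. w s * ennreal (indicator {norm (x - y)..} s) * ennreal (f y * H x) \<partial>lborel)"
      by (rule nn_integral_multc[symmetric]) measurable
    also have "\<dots> = (\<integral>\<^sup>+s. w s * k s x y \<partial>lborel)"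
      by (intro nn_integral_cong) (auto simp: k_def dist_norm split: split_indicator)
    finally show ?thesis .
  qed
  define J where "J s = (\<integral>\<^sup>+x. \<integral>\<^sup>+y. k s x y \<partial>lborel \<partial>lborel)" for s
  have small: "J s \<le> ennreal (F * (ball_vol * s ^ 3) powr (1/2) * G)" if "s > 0" for s
    unfolding J_def k_def using that
    by (intro ball_pairing[where a="3/2" and b="6/5"] assms) auto
  have large: "J s \<le> ennreal (F * (ball_vol * s ^ 3) powr (1/6) * G)" if "s > 0" for s
    unfolding J_def k_def using that f pos
    by (intro ball_pairing[where a=1 and b="6/5"] assms) auto
  have "(\<integral>\<^sup>+x. \<integral>\<^sup>+y. ennreal (f y * H x / norm (x - y)) \<partial>lborel \<partial>lborel)
     \<le> (\<integral>\<^sup>+x. \<integral>\<^sup>+y. \<integral>\<^sup>+s. w s * k s x y \<partial>lborel \<partial>lborel \<partial>lborel)"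
    by (intro nn_integral_mono layer)
  also have "\<dots> = (\<integral>\<^sup>+x. \<integral>\<^sup>+s. \<integral>\<^sup>+y. w s * k s x y \<partial>lborel \<partial>lborel \<partial>lborel)"
    by (intro nn_integral_cong lborel_pair.Fubini' km1)
  also have "\<dots> = (\<integral>\<^sup>+s. \<integral>\<^sup>+x. \<integral>\<^sup>+y. w s * k s x y \<partial>lborel \<partial>lborel \<partial>lborel)"
    by (intro lborel_pair.Fubini' km2)
  also have "\<dots> = (\<integral>\<^sup>+s. w s * J s \<partial>lborel)"
    by (simp add: J_def nn_integral_cmult[OF km3] nn_integral_cmult[OF km4])
  also have "\<dots> \<le> (\<integral>\<^sup>+s. ennreal (ball_vol powr (1/2) * F * G) * ennreal (indicator {0<..1} s * s powr (- 1/2))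
      + ennreal (ball_vol powr (1/6) * F * G) * ennreal (indicator {1..} s * s powr (- 3/2)) \<partial>lborel)"
  proof (intro nn_integral_mono)
    fix s :: real
    have pw: "w s * J s \<le> ennreal (ball_vol powr (1/r) * F * G) * ennreal (s powr (3/r - 2))"
      if "J s \<le> ennreal (F * (ball_vol * s ^ 3) powr (1/r) * G)" "s > 0" "r > 0" for r
    proof -
      have "(ball_vol * s ^ 3) powr (1/r) = ball_vol powr (1/r) * s powr (3/r)"
      proof -
        have "s ^ 3 = s powr 3" using that by simp
        then show ?thesis using that by (simp only: powr_mult powr_powr unit_ball_vol_nonneg) simp
      qed
      moreover have "s powr (3/r - 2) = s powr - 2 * s powr (3/r)" 
        by (subst powr_add[symmetric]) (simp add: algebra_simps)
      ultimately have e: "s powr - 2 * (F * (ball_vol * s ^ 3) powr (1/r) * G) = ball_vol powr (1/r) * F * G * s powr (3/r - 2)"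
        by simp
      have "w s * J s \<le> ennreal (s powr - 2) * ennreal (F * (ball_vol * s ^ 3) powr (1/r) * G)"
        using that by (intro mult_mono) (auto simp: w_def)
      also have "\<dots> = ennreal (ball_vol powr (1/r) * F * G) * ennreal (s powr (3/r - 2))"
        using pos by (simp add: ennreal_mult[symmetric] e del: powr_minus)
      finally show ?thesis .
    qed
    consider "s \<le> 0" | "0 < s" "s \<le> 1" | "s > 1" by linarith
    then show "w s * J s \<le> ennreal (ball_vol powr (1/2) * F * G) * ennreal (indicator {0<..1} s * s powr (- 1/2))
      + ennreal (ball_vol powr (1/6) * F * G) * ennreal (indicator {1..} s * s powr (- 3/2))"
    proof cases
      case 1
      then show ?thesis by (simp add: w_def)
    next
      case 2
      then show ?thesis using pw[OF small] by (intro add_increasing2) auto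
    next
      case 3
      then show ?thesis using pw[OF large] by (intro add_increasing) auto
    qed
  qed
  also have "\<dots> = ennreal (ball_vol powr (1/2) * F * G) * ennreal 2 + ennreal (ball_vol powr (1/6) * F * G) * ennreal 2"
    using nn_integral_powr_near_0[of "- 1/2"] nn_integral_powr_at_infinity[of "- 3/2" 1]
    by (subst nn_integral_add) (auto simp: nn_integral_cmult)
  also have "\<dots> = ennreal (2 * (ball_vol powr (1/2) + ball_vol powr (1/6)) * F * G)"
  proof -
    have "ennreal A * ennreal 2 + ennreal B * ennreal 2 = ennreal (2 * A + 2 * B)" if "A \<ge> 0" "B \<ge> 0" for A B
      using that by (simp add: ennreal_mult ennreal_plus mult.commute)
    from this[of "ball_vol powr (1/2) * F * G" "ball_vol powr (1/6) * F * G"] show ?thesis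
      using pos by (simp add: algebra_simps)
  qed
  finally show ?thesis .
qed

section \<open>Borel representatives of weak derivatives\<close>

text \<open>Fubini's theorem is applied to functions of several variables built by composition, which need not
  be measurable for Lebesgue measurable functions. Borel representatives are therefore used; the
  defining integrals do not see the difference.\<close>

definition borel_weak_partial :: "'n \<Rightarrow> (real^'n \<Rightarrow> real) \<Rightarrow> (real^'n \<Rightarrow> real) \<Rightarrow> bool" where
  "borel_weak_partial i f g \<longleftrightarrow> loc_integrable f \<and> loc_integrable g \<and>
     (\<forall>\<phi>. test_function \<phi> \<longrightarrow>
        (LINT x|lborel. partial i \<phi> x * f x) = - (LINT x|lborel. \<phi> x * g x))"

lemma borel_representative:
  fixes f :: "real^'n \<Rightarrow> real"
  assumes "f \<in> borel_measurable lebesgue"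
  obtains f' where "f' \<in> borel_measurable borel" "AE x in lebesgue. f x = f' x"
proof -
  obtain f' where "f' \<in> borel_measurable lborel" "AE x in lborel. f x = f' x"
    using completion_ex_borel_measurable_real[OF assms] by blast
  then show ?thesis by (intro that[of f']) (auto intro: AE_completion)
qed

lemma lebesgue_of_borel: "f \<in> borel_measurable borel \<Longrightarrow> f \<in> borel_measurable lebesgue"
  by (intro measurable_completion) simp

lemma Lp_loc_D:
  fixes f :: "real^'n \<Rightarrow> 'b::{banach,second_countable_topology}"
  assumes "f \<in> Lp_loc r"
  shows "f \<in> borel_measurable lebesgue"
    and "integrable lebesgue (\<lambda>x. norm (indicat_real (cball 0 R) x *\<^sub>R f x) powr r)"
proof -
  have K: "(\<lambda>x. indicat_real (cball 0 R) x *\<^sub>R f x) \<in> Lp r" for R using assms by (auto simp: Lp_loc_def)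
  from K[of R] show "integrable lebesgue (\<lambda>x. norm (indicat_real (cball 0 R) x *\<^sub>R f x) powr r)" by (simp add: Lp_def)
  show "f \<in> borel_measurable lebesgue"
  proof (rule borel_measurable_LIMSEQ_metric)
    show "(\<lambda>x. indicat_real (cball 0 (real n)) x *\<^sub>R f x) \<in> borel_measurable lebesgue" for n
      using K by (simp add: Lp_def)
    fix x :: "real^'n"
    obtain k where k: "norm x \<le> real k" using real_arch_simple by blast
    have "\<forall>\<^sub>F n in sequentially. indicat_real (cball 0 (real n)) x *\<^sub>R f x = f x"
      using eventually_ge_at_top[of k] by eventually_elim (use k in \<open>auto simp: indicator_def\<close>)
    then show "(\<lambda>n. indicat_real (cball 0 (real n)) x *\<^sub>R f x) \<longlonglongrightarrow> f x" by (rule tendsto_eventually)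
  qed
qed

lemma loc_integrable_representative:
  fixes f :: "real^'n \<Rightarrow> real"
  assumes "f \<in> Lp_loc 1" "f' \<in> borel_measurable borel" "AE x in lebesgue. f x = f' x"
  shows "loc_integrable f'"
  unfolding loc_integrable_def set_integrable_def
proof (intro conjI allI assms)
  fix R
  have [measurable]: "f' \<in> borel_measurable borel" "f \<in> borel_measurable lebesgue" "f' \<in> borel_measurable lebesgue"
    using assms Lp_loc_D by (auto intro: lebesgue_of_borel)
  have bm: "(\<lambda>x. indicator (cball 0 R) x *\<^sub>R f' x) \<in> borel_measurable lborel" by measurable
  then have lm: "(\<lambda>x. indicator (cball 0 R) x *\<^sub>R f' x) \<in> borel_measurable lebesgue" by (rule measurable_completion)
  have "integrable lebesgue (\<lambda>x. indicator (cball 0 R) x *\<^sub>R f' x)"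
  proof (rule Bochner_Integration.integrable_bound[OF Lp_loc_D(2)[OF assms(1), of R] lm])
    show "AE x in lebesgue. norm (indicator (cball 0 R) x *\<^sub>R f' x) \<le> norm (norm (indicat_real (cball 0 R) x *\<^sub>R f x) powr 1)"
      using assms(3) by eventually_elim simp
  qed
  then show "integrable lborel (\<lambda>x. indicator (cball 0 R) x *\<^sub>R f' x)"
    using integrable_completion[OF bm] by simp
qed

lemma LINT_representative:
  fixes f f' :: "real^'n \<Rightarrow> real"
  assumes "f \<in> borel_measurable lebesgue" "f' \<in> borel_measurable borel" "AE x in lebesgue. f x = f' x"
    and [measurable]: "\<phi> \<in> borel_measurable borel"
  shows "(LINT x|lebesgue. \<phi> x * f x) = (LINT x|lborel. \<phi> x * f' x)"
proof -
  have m: "f' \<in> borel_measurable lebesgue" "\<phi> \<in> borel_measurable lebesgue"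
    using assms by (auto intro: lebesgue_of_borel)
  have "(LINT x|lebesgue. \<phi> x * f x) = (LINT x|lebesgue. \<phi> x * f' x)"
    using assms(3) by (intro integral_cong_AE borel_measurable_times m assms) auto
  also have "\<dots> = (LINT x|lborel. \<phi> x * f' x)"
    using assms(2) by (intro integral_completion) measurable
  finally show ?thesis .
qed

lemma borel_weak_partialI:
  fixes f g :: "real^'n \<Rightarrow> real"
  assumes w: "has_weak_partial i f g"
    and f': "f' \<in> borel_measurable borel" "AE x in lebesgue. f x = f' x"
    and g': "g' \<in> borel_measurable borel" "AE x in lebesgue. g x = g' x"
  shows "borel_weak_partial i f' g'"
proof -
  have L: "f \<in> Lp_loc 1" "g \<in> Lp_loc 1" using w by (auto simp: has_weak_partial_def)
  have "(LINT x|lborel. partial i \<phi> x * f' x) = - (LINT x|lborel. \<phi> x * g' x)" if "test_function \<phi>" for \<phi>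
    using w that LINT_representative[OF Lp_loc_D(1)[OF L(1)] f' test_function_measurable[OF test_function_partial[OF that]], of i]
      LINT_representative[OF Lp_loc_D(1)[OF L(2)] g' test_function_measurable[OF that]]
    by (simp add: has_weak_partial_def)
  then show ?thesis
    using loc_integrable_representative[OF L(1) f'] loc_integrable_representative[OF L(2) g']
    by (simp add: borel_weak_partial_def)
qed

lemma weak_partial_unique_real:
  fixes f :: "real^'n \<Rightarrow> real"
  assumes "has_weak_partial i f g" "has_weak_partial i f h"
  shows "AE x in lebesgue. g x = h x"
proof -
  have L: "f \<in> Lp_loc 1" "g \<in> Lp_loc 1" "h \<in> Lp_loc 1" using assms by (auto simp: has_weak_partial_def)
  obtain f' where f': "f' \<in> borel_measurable borel" "AE x in lebesgue. f x = f' x"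
    using borel_representative[OF Lp_loc_D(1)[OF L(1)]] by blast
  obtain g' where g': "g' \<in> borel_measurable borel" "AE x in lebesgue. g x = g' x"
    using borel_representative[OF Lp_loc_D(1)[OF L(2)]] by blast
  obtain h' where h': "h' \<in> borel_measurable borel" "AE x in lebesgue. h x = h' x"
    using borel_representative[OF Lp_loc_D(1)[OF L(3)]] by blast
  have G: "borel_weak_partial i f' g'" and H: "borel_weak_partial i f' h'"
    by (rule borel_weak_partialI[OF assms(1) f' g'], rule borel_weak_partialI[OF assms(2) f' h'])
  have l: "loc_integrable g'" "loc_integrable h'" using G H by (auto simp: borel_weak_partial_def)
  have "loc_integrable (\<lambda>x. g' x - h' x)"
    using l by (auto simp: loc_integrable_def intro!: set_integral_diff)
  moreover have "(LINT x|lborel. \<phi> x * (g' x - h' x)) = 0" if t: "test_function \<phi>" for \<phi>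
  proof -
    have "(LINT x|lborel. \<phi> x * g' x) = (LINT x|lborel. \<phi> x * h' x)"
      using G H t unfolding borel_weak_partial_def by (metis minus_minus)
    then show ?thesis
      using loc_integrable_test_function[OF l(1) t] loc_integrable_test_function[OF l(2) t]
      by (simp add: right_diff_distrib)
  qed
  ultimately have "AE x in lborel. g' x - h' x = 0" by (rule fundamental_lemma)
  then have "AE x in lebesgue. g' x - h' x = 0" by (rule AE_completion)
  with g'(2) h'(2) show ?thesis by eventually_elim simp
qed

lemma Lp_loc_test_integrable:
  fixes f :: "real^'n \<Rightarrow> 'b::{banach,second_countable_topology}"
  assumes f: "f \<in> Lp_loc 1" and \<phi>: "test_function \<phi>"
  shows "integrable lebesgue (\<lambda>x. \<phi> x *\<^sub>R f x)"
proof -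
  obtain R where R: "\<And>x. \<phi> x \<noteq> 0 \<Longrightarrow> norm x \<le> R" using \<phi> by (auto simp: test_function_iff)
  obtain M where M: "\<And>x. \<bar>\<phi> x\<bar> \<le> M" "M \<ge> 0" using test_function_bounded[OF \<phi>] by blast
  have "integrable lebesgue (\<lambda>x. M * norm (indicat_real (cball 0 R) x *\<^sub>R f x) powr 1)"
    using Lp_loc_D(2)[OF f] by (rule integrable_mult_right)
  then show ?thesis
  proof (rule Bochner_Integration.integrable_bound)
    show "(\<lambda>x. \<phi> x *\<^sub>R f x) \<in> borel_measurable lebesgue"
      by (intro borel_measurable_scaleR lebesgue_of_borel test_function_measurable \<phi> Lp_loc_D(1)[OF f])
    show "AE x in lebesgue. norm (\<phi> x *\<^sub>R f x) \<le> norm (M * norm (indicat_real (cball 0 R) x *\<^sub>R f x) powr 1)"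
    proof (rule AE_I2)
      fix x
      have "\<bar>\<phi> x\<bar> * norm (f x) \<le> M * norm (f x)" using M(1) by (rule mult_right_mono) simp
      then show "norm (\<phi> x *\<^sub>R f x) \<le> norm (M * norm (indicat_real (cball 0 R) x *\<^sub>R f x) powr 1)"
        using M R[of x] by (cases "\<phi> x = 0") (auto simp: abs_mult)
    qed
  qed
qed

lemma has_weak_partial_bounded_linear:
  fixes f :: "real^'n \<Rightarrow> 'b::{banach,second_countable_topology}"
    and T :: "'b \<Rightarrow> 'c::{banach,second_countable_topology}"
  assumes w: "has_weak_partial i f g" and T: "bounded_linear T"
  shows "has_weak_partial i (\<lambda>x. T (f x)) (\<lambda>x. T (g x))"
proof -
  interpret bounded_linear T by (rule T)
  have L: "f \<in> Lp_loc 1" "g \<in> Lp_loc 1" using w by (auto simp: has_weak_partial_def)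
  have loc: "(\<lambda>x. T (h x)) \<in> Lp_loc 1" if h: "h \<in> Lp_loc 1" for h :: "real^'n \<Rightarrow> 'b"
  proof -
    obtain K where K: "\<And>x. norm (T x) \<le> norm x * K" "K \<ge> 0" using nonneg_bounded by blast
    have "(\<lambda>x. indicat_real S x *\<^sub>R T (h x)) \<in> Lp 1" if S: "compact S" for S
    proof -
      have hS: "(\<lambda>x. indicat_real S x *\<^sub>R h x) \<in> borel_measurable lebesgue"
        "integrable lebesgue (\<lambda>x. norm (indicat_real S x *\<^sub>R h x) powr 1)"
        using h S by (auto simp: Lp_loc_def Lp_def)
      have m: "(\<lambda>x. indicat_real S x *\<^sub>R T (h x)) \<in> borel_measurable lebesgue"
        using measurable_compose[OF hS(1) borel_measurable_continuous_onI[OF linear_continuous_on[OF T]]]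
        by (simp add: scaleR)
      have "integrable lebesgue (\<lambda>x. norm (indicat_real S x *\<^sub>R T (h x)) powr 1)"
      proof (rule Bochner_Integration.integrable_bound[OF integrable_mult_right[OF hS(2), of K]])
        show "AE x in lebesgue. norm (norm (indicat_real S x *\<^sub>R T (h x)) powr 1) \<le> norm (K * norm (indicat_real S x *\<^sub>R h x) powr 1)"
          using K by (intro AE_I2) (auto simp: indicator_def mult.commute)
      qed (use m in measurable)
      with m show ?thesis by (simp add: Lp_def)
    qed
    then show ?thesis by (simp add: Lp_loc_def)
  qed
  have "(LINT x|lebesgue. partial i \<phi> x *\<^sub>R T (f x)) = - (LINT x|lebesgue. \<phi> x *\<^sub>R T (g x))"
    if t: "test_function \<phi>" for \<phi>
  proof -
    have "(LINT x|lebesgue. partial i \<phi> x *\<^sub>R T (f x)) = T (LINT x|lebesgue. partial i \<phi> x *\<^sub>R f x)"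
      using integral_bounded_linear[OF T Lp_loc_test_integrable[OF L(1) test_function_partial[OF t]]]
      by (simp add: scaleR)
    also have "\<dots> = T (- (LINT x|lebesgue. \<phi> x *\<^sub>R g x))" using w t by (simp add: has_weak_partial_def)
    also have "\<dots> = - (LINT x|lebesgue. \<phi> x *\<^sub>R T (g x))"
      using integral_bounded_linear[OF T Lp_loc_test_integrable[OF L(2) t]] by (simp add: scaleR neg)
    finally show ?thesis .
  qed
  with loc[OF L(1)] loc[OF L(2)] show ?thesis by (simp add: has_weak_partial_def)
qed

text \<open>This makes integrals of the chosen \<open>weak_partial\<close> computable: any weak derivative gives the same value.\<close>

lemma weak_partial_unique:
  fixes f :: "real^'n \<Rightarrow> complex"
  assumes "has_weak_partial i f g" "has_weak_partial i f h"
  shows "AE x in lebesgue. g x = h x"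
proof -
  have "AE x in lebesgue. Re (g x) = Re (h x)"
    by (rule weak_partial_unique_real) (rule has_weak_partial_bounded_linear[OF _ bounded_linear_Re], fact)+
  moreover have "AE x in lebesgue. Im (g x) = Im (h x)"
    by (rule weak_partial_unique_real) (rule has_weak_partial_bounded_linear[OF _ bounded_linear_Im], fact)+
  ultimately show ?thesis by eventually_elim (rule complex_eqI)
qed

lemma weak_derivative_along_translation:
  assumes "\<And>i. borel_weak_partial i f (g i)"
  shows "weak_derivative_along 0 z f (\<lambda>x. \<Sum>i\<in>UNIV. z $ i * g i x)"
proof -
  have f: "loc_integrable f" and g: "loc_integrable (g i)" for i
    using assms by (auto simp: borel_weak_partial_def)
  have [measurable]: "g i \<in> borel_measurable borel" for i using g by (rule loc_integrable_measurable)
  have "loc_integrable (\<lambda>x. \<Sum>i\<in>UNIV. z $ i * g i x)"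
    unfolding loc_integrable_def set_integrable_def scaleR_sum_right
    using g by (auto simp: loc_integrable_def set_integrable_def mult.left_commute[of "indicator _ _"] intro!: Bochner_Integration.integrable_sum)
  moreover have "(LINT x|lborel. ((\<Sum>i\<in>UNIV. z $ i * partial i \<phi> x)) * f x) = - (LINT x|lborel. \<phi> x * (\<Sum>i\<in>UNIV. z $ i * g i x))"
    if t: "test_function \<phi>" for \<phi>
  proof -
    have "(LINT x|lborel. ((\<Sum>i\<in>UNIV. z $ i * partial i \<phi> x)) * f x) = (\<Sum>i\<in>UNIV. z $ i * (LINT x|lborel. partial i \<phi> x * f x))"
      using loc_integrable_test_function[OF f test_function_partial[OF t]]
      by (simp add: sum_distrib_right mult.assoc)
    also have "\<dots> = - (\<Sum>i\<in>UNIV. z $ i * (LINT x|lborel. \<phi> x * g i x))"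
      using assms t by (simp add: borel_weak_partial_def sum_negf)
    also have "(\<Sum>i\<in>UNIV. z $ i * (LINT x|lborel. \<phi> x * g i x)) = (LINT x|lborel. \<phi> x * (\<Sum>i\<in>UNIV. z $ i * g i x))"
      using loc_integrable_test_function[OF g t]
      by (simp add: sum_distrib_left mult.left_commute[of "\<phi> _"])
    finally show ?thesis .
  qed
  ultimately show ?thesis using f by (simp add: weak_derivative_along_def)
qed

section \<open>Subcritical Sobolev integrability\<close>

lemma ball_vol_pos [simp]: "0 < ball_vol" "ball_vol \<noteq> 0"
  using unit_ball_vol_pos[of 3] by (simp, linarith)

lemma translate_estimate:
  fixes w :: "real^'n \<Rightarrow> real"
  assumes w: "\<And>i. borel_weak_partial i w (g i)" and z: "norm z \<le> 1"
  shows "AE x in lborel. ennreal \<bar>w x\<bar> \<le> ennreal \<bar>w (x + z)\<bar> +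
     (\<integral>\<^sup>+s. ennreal (indicator {0..1} s * (\<Sum>i\<in>UNIV. \<bar>g i (x + s *\<^sub>R z)\<bar>)) \<partial>lborel)"
proof -
  have "weak_derivative_along 0 z w (\<lambda>x. \<Sum>i\<in>UNIV. z $ i * g i x)"
    by (rule weak_derivative_along_translation) (rule w)
  from weak_flow[OF this disjI1[OF refl]] show ?thesis
  proof eventually_elim
    case (elim x)
    let ?G = "\<lambda>s. \<Sum>i\<in>UNIV. z $ i * g i (x + s *\<^sub>R z)"
    have fl: "flow 0 z s x = x + s *\<^sub>R z" for s by (simp add: flow_def)
    have *: "set_integrable lborel {0..1} ?G" "w (x + z) - w x = (LINT s:{0..1}|lborel. ?G s)"
      using elim fl[of 1] by (simp_all add: fl)
    have "ennreal \<bar>w (x + z) - w x\<bar> \<le> (\<integral>\<^sup>+s. ennreal (norm (indicator {0..1} s *\<^sub>R ?G s)) \<partial>lborel)"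
      using * integral_norm_bound_ennreal[of lborel "\<lambda>s. indicator {0..1} s *\<^sub>R ?G s"]
      by (simp add: set_integrable_def set_lebesgue_integral_def)
    also have "\<dots> \<le> (\<integral>\<^sup>+s. ennreal (indicator {0..1} s * (\<Sum>i\<in>UNIV. \<bar>g i (x + s *\<^sub>R z)\<bar>)) \<partial>lborel)"
    proof (intro nn_integral_mono ennreal_leI)
      fix s :: real
      have "\<bar>?G s\<bar> \<le> (\<Sum>i\<in>UNIV. \<bar>g i (x + s *\<^sub>R z)\<bar>)"
      proof (rule order_trans[OF sum_abs sum_mono])
        fix i
        have "\<bar>z $ i\<bar> \<le> 1" using component_le_norm_cart[of z i] z by linarith
        then show "\<bar>z $ i * g i (x + s *\<^sub>R z)\<bar> \<le> \<bar>g i (x + s *\<^sub>R z)\<bar>"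
          unfolding abs_mult by (intro mult_left_le_one_le) auto
      qed
      then show "norm (indicator {0..1} s *\<^sub>R ?G s) \<le> indicator {0..1} s * (\<Sum>i\<in>UNIV. \<bar>g i (x + s *\<^sub>R z)\<bar>)"
        by (simp add: indicator_def)
    qed
    finally have "ennreal \<bar>w (x + z)\<bar> + ennreal \<bar>w (x + z) - w x\<bar> \<le> ennreal \<bar>w (x + z)\<bar> +
       (\<integral>\<^sup>+s. ennreal (indicator {0..1} s * (\<Sum>i\<in>UNIV. \<bar>g i (x + s *\<^sub>R z)\<bar>)) \<partial>lborel)"
      by (rule add_left_mono)
    moreover have "ennreal \<bar>w x\<bar> \<le> ennreal \<bar>w (x + z)\<bar> + ennreal \<bar>w (x + z) - w x\<bar>"
    proof -
      have "ennreal \<bar>w x\<bar> \<le> ennreal (\<bar>w (x + z)\<bar> + \<bar>w (x + z) - w x\<bar>)" by (rule ennreal_leI) linarith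
      then show ?thesis by simp
    qed
    ultimately show ?case by (rule order_trans[rotated])
  qed
qed

text \<open>Averaging over translations by \<open>s * z\<close> with \<open>z\<close> in the unit ball is averaging over a ball of
  radius \<open>s\<close>; the exponent of \<open>s\<close> in the bound decides which integrability exponents are
  reached.\<close>

lemma averaged_pairing:
  fixes f H :: "real^3 \<Rightarrow> real"
  assumes [measurable]: "f \<in> borel_measurable borel" "H \<in> borel_measurable borel"
    and pos: "\<And>x. 0 \<le> f x" "\<And>x. 0 \<le> H x" "s > 0" "F > 0" "G > 0"
    and ex: "r \<ge> 1" "b \<ge> 1" "1 / 2 + 1 / r + 1 / b = 2"
    and f: "(\<integral>\<^sup>+x. ennreal ((f x)\<^sup>2) \<partial>lborel) \<le> ennreal (F\<^sup>2)"
    and H: "(\<integral>\<^sup>+x. ennreal (H x powr b) \<partial>lborel) \<le> ennreal (G powr b)"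
  shows "(\<integral>\<^sup>+z. \<integral>\<^sup>+x. ennreal (indicator (cball 0 1) z * (f (x + s *\<^sub>R z) * H x)) \<partial>lborel \<partial>lborel)
    \<le> ennreal (F * ball_vol powr (1 / r) * G) * ennreal (s powr (3 / r - 3))"
proof -
  have m1: "(\<lambda>p. ennreal (indicator (cball 0 1) (snd p) * (f (fst p + s *\<^sub>R snd p) * H (fst p))))
     \<in> borel_measurable (lborel \<Otimes>\<^sub>M lborel)"
    unfolding indicator_def mem_cball_0 by measurable
  have "(\<integral>\<^sup>+z. \<integral>\<^sup>+x. ennreal (indicator (cball 0 1) z * (f (x + s *\<^sub>R z) * H x)) \<partial>lborel \<partial>lborel)
    = (\<integral>\<^sup>+x. \<integral>\<^sup>+z. ennreal (indicator (cball 0 1) z * (f (x + s *\<^sub>R z) * H x)) \<partial>lborel \<partial>lborel)"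
    by (rule lborel_pair.Fubini') (use m1 in \<open>simp add: case_prod_beta\<close>)
  also have "\<dots> = (\<integral>\<^sup>+x. ennreal (1 / s ^ 3) * (\<integral>\<^sup>+y. ennreal (indicator (cball x s) y * (f y * H x)) \<partial>lborel) \<partial>lborel)"
  proof (rule nn_integral_cong)
    fix x :: "real^3"
    have "(\<integral>\<^sup>+z. ennreal (indicator (cball 0 1) z * (f (x + s *\<^sub>R z) * H x)) \<partial>lborel)
       = (\<integral>\<^sup>+z. ennreal (indicator (cball x s) (s *\<^sub>R z + x) * (f (s *\<^sub>R z + x) * H x)) \<partial>lborel)"
      using pos(3) by (intro nn_integral_cong) (auto simp: indicator_def dist_norm add.commute)
    also have "\<dots> = ennreal (1 / s ^ 3) * (\<integral>\<^sup>+y. ennreal (indicator (cball x s) y * (f y * H x)) \<partial>lborel)"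
      using pos(3) by (subst nn_integral_affine[where f="\<lambda>y. ennreal (indicator (cball x s) y * (f y * H x))"])
         (auto simp: indicator_def dist_norm)
    finally show "(\<integral>\<^sup>+z. ennreal (indicator (cball 0 1) z * (f (x + s *\<^sub>R z) * H x)) \<partial>lborel)
      = ennreal (1 / s ^ 3) * (\<integral>\<^sup>+y. ennreal (indicator (cball x s) y * (f y * H x)) \<partial>lborel)" .
  qed
  also have "\<dots> = ennreal (1 / s ^ 3) * (\<integral>\<^sup>+x. \<integral>\<^sup>+y. ennreal (indicator (cball x s) y * (f y * H x)) \<partial>lborel \<partial>lborel)"
    using ball_pairing_measurable[of f H s]
    by (intro nn_integral_cmult lborel.borel_measurable_nn_integral) (simp add: case_prod_beta)
  also have "\<dots> \<le> ennreal (1 / s ^ 3) * ennreal (F * (ball_vol * s ^ 3) powr (1 / r) * G)"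
    using f pos ex H
    by (intro mult_left_mono ball_pairing[where a=2 and b=b] assms) auto
  also have "\<dots> = ennreal (F * ball_vol powr (1 / r) * G) * ennreal (s powr (3 / r - 3))"
  proof -
    have s3: "s ^ 3 = s powr 3" using pos(3) by simp
    have "(ball_vol * s powr 3) powr (1 / r) = ball_vol powr (1 / r) * s powr (3 / r)"
      using pos(3) by (simp only: powr_mult powr_powr unit_ball_vol_nonneg) simp
    moreover have "1 / s powr 3 * s powr (3 / r) = s powr (3 / r - 3)"
      by (simp only: powr_diff) simp
    ultimately have e: "(ball_vol * s ^ 3) powr (1 / r) = ball_vol powr (1 / r) * s powr (3 / r)"
      "1 / s ^ 3 * s powr (3 / r) = s powr (3 / r - 3)"
      unfolding s3 by auto
    have "1 / s ^ 3 * (F * (ball_vol * s ^ 3) powr (1 / r) * G) = F * ball_vol powr (1 / r) * G * (1 / s ^ 3 * s powr (3 / r))"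
      unfolding e(1) by (simp add: mult_ac)
    also note e(2)
    finally have "1 / s ^ 3 * (F * (ball_vol * s ^ 3) powr (1 / r) * G) = F * ball_vol powr (1 / r) * G * s powr (3 / r - 3)" .
    then show ?thesis using pos by (simp only: ennreal_mult[symmetric] mult_nonneg_nonneg powr_ge_zero less_imp_le zero_le_divide_1_iff zero_le_power)
  qed
  finally show ?thesis .
qed

text \<open>Average \<open>translate_estimate\<close> over \<open>z\<close> in the unit ball and pair with \<open>H\<close>. The gradient term carries
  \<open>s powr e\<close> with \<open>e = 3 / q - 3 / 2\<close>, integrable near \<open>0\<close> exactly when \<open>q < 6\<close>.\<close>

lemma sobolev_pairing:
  fixes w :: "real^3 \<Rightarrow> real"
  assumes w: "\<And>i. borel_weak_partial i w (g i)"
    and q: "2 < q" "q < 6" "1 / q + 1 / b = 1"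
    and L: "L > 0" "(\<integral>\<^sup>+x. ennreal ((w x)\<^sup>2) \<partial>lborel) \<le> ennreal (L\<^sup>2)"
      "(\<integral>\<^sup>+x. ennreal ((\<Sum>i\<in>UNIV. \<bar>g i x\<bar>)\<^sup>2) \<partial>lborel) \<le> ennreal (L\<^sup>2)"
  obtains C where "C > 0" "\<And>H G. H \<in> borel_measurable borel \<Longrightarrow> (\<And>x. 0 \<le> H x) \<Longrightarrow> G > 0 \<Longrightarrow>
     (\<integral>\<^sup>+x. ennreal (H x powr b) \<partial>lborel) \<le> ennreal (G powr b) \<Longrightarrow>
     (\<integral>\<^sup>+x. ennreal (\<bar>w x\<bar> * H x) \<partial>lborel) \<le> ennreal (C * G)"
proof -
  define r where "r = 1 / (1 / 2 + 1 / q)"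
  have r3: "1 / r = 1 / 2 + 1 / q" by (simp add: r_def)
  moreover have "1 / q \<le> 1 / 2" using q(1) by (simp add: field_simps)
  moreover have "1 / q > 0" using q(1) by simp
  ultimately have "0 < 1 / r" "1 / r \<le> 1" by linarith+
  then have "r \<ge> 1" by simp
  with r3 q(3) have r: "r \<ge> 1" "1 / 2 + 1 / r + 1 / b = 2" "1 / r = 1 / 2 + 1 / q"
    by linarith+
  have b: "b \<ge> 1"
  proof -
    have "1 / b = 1 - 1 / q" using q(3) by linarith
    moreover have "1 / q < 1" "1 / q > 0" using q by auto
    ultimately have "0 < 1 / b" "1 / b \<le> 1" by linarith+
    then show ?thesis by simp
  qed
  define e where "e = 3 / r - 3"
  have e: "e > - 1"
  proof -
    have "3 / r = 3 / 2 + 3 / q" using r(3) by (simp add: field_simps)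
    moreover have "3 / q > 1 / 2" using q by (simp add: field_simps)
    ultimately show ?thesis by (simp add: e_def)
  qed
  define V where "V = ball_vol powr (1 / r)"
  define C where "C = L * V * (1 + 1 / (e + 1)) / ball_vol"
  have V: "V > 0" by (simp add: V_def)
  show ?thesis
  proof (rule that)
    have "1 + 1 / (e + 1) > 0" using e by (intro add_pos_pos) auto
    then show "C > 0" unfolding C_def using L(1) V by (intro divide_pos_pos mult_pos_pos) auto
    have wm [measurable]: "w \<in> borel_measurable borel" and gm [measurable]: "g i \<in> borel_measurable borel" for i
      using w by (auto simp: borel_weak_partial_def intro: loc_integrable_measurable)
    define h where "h x = (\<Sum>i\<in>UNIV. \<bar>g i x\<bar>)" for x
    have hm [measurable]: "h \<in> borel_measurable borel" by (simp add: h_def[abs_def])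
    have h0: "0 \<le> h x" for x by (simp add: h_def sum_nonneg)
    fix H :: "real^3 \<Rightarrow> real" and G
    assume Hm [measurable]: "H \<in> borel_measurable borel" and H0: "\<And>x. 0 \<le> H x" and G: "G > (0::real)"
      and H: "(\<integral>\<^sup>+x. ennreal (H x powr b) \<partial>lborel) \<le> ennreal (G powr b)"
    have split: "ennreal (A + A * B) = ennreal A + ennreal A * ennreal B" if "A \<ge> 0" "B \<ge> 0" for A B :: real
      using that by (simp add: ennreal_mult)
    define k where "k z = (indicator (cball 0 1) z :: real)" for z :: "real^3"
    have k: "k z \<ge> 0" for z by (simp add: k_def)
    have km [measurable]: "k \<in> borel_measurable borel" by (simp add: k_def[abs_def] borel_measurable_indicator_cball)
    define X where "X = (\<integral>\<^sup>+x. ennreal (\<bar>w x\<bar> * H x) \<partial>lborel)"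
    define T where "T z s x = ennreal (k z * (h (x + s *\<^sub>R z) * H x))" for z s x
    define ind where "ind s = ennreal (indicator {0..1} s)" for s :: real
    have im [measurable]: "ind \<in> borel_measurable borel" by (simp add: ind_def[abs_def] ennreal_indicator)
    have Tm3: "(\<lambda>p. T (fst (fst p)) (snd (fst p)) (snd p)) \<in> borel_measurable ((lborel \<Otimes>\<^sub>M lborel) \<Otimes>\<^sub>M lborel)"
      unfolding T_def by measurable
    have Tmx: "(\<lambda>p. \<integral>\<^sup>+x. T (fst p) (snd p) x \<partial>lborel) \<in> borel_measurable (lborel \<Otimes>\<^sub>M lborel)"
      by (rule lborel.borel_measurable_nn_integral) (use Tm3 in \<open>simp add: case_prod_beta\<close>)
    then have Tm2: "(\<lambda>p. ind (snd p) * (\<integral>\<^sup>+x. T (fst p) (snd p) x \<partial>lborel)) \<in> borel_measurable (lborel \<Otimes>\<^sub>M lborel)"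
      by measurable
    have sw: "(\<lambda>p. (snd p, fst p)) \<in> lborel \<Otimes>\<^sub>M lborel \<rightarrow>\<^sub>M lborel \<Otimes>\<^sub>M lborel" by measurable
    have Tm2s: "(\<lambda>p. ind (fst p) * (\<integral>\<^sup>+x. T (snd p) (fst p) x \<partial>lborel)) \<in> borel_measurable (lborel \<Otimes>\<^sub>M lborel)"
      using measurable_compose[OF sw Tm2] by simp
    have "(\<lambda>z. (z, s)) \<in> lborel \<rightarrow>\<^sub>M lborel \<Otimes>\<^sub>M lborel" for s :: real by measurable
    from measurable_compose[OF this Tmx]
    have Tm1: "(\<lambda>z. \<integral>\<^sup>+x. T z s x \<partial>lborel) \<in> borel_measurable lborel" for s by simp
    have est: "ennreal (k z) * X \<le> (\<integral>\<^sup>+x. ennreal (k z * (\<bar>w (x + 1 *\<^sub>R z)\<bar> * H x)) \<partial>lborel) +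
        (\<integral>\<^sup>+s. ind s * (\<integral>\<^sup>+x. T z s x \<partial>lborel) \<partial>lborel)" for z
    proof (cases "norm z \<le> 1")
      case True
      have tr: "AE x in lborel. ennreal \<bar>w x\<bar> \<le> ennreal \<bar>w (x + z)\<bar> +
         (\<integral>\<^sup>+s. ennreal (indicator {0..1} s * (\<Sum>i\<in>UNIV. \<bar>g i (x + s *\<^sub>R z)\<bar>)) \<partial>lborel)"
        by (rule translate_estimate) (use w True in auto)
      have Tm: "(\<lambda>p. T z (fst p) (snd p)) \<in> borel_measurable (lborel \<Otimes>\<^sub>M lborel)"
        unfolding T_def by measurable
      have "ennreal (k z) * X = (\<integral>\<^sup>+x. ennreal (k z) * ennreal (\<bar>w x\<bar> * H x) \<partial>lborel)"
        unfolding X_def by (rule nn_integral_cmult[symmetric]) measurable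
      also have "\<dots> \<le> (\<integral>\<^sup>+x. ennreal (k z * (\<bar>w (x + 1 *\<^sub>R z)\<bar> * H x)) + (\<integral>\<^sup>+s. ind s * T z s x \<partial>lborel) \<partial>lborel)"
      proof (rule nn_integral_mono_AE)
        show "AE x in lborel. ennreal (k z) * ennreal (\<bar>w x\<bar> * H x) \<le>
          ennreal (k z * (\<bar>w (x + 1 *\<^sub>R z)\<bar> * H x)) + (\<integral>\<^sup>+s. ind s * T z s x \<partial>lborel)"
          using tr
        proof eventually_elim
          case (elim x)
          define c where "c = ennreal (k z * H x)"
          have "ennreal (k z) * ennreal (\<bar>w x\<bar> * H x) = c * ennreal \<bar>w x\<bar>"
            using H0 k by (simp add: c_def ennreal_mult mult_ac)
          also have "\<dots> \<le> c * (ennreal \<bar>w (x + z)\<bar> + (\<integral>\<^sup>+s. ennreal (indicator {0..1} s * h (x + s *\<^sub>R z)) \<partial>lborel))"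
            using elim unfolding h_def by (rule mult_left_mono) simp
          also have "\<dots> = c * ennreal \<bar>w (x + z)\<bar> + (\<integral>\<^sup>+s. c * ennreal (indicator {0..1} s * h (x + s *\<^sub>R z)) \<partial>lborel)"
            by (subst nn_integral_cmult) (measurable, simp add: distrib_left)
          also have "\<dots> = ennreal (k z * (\<bar>w (x + 1 *\<^sub>R z)\<bar> * H x)) + (\<integral>\<^sup>+s. ind s * T z s x \<partial>lborel)"
            using H0 k h0 by (simp add: c_def T_def ind_def ennreal_mult[symmetric] mult_ac)
          finally show ?case .
        qed
      qed
      also have "\<dots> = (\<integral>\<^sup>+x. ennreal (k z * (\<bar>w (x + 1 *\<^sub>R z)\<bar> * H x)) \<partial>lborel) + (\<integral>\<^sup>+x. \<integral>\<^sup>+s. ind s * T z s x \<partial>lborel \<partial>lborel)"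
      proof (rule nn_integral_add)
        show "(\<lambda>x. ennreal (k z * (\<bar>w (x + 1 *\<^sub>R z)\<bar> * H x))) \<in> borel_measurable lborel" by measurable
        have "(\<lambda>(x, s). ind s * T z s x) \<in> borel_measurable (lborel \<Otimes>\<^sub>M lborel)"
          unfolding T_def case_prod_beta by measurable
        then show "(\<lambda>x. \<integral>\<^sup>+s. ind s * T z s x \<partial>lborel) \<in> borel_measurable lborel"
          by (rule lborel.borel_measurable_nn_integral)
      qed
      also have "(\<integral>\<^sup>+x. \<integral>\<^sup>+s. ind s * T z s x \<partial>lborel \<partial>lborel) = (\<integral>\<^sup>+s. \<integral>\<^sup>+x. ind s * T z s x \<partial>lborel \<partial>lborel)"
        by (rule lborel_pair.Fubini') (use Tm in \<open>simp add: case_prod_beta\<close>)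
      also have "\<dots> = (\<integral>\<^sup>+s. ind s * (\<integral>\<^sup>+x. T z s x \<partial>lborel) \<partial>lborel)"
        by (intro nn_integral_cong nn_integral_cmult) (simp add: T_def)
      finally show ?thesis .
    next
      case False
      then have "k z = 0" by (simp add: k_def)
      then show ?thesis by simp
    qed
    have "ennreal ball_vol * X = (\<integral>\<^sup>+z. ennreal (k z) * X \<partial>lborel)"
      using nn_integral_cball_indicator[of 1 0] by (subst nn_integral_multc) (auto simp: k_def[symmetric])
    also have "\<dots> \<le> (\<integral>\<^sup>+z. (\<integral>\<^sup>+x. ennreal (k z * (\<bar>w (x + 1 *\<^sub>R z)\<bar> * H x)) \<partial>lborel) +
        (\<integral>\<^sup>+s. ind s * (\<integral>\<^sup>+x. T z s x \<partial>lborel) \<partial>lborel) \<partial>lborel)"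
      by (intro nn_integral_mono est)
    also have "\<dots> = (\<integral>\<^sup>+z. \<integral>\<^sup>+x. ennreal (k z * (\<bar>w (x + 1 *\<^sub>R z)\<bar> * H x)) \<partial>lborel \<partial>lborel) +
        (\<integral>\<^sup>+z. \<integral>\<^sup>+s. ind s * (\<integral>\<^sup>+x. T z s x \<partial>lborel) \<partial>lborel \<partial>lborel)"
    proof (rule nn_integral_add)
      show "(\<lambda>z. \<integral>\<^sup>+x. ennreal (k z * (\<bar>w (x + 1 *\<^sub>R z)\<bar> * H x)) \<partial>lborel) \<in> borel_measurable lborel"
        by (rule lborel.borel_measurable_nn_integral) (unfold case_prod_beta, measurable)
      show "(\<lambda>z. \<integral>\<^sup>+s. ind s * (\<integral>\<^sup>+x. T z s x \<partial>lborel) \<partial>lborel) \<in> borel_measurable lborel"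
        by (rule lborel.borel_measurable_nn_integral) (use Tm2 in \<open>simp add: case_prod_beta\<close>)
    qed
    also have "(\<integral>\<^sup>+z. \<integral>\<^sup>+s. ind s * (\<integral>\<^sup>+x. T z s x \<partial>lborel) \<partial>lborel \<partial>lborel)
      = (\<integral>\<^sup>+s. ind s * (\<integral>\<^sup>+z. \<integral>\<^sup>+x. T z s x \<partial>lborel \<partial>lborel) \<partial>lborel)"
    proof -
      have "(\<integral>\<^sup>+z. \<integral>\<^sup>+s. ind s * (\<integral>\<^sup>+x. T z s x \<partial>lborel) \<partial>lborel \<partial>lborel)
        = (\<integral>\<^sup>+s. \<integral>\<^sup>+z. ind s * (\<integral>\<^sup>+x. T z s x \<partial>lborel) \<partial>lborel \<partial>lborel)"
        by (rule lborel_pair.Fubini') (use Tm2s in \<open>simp add: case_prod_beta\<close>)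
      also have "\<dots> = (\<integral>\<^sup>+s. ind s * (\<integral>\<^sup>+z. \<integral>\<^sup>+x. T z s x \<partial>lborel \<partial>lborel) \<partial>lborel)"
        by (intro nn_integral_cong nn_integral_cmult Tm1)
      finally show ?thesis .
    qed
    also have "(\<integral>\<^sup>+z. \<integral>\<^sup>+x. ennreal (k z * (\<bar>w (x + 1 *\<^sub>R z)\<bar> * H x)) \<partial>lborel \<partial>lborel) \<le> ennreal (L * V * G)"
      using averaged_pairing[OF _ Hm _ H0 zero_less_one L(1) G r(1) b r(2) _ H, of "\<lambda>x. \<bar>w x\<bar>"] L
      by (simp add: k_def V_def)
    also have "(\<integral>\<^sup>+s. ind s * (\<integral>\<^sup>+z. \<integral>\<^sup>+x. T z s x \<partial>lborel \<partial>lborel) \<partial>lborel) \<le>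
      (\<integral>\<^sup>+s. ennreal (L * V * G) * ennreal (indicator {0<..1} s * s powr e) \<partial>lborel)"
    proof (intro nn_integral_mono_AE)
      have T: "(\<integral>\<^sup>+z. \<integral>\<^sup>+x. T z s x \<partial>lborel \<partial>lborel) \<le> ennreal (L * V * G) * ennreal (s powr e)" if "s > 0" for s
        using averaged_pairing[OF hm Hm h0 H0 that L(1) G r(1) b r(2) _ H] L
        unfolding T_def k_def V_def e_def h_def by blast
      have "AE s in lborel. s \<noteq> (0::real)" by (rule AE_lborel_singleton)
      then show "AE s in lborel. ind s * (\<integral>\<^sup>+z. \<integral>\<^sup>+x. T z s x \<partial>lborel \<partial>lborel) \<le>
        ennreal (L * V * G) * ennreal (indicator {0<..1} s * s powr e)"
        by eventually_elim (use T in \<open>auto simp: ind_def split: split_indicator\<close>)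
    qed
    also have "(\<integral>\<^sup>+s. ennreal (L * V * G) * ennreal (indicator {0<..1} s * s powr e) \<partial>lborel) = ennreal (L * V * G) * ennreal (1 / (e + 1))"
      using nn_integral_powr_near_0[OF e] by (subst nn_integral_cmult) auto
    also have "ennreal (L * V * G) + ennreal (L * V * G) * ennreal (1 / (e + 1)) = ennreal ball_vol * ennreal (C * G)"
    proof -
      have "ball_vol * (C * G) = L * V * G + L * V * G * (1 / (e + 1))"
      proof -
        have "ball_vol * (C * G) = L * V * (1 + 1 / (e + 1)) * G" unfolding C_def by simp
        then show ?thesis by (simp add: algebra_simps)
      qed
      then have "ennreal ball_vol * ennreal (C * G) = ennreal (L * V * G + L * V * G * (1 / (e + 1)))"
        using \<open>C > 0\<close> G by (subst ennreal_mult[symmetric]) auto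
      also have "\<dots> = ennreal (L * V * G) + ennreal (L * V * G) * ennreal (1 / (e + 1))"
        by (rule split) (use L V G e in auto)
      finally show ?thesis by simp
    qed
    finally have "ennreal ball_vol * X \<le> ennreal ball_vol * ennreal (C * G)" by (simp add: add_mono)
    then show "(\<integral>\<^sup>+x. ennreal (\<bar>w x\<bar> * H x) \<partial>lborel) \<le> ennreal (C * G)"
      unfolding X_def[symmetric] by (subst (asm) ennreal_mult_le_mult_iff) auto
  qed
qed

text \<open>Duality: test \<open>sobolev_pairing\<close> with the power \<open>q - 1\<close> of a truncation of \<open>\<bar>w\<bar>\<close>. The truncation has a
  finite norm, which can be absorbed, and the resulting bound does not depend on the level of truncation.\<close>

lemma sobolev_real:
  fixes w :: "real^3 \<Rightarrow> real"
  assumes w: "\<And>i. borel_weak_partial i w (g i)"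
    and sq: "integrable lborel (\<lambda>x. (w x)\<^sup>2)" "\<And>i. integrable lborel (\<lambda>x. (g i x)\<^sup>2)"
    and q: "2 < q" "q < 6"
  shows "integrable lborel (\<lambda>x. \<bar>w x\<bar> powr q)"
proof -
  have wm [measurable]: "w \<in> borel_measurable borel" and gm [measurable]: "g i \<in> borel_measurable borel" for i
    using w by (auto simp: borel_weak_partial_def intro: loc_integrable_measurable)
  define A where "A = (LINT x|lborel. (w x)\<^sup>2)"
  define B where "B = (LINT x|lborel. 3 * (\<Sum>i\<in>UNIV. (g i x)\<^sup>2))"
  define L where "L = sqrt (A + B + 1)"
  have AB: "A \<ge> 0" "B \<ge> 0" unfolding A_def B_def by (auto intro!: Bochner_Integration.integral_nonneg sum_nonneg)
  have L: "L > 0" "L\<^sup>2 = A + B + 1" using AB by (auto simp: L_def)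
  have LA: "(\<integral>\<^sup>+x. ennreal ((w x)\<^sup>2) \<partial>lborel) \<le> ennreal (L\<^sup>2)"
    using AB by (subst nn_integral_eq_integral[OF sq(1)]) (auto simp: L A_def[symmetric] intro!: ennreal_leI)
  have "(\<integral>\<^sup>+x. ennreal ((\<Sum>i\<in>UNIV. \<bar>g i x\<bar>)\<^sup>2) \<partial>lborel) \<le> (\<integral>\<^sup>+x. ennreal (3 * (\<Sum>i\<in>UNIV. (g i x)\<^sup>2)) \<partial>lborel)"
  proof (intro nn_integral_mono ennreal_leI)
    fix x
    have "(a + b + c)\<^sup>2 \<le> 3 * (a\<^sup>2 + b\<^sup>2 + c\<^sup>2)" for a b c :: real
    proof -
      have "0 \<le> (a - b)\<^sup>2 + (b - c)\<^sup>2 + (a - c)\<^sup>2" by simp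
      then show ?thesis by (simp add: power2_eq_square algebra_simps)
    qed
    from this[of "\<bar>g 1 x\<bar>" "\<bar>g 2 x\<bar>" "\<bar>g 3 x\<bar>"]
    show "(\<Sum>i\<in>UNIV. \<bar>g i x\<bar>)\<^sup>2 \<le> 3 * (\<Sum>i\<in>UNIV. (g i x)\<^sup>2)" by (simp add: sum_3)
  qed
  also have "\<dots> = ennreal B"
    unfolding B_def using sq(2) by (intro nn_integral_eq_integral) (auto intro!: Bochner_Integration.integrable_sum integrable_mult_right sum_nonneg)
  also have "\<dots> \<le> ennreal (L\<^sup>2)" using AB L by (intro ennreal_leI) auto
  finally have LB: "(\<integral>\<^sup>+x. ennreal ((\<Sum>i\<in>UNIV. \<bar>g i x\<bar>)\<^sup>2) \<partial>lborel) \<le> ennreal (L\<^sup>2)" .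
  define b where "b = q / (q - 1)"
  have b: "1 / q + 1 / b = 1" "(q - 1) * b = q" using q by (auto simp: b_def field_simps)
  obtain C where C: "C > 0" and pair: "\<And>H G. H \<in> borel_measurable borel \<Longrightarrow> (\<And>x. 0 \<le> H x) \<Longrightarrow> G > 0 \<Longrightarrow>
     (\<integral>\<^sup>+x. ennreal (H x powr b) \<partial>lborel) \<le> ennreal (G powr b) \<Longrightarrow>
     (\<integral>\<^sup>+x. ennreal (\<bar>w x\<bar> * H x) \<partial>lborel) \<le> ennreal (C * G)"
    by (rule sobolev_pairing[where w=w and g=g and q=q and b=b and L=L]) (use w q b L LA LB in auto)
  define tr where "tr n x = indicator (cball 0 (real n)) x * min \<bar>w x\<bar> (real n) powr q" for n :: nat and x
  have [measurable]: "tr n \<in> borel_measurable borel" for n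
    unfolding tr_def indicator_def mem_cball_0 by measurable
  have bound: "(\<integral>\<^sup>+x. ennreal (tr n x) \<partial>lborel) \<le> ennreal (C powr q)" for n
  proof -
    define H where "H x = indicator (cball 0 (real n)) x * min \<bar>w x\<bar> (real n) powr (q - 1)" for x
    have Hm: "H \<in> borel_measurable borel" unfolding H_def indicator_def mem_cball_0 by measurable
    have H0: "0 \<le> H x" for x by (simp add: H_def)
    have Hb: "H x powr b = tr n x" for x
      using q b by (simp add: H_def tr_def powr_powr indicator_def)
    have wH: "tr n x \<le> \<bar>w x\<bar> * H x" for x
    proof -
      have "min \<bar>w x\<bar> (real n) powr q = min \<bar>w x\<bar> (real n) * min \<bar>w x\<bar> (real n) powr (q - 1)"
        by (cases "min \<bar>w x\<bar> (real n) = 0") (auto simp: powr_diff)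
      also have "\<dots> \<le> \<bar>w x\<bar> * min \<bar>w x\<bar> (real n) powr (q - 1)" by (intro mult_right_mono) auto
      finally show ?thesis by (simp add: tr_def H_def indicator_def)
    qed
    have "(\<integral>\<^sup>+x. ennreal (tr n x) \<partial>lborel) \<le> (\<integral>\<^sup>+x. ennreal (real n powr q) * indicator (cball (0::real^3) (real n)) x \<partial>lborel)"
      using q by (intro nn_integral_mono) (auto simp: tr_def indicator_def intro!: ennreal_leI powr_mono2)
    also have "\<dots> = ennreal (real n powr q) * emeasure lborel (cball (0::real^3) (real n))"
      by (rule nn_integral_cmult_indicator) simp
    also have "\<dots> < \<infinity>" using emeasure_lborel_cball_finite[of "0::real^3" "real n"] by (simp add: ennreal_mult_less_top)
    finally obtain X where X: "(\<integral>\<^sup>+x. ennreal (tr n x) \<partial>lborel) = ennreal X" "X \<ge> 0"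
      by (cases "\<integral>\<^sup>+x. ennreal (tr n x) \<partial>lborel") auto
    have "X \<le> C powr q"
    proof (cases "X = 0")
      case False
      with X have X0: "X > 0" by simp
      have b0: "b \<noteq> 0" using b(2) q by auto
      have "ennreal X \<le> (\<integral>\<^sup>+x. ennreal (\<bar>w x\<bar> * H x) \<partial>lborel)"
        unfolding X(1)[symmetric] by (intro nn_integral_mono ennreal_leI wH)
      also have "\<dots> \<le> ennreal (C * X powr (1 / b))"
        using X X0 b0 by (intro pair Hm H0) (auto simp: Hb powr_powr)
      finally have "X \<le> C * X powr (1 / b)" using C by (simp add: ennreal_le_iff)
      moreover have "1 / b = 1 - 1 / q" using b by linarith
      then have "X powr (1 / b) = X / X powr (1 / q)" using X0 by (simp add: powr_diff)
      ultimately have "X powr (1 / q) \<le> C" using X0 by (simp add: field_simps)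
      then have "(X powr (1 / q)) powr q \<le> C powr q" using q by (intro powr_mono2) auto
      then show ?thesis using X0 q by (simp add: powr_powr)
    qed simp
    then show ?thesis unfolding X(1) by (rule ennreal_leI)
  qed
  have lim: "(\<lambda>n. ennreal (tr n x)) \<longlonglongrightarrow> ennreal (\<bar>w x\<bar> powr q)" for x
  proof -
    obtain k where k: "max (norm x) \<bar>w x\<bar> \<le> real k" using real_arch_simple by blast
    have "\<forall>\<^sub>F n in sequentially. ennreal (tr n x) = ennreal (\<bar>w x\<bar> powr q)"
      using eventually_ge_at_top[of k]
    proof eventually_elim
      case (elim n)
      then have "real k \<le> real n" by simp
      with k have "norm x \<le> real n" "\<bar>w x\<bar> \<le> real n" by linarith+
      then show ?case by (simp add: tr_def min_absorb1)
    qed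
    then show ?thesis by (rule tendsto_eventually)
  qed
  have "(\<integral>\<^sup>+x. ennreal (\<bar>w x\<bar> powr q) \<partial>lborel) = (\<integral>\<^sup>+x. liminf (\<lambda>n. ennreal (tr n x)) \<partial>lborel)"
    using lim_imp_Liminf[OF sequentially_bot lim] by (intro nn_integral_cong) simp
  also have "\<dots> \<le> liminf (\<lambda>n. \<integral>\<^sup>+x. ennreal (tr n x) \<partial>lborel)" by (rule nn_integral_liminf) simp
  also have "\<dots> \<le> ennreal (C powr q)" using bound by (intro Liminf_le) (auto intro: always_eventually)
  finally have "(\<integral>\<^sup>+x. ennreal (\<bar>w x\<bar> powr q) \<partial>lborel) < \<infinity>" by (simp add: le_less_trans)
  then show ?thesis by (intro integrableI_nonneg) auto
qed

lemma integrable_representative: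
  fixes f f' :: "real^'n \<Rightarrow> real"
  assumes f: "f \<in> borel_measurable lebesgue" and f': "f' \<in> borel_measurable borel"
    and eq: "AE x in lebesgue. f x = f' x" and T: "T \<in> borel_measurable borel"
  shows "integrable lebesgue (\<lambda>x. T (f x) :: real) \<longleftrightarrow> integrable lborel (\<lambda>x. T (f' x))"
proof -
  have m: "(\<lambda>x. T (f' x)) \<in> borel_measurable lborel" "(\<lambda>x. T (f x)) \<in> borel_measurable lebesgue"
    using measurable_compose[OF f' T] measurable_compose[OF f T] by auto
  have "integrable lebesgue (\<lambda>x. T (f x)) \<longleftrightarrow> integrable lebesgue (\<lambda>x. T (f' x))"
    using eq by (intro integrable_cong_AE m measurable_completion) auto
  also have "\<dots> \<longleftrightarrow> integrable lborel (\<lambda>x. T (f' x))" by (rule integrable_completion[OF m(1)])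
  finally show ?thesis .
qed

lemma Lp_2_component:
  fixes f :: "real^'n \<Rightarrow> complex"
  assumes f: "f \<in> Lp 2" and T: "bounded_linear T" and le: "\<And>z. \<bar>T z\<bar> \<le> cmod z"
  shows "(\<lambda>x. T (f x)) \<in> borel_measurable lebesgue" "integrable lebesgue (\<lambda>x. (T (f x) :: real)\<^sup>2)"
proof -
  have fm: "f \<in> borel_measurable lebesgue" and fi: "integrable lebesgue (\<lambda>x. cmod (f x) powr 2)"
    using f by (auto simp: Lp_def)
  show m: "(\<lambda>x. T (f x)) \<in> borel_measurable lebesgue"
    using measurable_compose[OF fm borel_measurable_continuous_onI[OF linear_continuous_on[OF T]]] .
  show "integrable lebesgue (\<lambda>x. (T (f x))\<^sup>2)"
  proof (rule Bochner_Integration.integrable_bound[OF fi])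
    show "AE x in lebesgue. norm ((T (f x))\<^sup>2) \<le> norm (cmod (f x) powr 2)"
    proof (rule AE_I2)
      fix x
      have "\<bar>T (f x)\<bar>\<^sup>2 \<le> (cmod (f x))\<^sup>2" by (intro power_mono le) simp
      then show "norm ((T (f x))\<^sup>2) \<le> norm (cmod (f x) powr 2)" by simp
    qed
  qed (use m in measurable)
qed

lemma H1_component_integrable:
  fixes u :: "real^3 \<Rightarrow> complex"
  assumes u: "u \<in> H1" and T: "bounded_linear T" and le: "\<And>z. \<bar>T z\<bar> \<le> cmod z" and q: "2 < q" "q < 6"
  shows "integrable lebesgue (\<lambda>x. \<bar>T (u x) :: real\<bar> powr q)"
proof -
  have u2: "u \<in> Lp 2" using u by (simp add: H1_def)
  have "\<forall>i. \<exists>g. g \<in> Lp 2 \<and> has_weak_partial i u g" using u by (auto simp: H1_def)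
  then obtain g where g: "\<And>i. g i \<in> Lp 2" "\<And>i. has_weak_partial i u (g i)" by metis
  note Tu = Lp_2_component[OF u2 T le] and Tg = Lp_2_component[OF g(1) T le]
  obtain w where w: "w \<in> borel_measurable borel" "AE x in lebesgue. T (u x) = w x"
    using borel_representative[OF Tu(1)] by blast
  have "\<forall>i. \<exists>h. h \<in> borel_measurable borel \<and> (AE x in lebesgue. T (g i x) = h x)"
    using borel_representative[OF Tg(1)] by metis
  then obtain h where h: "\<And>i. h i \<in> borel_measurable borel" "\<And>i. AE x in lebesgue. T (g i x) = h i x" by metis
  have "borel_weak_partial i w (h i)" for i
    by (rule borel_weak_partialI[OF has_weak_partial_bounded_linear[OF g(2) T] w h])
  moreover have "integrable lborel (\<lambda>x. (w x)\<^sup>2)"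
    using integrable_representative[OF Tu(1) w, of "\<lambda>y. y\<^sup>2"] Tu(2) by simp
  moreover have "integrable lborel (\<lambda>x. (h i x)\<^sup>2)" for i
    using integrable_representative[OF Tg(1) h, of "\<lambda>y. y\<^sup>2" i] Tg(2) by simp
  ultimately have "integrable lborel (\<lambda>x. \<bar>w x\<bar> powr q)"
    using q by (intro sobolev_real[of w h q])
  then show ?thesis using integrable_representative[OF Tu(1) w, of "\<lambda>y. \<bar>y\<bar> powr q"] by simp
qed

text \<open>The Sobolev embedding below the critical exponent \<open>6\<close>, from the real case applied to real and
  imaginary part.\<close>

theorem H1_Lp:
  fixes u :: "real^3 \<Rightarrow> complex"
  assumes u: "u \<in> H1" and q: "2 < q" "q < 6"
  shows "u \<in> Lp q"
proof -
  have um: "u \<in> borel_measurable lebesgue" using u by (simp add: H1_def Lp_def)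
  have i: "integrable lebesgue (\<lambda>x. 2 powr q * (\<bar>Re (u x)\<bar> powr q + \<bar>Im (u x)\<bar> powr q))"
    using H1_component_integrable[OF u bounded_linear_Re abs_Re_le_cmod q]
      H1_component_integrable[OF u bounded_linear_Im abs_Im_le_cmod q] by simp
  have "integrable lebesgue (\<lambda>x. cmod (u x) powr q)"
  proof (rule Bochner_Integration.integrable_bound[OF i])
    show "(\<lambda>x. cmod (u x) powr q) \<in> borel_measurable lebesgue" using um by measurable
    show "AE x in lebesgue. norm (cmod (u x) powr q) \<le> norm (2 powr q * (\<bar>Re (u x)\<bar> powr q + \<bar>Im (u x)\<bar> powr q))"
    proof (rule AE_I2)
      fix x
      define a where "a = max \<bar>Re (u x)\<bar> \<bar>Im (u x)\<bar>"
      have a: "a \<ge> 0" by (simp add: a_def)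
      have "cmod (u x) \<le> 2 * a" using cmod_le[of "u x"] by (simp add: a_def)
      then have "cmod (u x) powr q \<le> (2 * a) powr q" using q by (intro powr_mono2) auto
      also have "\<dots> = 2 powr q * a powr q" using a by (simp add: powr_mult)
      also have "a powr q \<le> \<bar>Re (u x)\<bar> powr q + \<bar>Im (u x)\<bar> powr q" by (auto simp: a_def max_def)
      finally show "norm (cmod (u x) powr q) \<le> norm (2 powr q * (\<bar>Re (u x)\<bar> powr q + \<bar>Im (u x)\<bar> powr q))"
        by (simp add: mult_left_mono)
    qed
  qed
  with um show ?thesis by (simp add: Lp_def)
qed

section \<open>Bounds for the Newtonian potential\<close>

lemma nn_integral_Lnorm:
  fixes f :: "real^'n \<Rightarrow> 'b::{banach,second_countable_topology}"
  assumes "f \<in> Lp r" "r > 0"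
  shows "(\<integral>\<^sup>+x. ennreal (norm (f x) powr r) \<partial>lborel) = ennreal (Lnorm r f powr r)"
proof -
  have "(\<integral>\<^sup>+x. ennreal (norm (f x) powr r) \<partial>lborel) = (\<integral>\<^sup>+x. ennreal (norm (f x) powr r) \<partial>lebesgue)"
    by (rule nn_integral_completion[symmetric])
  also have "\<dots> = ennreal (LINT x|lebesgue. norm (f x) powr r)"
    using assms by (intro nn_integral_eq_integral) (auto simp: Lp_def)
  also have "(LINT x|lebesgue. norm (f x) powr r) = Lnorm r f powr r"
    using assms(2) by (simp add: Lnorm_def powr_powr Bochner_Integration.integral_nonneg)
  finally show ?thesis .
qed

lemma Lnorm_nonneg: "Lnorm r f \<ge> 0" by (simp add: Lnorm_def)

definition newton_const :: real where
  "newton_const = (ball_vol powr (1/2) + ball_vol powr (1/6)) / pi"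

lemma newton_const_pos: "newton_const > 0"
  unfolding newton_const_def by (intro divide_pos_pos add_pos_pos) auto

lemma S0_representative:
  assumes "AE x in lebesgue. (cmod (u x))\<^sup>2 = v x" "v \<in> borel_measurable borel" "(\<lambda>x. (cmod (u x))\<^sup>2) \<in> borel_measurable lebesgue"
  shows "S0 u x = (LINT y|lborel. v y / (8 * pi * norm (x - y)))"
proof -
  have [measurable]: "v \<in> borel_measurable borel" by fact
  have "S0 u x = (LINT y|lebesgue. 1 / (8 * pi * norm (x - y)) * (cmod (u y))\<^sup>2)" by (simp add: S0_def conv_def)
  also have "\<dots> = (LINT y|lborel. 1 / (8 * pi * norm (x - y)) * v y)"
    by (rule LINT_representative[OF assms(3,2,1)]) measurable
  finally show ?thesis by simp
qed

lemma S0_nonneg: "S0 u x \<ge> 0"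
  unfolding S0_def conv_def by (intro Bochner_Integration.integral_nonneg) auto

lemma density_representative:
  fixes u :: "real^3 \<Rightarrow> complex"
  assumes "u \<in> borel_measurable lebesgue"
  obtains v where "v \<in> borel_measurable borel" "AE x in lebesgue. (cmod (u x))\<^sup>2 = v x" "\<forall>x. 0 \<le> v x"
proof -
  have "(\<lambda>x. (cmod (u x))\<^sup>2) \<in> borel_measurable lebesgue" using assms by measurable
  then obtain v where v: "v \<in> borel_measurable borel" "AE x in lebesgue. (cmod (u x))\<^sup>2 = v x"
    by (rule borel_representative)
  from v(2) have "AE x in lebesgue. (cmod (u x))\<^sup>2 = \<bar>v x\<bar>"
    by eventually_elim (metis abs_of_nonneg zero_le_power2)
  with v(1) show ?thesis by (intro that[of "\<lambda>x. \<bar>v x\<bar>"]) auto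
qed

lemma S0_measurable:
  assumes u: "u \<in> borel_measurable lebesgue"
  shows "S0 u \<in> borel_measurable borel"
proof -
  obtain v where v: "v \<in> borel_measurable borel" "AE x in lebesgue. (cmod (u x))\<^sup>2 = v x"
    by (rule density_representative[OF u])
  have [measurable]: "v \<in> borel_measurable borel" by fact
  have um: "(\<lambda>x. (cmod (u x))\<^sup>2) \<in> borel_measurable lebesgue" using u by measurable
  have "S0 u = (\<lambda>x. LINT y|lborel. v y / (8 * pi * norm (x - y)))"
    by (rule ext) (rule S0_representative[OF v(2,1) um])
  also have "\<dots> \<in> borel_measurable borel" by measurable
  finally show ?thesis .
qed

text \<open>Apply \<open>newton_pairing\<close> to \<open>f = \<bar>u\<bar>\<^sup>2\<close>. The exponent \<open>3\<close> of \<open>u\<close> lies between \<open>2\<close> and \<open>p + 1\<close>, and the pointwise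
  bound of \<open>t\<^sup>3\<close> by the powers \<open>2\<close> and \<open>p + 1\<close>, split at the height \<open>U\<close>, replaces interpolation of norms.\<close>

lemma S0_pairing:
  fixes u :: "real^3 \<Rightarrow> complex"
  assumes p: "2 < p" "p < 5" and u: "u \<in> H1" and h: "h \<in> borel_measurable borel"
    and b: "b \<ge> 0" "(\<integral>\<^sup>+x. ennreal (\<bar>h x\<bar> powr (6/5)) \<partial>lborel) \<le> ennreal (b powr (6/5))"
  shows "(\<integral>\<^sup>+x. ennreal (S0 u x * \<bar>h x\<bar>) \<partial>lborel)
    \<le> ennreal (newton_const * ((Lnorm 2 u)\<^sup>2 + (Lnorm (p + 1) u)\<^sup>2) * b)"
proof -
  have um: "u \<in> borel_measurable lebesgue" and u2: "u \<in> Lp 2" using u by (auto simp: H1_def Lp_def)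
  have up: "u \<in> Lp (p + 1)" using p by (intro H1_Lp[OF u]) auto
  obtain v where v: "v \<in> borel_measurable borel" "AE x in lebesgue. (cmod (u x))\<^sup>2 = v x" "\<forall>x. 0 \<le> v x"
    by (rule density_representative[OF um])
  have [measurable]: "v \<in> borel_measurable borel" "h \<in> borel_measurable borel" by fact+
  have u2m: "(\<lambda>x. (cmod (u x))\<^sup>2) \<in> borel_measurable lebesgue" using um by measurable
  have S: "ennreal (S0 u x * \<bar>h x\<bar>) \<le> ennreal (1 / (8 * pi)) * (\<integral>\<^sup>+y. ennreal (v y * \<bar>h x\<bar> / norm (x - y)) \<partial>lborel)" for x
  proof -
    have "S0 u x = enn2real (\<integral>\<^sup>+y. ennreal (v y / (8 * pi * norm (x - y))) \<partial>lborel)"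
      unfolding S0_representative[OF v(2,1) u2m] using v(3) by (intro integral_eq_nn_integral) auto
    then have "ennreal (S0 u x) \<le> (\<integral>\<^sup>+y. ennreal (v y / (8 * pi * norm (x - y))) \<partial>lborel)"
      by (simp add: ennreal_enn2real_if)
    then have "ennreal (S0 u x) * ennreal \<bar>h x\<bar> \<le> (\<integral>\<^sup>+y. ennreal (v y / (8 * pi * norm (x - y))) \<partial>lborel) * ennreal \<bar>h x\<bar>"
      by (rule mult_right_mono) simp
    also have "\<dots> = (\<integral>\<^sup>+y. ennreal (v y / (8 * pi * norm (x - y))) * ennreal \<bar>h x\<bar> \<partial>lborel)"
      by (rule nn_integral_multc[symmetric]) measurable
    also have "\<dots> = (\<integral>\<^sup>+y. ennreal (1 / (8 * pi)) * ennreal (v y * \<bar>h x\<bar> / norm (x - y)) \<partial>lborel)"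
      using v(3) by (intro nn_integral_cong) (simp add: ennreal_mult[symmetric] field_simps)
    also have "\<dots> = ennreal (1 / (8 * pi)) * (\<integral>\<^sup>+y. ennreal (v y * \<bar>h x\<bar> / norm (x - y)) \<partial>lborel)"
      by (rule nn_integral_cmult) measurable
    finally show ?thesis by (simp add: ennreal_mult S0_nonneg)
  qed
  define B2 Bp where "B2 = Lnorm 2 u" and "Bp = Lnorm (p + 1) u"
  have B: "B2 \<ge> 0" "Bp \<ge> 0" by (simp_all add: B2_def Bp_def Lnorm_nonneg)
  define c where "c = ball_vol powr (1/2) + ball_vol powr (1/6)"
  have c: "c \<ge> 0" by (simp add: c_def)
  \<comment> \<open>The bound needs positive norms; adding \<open>\<epsilon>\<close> avoids treating vanishing functions separately.\<close>
  have eps: "(\<integral>\<^sup>+x. ennreal (S0 u x * \<bar>h x\<bar>) \<partial>lborel) \<le> ennreal (c / (2 * pi) * (B2 + Bp + \<epsilon>)\<^sup>2 * (b + \<epsilon>))"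
    if e: "\<epsilon> > 0" for \<epsilon> :: real
  proof -
    define U where "U = B2 + Bp + \<epsilon>"
    have U: "U > 0" "B2 \<le> U" "Bp \<le> U" using B e by (auto simp: U_def)
    have i2: "(\<integral>\<^sup>+x. ennreal (v x) \<partial>lborel) \<le> ennreal (U\<^sup>2)"
    proof -
      have "(\<integral>\<^sup>+x. ennreal (v x) \<partial>lborel) = (\<integral>\<^sup>+x. ennreal (cmod (u x) powr 2) \<partial>lebesgue)"
        unfolding nn_integral_completion[of lborel "\<lambda>x. ennreal (v x)", symmetric]
        using v(2) by (intro nn_integral_cong_AE) (auto elim!: eventually_mono)
      also have "\<dots> = ennreal (B2\<^sup>2)" using nn_integral_Lnorm[OF u2] B by (simp add: nn_integral_completion B2_def)
      also have "\<dots> \<le> ennreal (U\<^sup>2)" using U B by (intro ennreal_leI power_mono)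
      finally show ?thesis .
    qed
    have ip: "(\<integral>\<^sup>+x. ennreal (v x powr ((p + 1) / 2)) \<partial>lborel) \<le> ennreal (U powr (p + 1))"
    proof -
      have "(\<integral>\<^sup>+x. ennreal (v x powr ((p + 1) / 2)) \<partial>lborel) = (\<integral>\<^sup>+x. ennreal (cmod (u x) powr (p + 1)) \<partial>lebesgue)"
        unfolding nn_integral_completion[of lborel "\<lambda>x. ennreal (v x powr ((p + 1) / 2))", symmetric]
      proof (rule nn_integral_cong_AE)
        show "AE x in lebesgue. ennreal (v x powr ((p + 1) / 2)) = ennreal (cmod (u x) powr (p + 1))"
          using v(2)
        proof eventually_elim
          case (elim x)
          have e2: "2 * ((p + 1) / 2) = p + 1" by simp
          have "(cmod (u x))\<^sup>2 = cmod (u x) powr 2" by simp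
          then have "(cmod (u x))\<^sup>2 powr ((p + 1) / 2) = cmod (u x) powr (p + 1)"
            by (simp only: powr_powr e2)
          with elim show ?case by simp
        qed
      qed
      also have "\<dots> = ennreal (Bp powr (p + 1))"
        using nn_integral_Lnorm[OF up] p by (simp add: nn_integral_completion Bp_def)
      also have "\<dots> \<le> ennreal (U powr (p + 1))" using U B p by (intro ennreal_leI powr_mono2) auto
      finally show ?thesis .
    qed
    have pw: "v x powr (3/2) \<le> U * v x + U powr (2 - p) * v x powr ((p + 1) / 2)" for x
    proof (cases "v x = 0")
      case False
      then have vx: "v x > 0" using v(3) by (simp add: less_le)
      define t where "t = v x powr (1/2)"
      have t: "t > 0" using vx by (simp add: t_def)
      have vt: "v x = t powr 2" "v x powr (3/2) = t powr 3" "v x powr ((p + 1) / 2) = t powr (p + 1)"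
        using vx by (auto simp: t_def powr_powr)
      show ?thesis
      proof (cases "t \<le> U")
        case True
        have "t powr 3 = t * t powr 2" using t by (simp add: power2_eq_square power3_eq_cube)
        also have "\<dots> \<le> U * t powr 2" using True by (intro mult_right_mono) auto
        finally show ?thesis unfolding vt(2,3) unfolding vt(1) by (simp add: add_increasing2)
      next
        case False
        have "t powr 3 = t powr (2 - p) * t powr (p + 1)" using t by (subst powr_add[symmetric]) simp
        also have "\<dots> \<le> U powr (2 - p) * t powr (p + 1)"
          using False p U by (intro mult_right_mono powr_mono2') auto
        finally show ?thesis unfolding vt(2,3) unfolding vt(1) using U by (simp add: add_increasing)
      qed
    qed simp
    have i3: "(\<integral>\<^sup>+x. ennreal (v x powr (3/2)) \<partial>lborel) \<le> ennreal ((2 * U\<^sup>2) powr (3/2))"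
    proof -
      have "(\<integral>\<^sup>+x. ennreal (v x powr (3/2)) \<partial>lborel) \<le> (\<integral>\<^sup>+x. ennreal U * ennreal (v x) + ennreal (U powr (2 - p)) * ennreal (v x powr ((p + 1) / 2)) \<partial>lborel)"
      proof (rule nn_integral_mono)
        fix x
        have "ennreal (v x powr (3/2)) \<le> ennreal (U * v x + U powr (2 - p) * v x powr ((p + 1) / 2))"
          by (rule ennreal_leI[OF pw])
        then show "ennreal (v x powr (3/2)) \<le> ennreal U * ennreal (v x) + ennreal (U powr (2 - p)) * ennreal (v x powr ((p + 1) / 2))"
          using U v(3) by (simp add: ennreal_mult)
      qed
      also have "\<dots> = ennreal U * (\<integral>\<^sup>+x. ennreal (v x) \<partial>lborel) + ennreal (U powr (2 - p)) * (\<integral>\<^sup>+x. ennreal (v x powr ((p + 1) / 2)) \<partial>lborel)"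
        by (simp add: nn_integral_add nn_integral_cmult)
      also have "\<dots> \<le> ennreal U * ennreal (U\<^sup>2) + ennreal (U powr (2 - p)) * ennreal (U powr (p + 1))"
        by (intro add_mono mult_left_mono i2 ip) auto
      also have "\<dots> = ennreal (U * U\<^sup>2 + U powr (2 - p) * U powr (p + 1))"
        using U by (simp add: ennreal_mult)
      also have "U * U\<^sup>2 + U powr (2 - p) * U powr (p + 1) = 2 * U ^ 3"
        using U by (simp add: powr_add[symmetric] power2_eq_square power3_eq_cube)
      also have "2 * U ^ 3 \<le> (2 * U\<^sup>2) powr (3/2)"
      proof -
        have "U ^ 3 = (U\<^sup>2) powr (3/2)" using U by (simp add: powr_powr flip: powr_numeral)
        moreover have "(2::real) powr 1 \<le> 2 powr (3/2)" by (rule powr_mono) auto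
        ultimately show ?thesis using U by (simp add: powr_mult)
      qed
      finally show ?thesis by (simp add: ennreal_leI)
    qed
    have "(\<integral>\<^sup>+x. ennreal (S0 u x * \<bar>h x\<bar>) \<partial>lborel) \<le> (\<integral>\<^sup>+x. ennreal (1 / (8 * pi)) * (\<integral>\<^sup>+y. ennreal (v y * \<bar>h x\<bar> / norm (x - y)) \<partial>lborel) \<partial>lborel)"
      by (intro nn_integral_mono S)
    also have "\<dots> = ennreal (1 / (8 * pi)) * (\<integral>\<^sup>+x. \<integral>\<^sup>+y. ennreal (v y * \<bar>h x\<bar> / norm (x - y)) \<partial>lborel \<partial>lborel)"
      by (rule nn_integral_cmult) measurable
    also have "\<dots> \<le> ennreal (1 / (8 * pi)) * ennreal (2 * c * (2 * U\<^sup>2) * (b + \<epsilon>))"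
    proof (intro mult_left_mono)
      have "ennreal (U\<^sup>2) \<le> ennreal (2 * U\<^sup>2)" by (intro ennreal_leI) simp
      moreover have "ennreal (b powr (6/5)) \<le> ennreal ((b + \<epsilon>) powr (6/5))"
        using b e by (intro ennreal_leI powr_mono2) auto
      ultimately show "(\<integral>\<^sup>+x. \<integral>\<^sup>+y. ennreal (v y * \<bar>h x\<bar> / norm (x - y)) \<partial>lborel \<partial>lborel) \<le> ennreal (2 * c * (2 * U\<^sup>2) * (b + \<epsilon>))"
        unfolding c_def using v(3) U b e i3 i2 by (intro newton_pairing) (auto intro: order_trans)
    qed simp
    also have "\<dots> = ennreal (c / (2 * pi) * U\<^sup>2 * (b + \<epsilon>))"
      using c U b e by (subst ennreal_mult[symmetric]) (auto simp: field_simps)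
    finally show ?thesis by (simp add: U_def)
  qed
  have "(\<integral>\<^sup>+x. ennreal (S0 u x * \<bar>h x\<bar>) \<partial>lborel) \<le> ennreal (c / (2 * pi) * (B2 + Bp + 0)\<^sup>2 * (b + 0))"
  proof (rule tendsto_lowerbound)
    show "((\<lambda>\<epsilon>. ennreal (c / (2 * pi) * (B2 + Bp + \<epsilon>)\<^sup>2 * (b + \<epsilon>))) \<longlongrightarrow> ennreal (c / (2 * pi) * (B2 + Bp + 0)\<^sup>2 * (b + 0))) (at_right 0)"
      by (intro tendsto_ennrealI tendsto_intros)
    show "\<forall>\<^sub>F \<epsilon> in at_right 0. (\<integral>\<^sup>+x. ennreal (S0 u x * \<bar>h x\<bar>) \<partial>lborel) \<le> ennreal (c / (2 * pi) * (B2 + Bp + \<epsilon>)\<^sup>2 * (b + \<epsilon>))"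
      using eps by (intro eventually_at_rightI[of 0 1]) auto
  qed simp
  also have "\<dots> \<le> ennreal (newton_const * (B2\<^sup>2 + Bp\<^sup>2) * b)"
  proof (rule ennreal_leI)
    have "(B2 + Bp)\<^sup>2 \<le> 2 * (B2\<^sup>2 + Bp\<^sup>2)"
    proof -
      have "0 \<le> (B2 - Bp)\<^sup>2" by simp
      then show ?thesis by (simp add: power2_eq_square algebra_simps)
    qed
    then have "c / (2 * pi) * (B2 + Bp)\<^sup>2 * b \<le> c / (2 * pi) * (2 * (B2\<^sup>2 + Bp\<^sup>2)) * b"
      using c b by (intro mult_right_mono mult_left_mono) auto
    then show "c / (2 * pi) * (B2 + Bp + 0)\<^sup>2 * (b + 0) \<le> newton_const * (B2\<^sup>2 + Bp\<^sup>2) * b"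
    proof -
      have "c / (2 * pi) * (2 * (B2\<^sup>2 + Bp\<^sup>2)) * b = newton_const * (B2\<^sup>2 + Bp\<^sup>2) * b"
      proof -
        have "c / (2 * pi) * (2 * Y) * b = c / pi * Y * b" for Y by simp
        then show ?thesis unfolding newton_const_def c_def[symmetric] .
      qed
      then show ?thesis using \<open>c / (2 * pi) * (B2 + Bp)\<^sup>2 * b \<le> _\<close> by simp
    qed
  qed
  finally show ?thesis by (simp add: B2_def Bp_def)
qed

section \<open>Dilations of the doping profile\<close>

lemma loc_integrable_mult_continuous:
  fixes k f :: "real^'n \<Rightarrow> real"
  assumes f: "loc_integrable f" and k: "continuous_on UNIV k"
  shows "loc_integrable (\<lambda>x. k x * f x)"
  unfolding loc_integrable_def set_integrable_def
proof (intro conjI allI)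
  have [measurable]: "f \<in> borel_measurable borel" "k \<in> borel_measurable borel"
    using f k by (auto intro: loc_integrable_measurable borel_measurable_continuous_onI)
  show "(\<lambda>x. k x * f x) \<in> borel_measurable borel" by measurable
  fix R
  have "compact (k ` cball 0 R)" using k by (intro compact_continuous_image) (auto intro: continuous_on_subset)
  then obtain M where M: "\<And>x. x \<in> cball 0 R \<Longrightarrow> \<bar>k x\<bar> \<le> M"
    using compact_imp_bounded bounded_iff by (metis image_eqI real_norm_def)
  have "integrable lborel (\<lambda>x. (indicator (cball 0 R) x * k x) * f x)"
  proof (rule loc_integrable_bounded_support[OF f, of _ "max M 0" R])
    show "(\<lambda>x. indicator (cball 0 R) x * k x) \<in> borel_measurable borel"
      unfolding indicator_def mem_cball_0 by measurable
    show "\<bar>indicator (cball 0 R) x * k x\<bar> \<le> max M 0" for x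
      using M[of x] by (auto simp: indicator_def)
    show "norm x \<le> R" if "indicator (cball 0 R) x * k x \<noteq> 0" for x
      using that by (auto simp: indicator_def split: if_splits)
  qed
  then show "integrable lborel (\<lambda>x. indicator (cball 0 R) x *\<^sub>R (k x * f x))" by (simp add: mult.assoc)
qed

lemma loc_integrable_sum:
  assumes "\<And>i. i \<in> A \<Longrightarrow> loc_integrable (f i)"
  shows "loc_integrable (\<lambda>x. \<Sum>i\<in>A. f i x)"
  using assms unfolding loc_integrable_def set_integrable_def scaleR_sum_right
  by (auto intro!: Bochner_Integration.integrable_sum borel_measurable_sum)

lemma loc_integrable_add:
  assumes "loc_integrable f" "loc_integrable g" shows "loc_integrable (\<lambda>x. f x + g x)"
  using assms unfolding loc_integrable_def by (auto intro!: set_integral_add)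

lemma weak_derivative_along_scale:
  assumes "weak_derivative_along 1 0 f G"
  shows "weak_derivative_along c 0 f (\<lambda>x. c * G x)"
proof -
  have G: "loc_integrable G" and f: "loc_integrable f" using assms by (auto simp: weak_derivative_along_def)
  have "loc_integrable (\<lambda>x. c * G x)" by (rule loc_integrable_mult_continuous[OF G]) simp
  moreover have "(LINT x|lborel. ((\<Sum>i\<in>UNIV. (c * x $ i + 0 $ i) * partial i \<phi> x) + real CARD('a) * c * \<phi> x) * f x)
      = - (LINT x|lborel. \<phi> x * (c * G x))" if t: "test_function \<phi>" for \<phi>
  proof -
    have "((\<Sum>i\<in>UNIV. (c * x $ i + 0 $ i) * partial i \<phi> x) + real CARD('a) * c * \<phi> x) * f x
      = c * (((\<Sum>i\<in>UNIV. (1 * x $ i + 0 $ i) * partial i \<phi> x) + real CARD('a) * 1 * \<phi> x) * f x)" (is "?l x = c * ?r x") for x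
    proof -
      have "(\<Sum>i\<in>UNIV. (c * x $ i + 0 $ i) * partial i \<phi> x) = c * (\<Sum>i\<in>UNIV. (1 * x $ i + 0 $ i) * partial i \<phi> x)"
        by (simp add: sum_distrib_left mult.assoc)
      moreover have "(c * A + n * c * B) * y = c * ((A + n * 1 * B) * y)" for A n B y by (simp add: algebra_simps)
      ultimately show ?thesis by (simp only:)
    qed
    then have "(LINT x|lborel. ?l x) = (LINT x|lborel. c * ?r x)"
      by (intro Bochner_Integration.integral_cong refl)
    also have "\<dots> = c * (LINT x|lborel. ?r x)" by (rule integral_mult_right_zero)
    also have "\<dots> = c * - (LINT x|lborel. \<phi> x * G x)"
      using assms t unfolding weak_derivative_along_def by simp
    also have "\<dots> = - (LINT x|lborel. c * (\<phi> x * G x))" by simp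
    also have "(\<lambda>x. c * (\<phi> x * G x)) = (\<lambda>x. \<phi> x * (c * G x))" by (simp add: mult.left_commute)
    finally show ?thesis .
  qed
  ultimately show ?thesis using f unfolding weak_derivative_along_def by blast
qed

lemma partial_coord_mult:
  fixes \<phi> :: "real^'n \<Rightarrow> real"
  assumes \<phi>: "test_function \<phi>"
  shows "partial i (\<lambda>x. x $ j * \<phi> x) x = x $ j * partial i \<phi> x + (if i = j then \<phi> x else 0)"
    and "test_function (\<lambda>x. x $ j * \<phi> x)"
proof -
  have d: "((\<lambda>x::real^'n. x $ j) has_derivative (\<lambda>x. x $ j)) (at x)"
    by (rule bounded_linear_imp_has_derivative) (rule bounded_linear_vec_nth)
  have "partial i (\<lambda>x. x $ j) x = (if i = j then 1 else 0)"
    using partial_eqI[OF d, of i] by (simp add: axis_def)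
  then show "partial i (\<lambda>x. x $ j * \<phi> x) x = x $ j * partial i \<phi> x + (if i = j then \<phi> x else 0)"
    using partial_mult[OF differentiableI[OF d] test_function_D(1)[OF \<phi>], of i] by simp
  show "test_function (\<lambda>x. x $ j * \<phi> x)" by (rule test_function_mult[OF \<phi> Ck_coord])
qed

lemma continuous_coord: "continuous_on UNIV (\<lambda>x::real^'n. x $ i)"
  by (intro continuous_intros)

text \<open>Test with \<open>x $ i * \<phi>\<close>, whose partial derivative in direction \<open>i\<close> produces the divergence term.\<close>

lemma euler_gradient:
  fixes f :: "real^'n \<Rightarrow> real"
  assumes w: "\<And>i. borel_weak_partial i f (g i)"
  shows "weak_derivative_along 1 0 f (\<lambda>x. \<Sum>i\<in>UNIV. x $ i * g i x)"
proof -
  have f: "loc_integrable f" and g: "loc_integrable (g i)" for i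
    using w by (auto simp: borel_weak_partial_def)
  have "(LINT x|lborel. ((\<Sum>i\<in>UNIV. (1 * x $ i + 0 $ i) * partial i \<phi> x) + real CARD('n) * 1 * \<phi> x) * f x)
      = - (LINT x|lborel. \<phi> x * (\<Sum>i\<in>UNIV. x $ i * g i x))" if t: "test_function \<phi>" for \<phi>
  proof -
    have "((\<Sum>i\<in>UNIV. (1 * x $ i + 0 $ i) * partial i \<phi> x) + real CARD('n) * 1 * \<phi> x) * f x
      = (\<Sum>i\<in>UNIV. partial i (\<lambda>x. x $ i * \<phi> x) x * f x)" for x
      by (simp add: partial_coord_mult[OF t] sum.distrib sum_distrib_right distrib_right)
    then have "(LINT x|lborel. ((\<Sum>i\<in>UNIV. (1 * x $ i + 0 $ i) * partial i \<phi> x) + real CARD('n) * 1 * \<phi> x) * f x)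
      = (LINT x|lborel. (\<Sum>i\<in>UNIV. partial i (\<lambda>x. x $ i * \<phi> x) x * f x))" by simp
    also have "\<dots> = (\<Sum>i\<in>UNIV. LINT x|lborel. partial i (\<lambda>x. x $ i * \<phi> x) x * f x)"
      by (intro Bochner_Integration.integral_sum loc_integrable_test_function[OF f] test_function_partial partial_coord_mult t)
    also have "\<dots> = (\<Sum>i\<in>UNIV. - (LINT x|lborel. (x $ i * \<phi> x) * g i x))"
      using w partial_coord_mult(2)[OF t] by (intro sum.cong) (auto simp: borel_weak_partial_def)
    also have "\<dots> = - (LINT x|lborel. (\<Sum>i\<in>UNIV. (x $ i * \<phi> x) * g i x))"
      by (subst Bochner_Integration.integral_sum)
        (auto simp: sum_negf intro!: loc_integrable_test_function[OF g] partial_coord_mult t)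
    also have "(\<lambda>x. \<Sum>i\<in>UNIV. (x $ i * \<phi> x) * g i x) = (\<lambda>x. \<phi> x * (\<Sum>i\<in>UNIV. x $ i * g i x))"
      by (simp add: sum_distrib_left mult_ac)
    finally show ?thesis .
  qed
  moreover have "loc_integrable (\<lambda>x. \<Sum>i\<in>UNIV. x $ i * g i x)"
    by (intro loc_integrable_sum loc_integrable_mult_continuous g continuous_coord)
  ultimately show ?thesis using f unfolding weak_derivative_along_def by blast
qed

lemma weak_derivative_along_coord_mult:
  fixes f :: "real^'n \<Rightarrow> real"
  assumes w: "weak_derivative_along 1 0 f G"
  shows "weak_derivative_along 1 0 (\<lambda>x. x $ j * f x) (\<lambda>x. x $ j * G x + x $ j * f x)"
proof -
  have f: "loc_integrable f" and G: "loc_integrable G" using w by (auto simp: weak_derivative_along_def)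
  have fj: "loc_integrable (\<lambda>x. x $ j * f x)" and Gj: "loc_integrable (\<lambda>x. x $ j * G x)"
    by (intro loc_integrable_mult_continuous f G continuous_coord)+
  have "(LINT x|lborel. ((\<Sum>i\<in>UNIV. (1 * x $ i + 0 $ i) * partial i \<phi> x) + real CARD('n) * 1 * \<phi> x) * (x $ j * f x))
      = - (LINT x|lborel. \<phi> x * (x $ j * G x + x $ j * f x))" (is "?lhs = _") if t: "test_function \<phi>" for \<phi>
  proof -
    let ?\<psi> = "\<lambda>x. x $ j * \<phi> x"
    let ?X = "\<lambda>x. ((\<Sum>i\<in>UNIV. (1 * x $ i + 0 $ i) * partial i ?\<psi> x) + real CARD('n) * 1 * ?\<psi> x) * f x"
    have \<psi>: "test_function ?\<psi>" by (rule partial_coord_mult[OF t])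
    have "(\<Sum>i\<in>UNIV. x $ i * (if i = j then \<phi> x else 0)) = x $ j * \<phi> x" for x
      by (simp add: if_distrib[of "\<lambda>y. _ * y"] cong: if_cong)
    moreover have "(\<Sum>i\<in>UNIV. x $ i * (x $ j * partial i \<phi> x)) = x $ j * (\<Sum>i\<in>UNIV. x $ i * partial i \<phi> x)" for x
      by (simp add: sum_distrib_left mult.left_commute)
    ultimately have s: "(\<Sum>i\<in>UNIV. (1 * x $ i + 0 $ i) * partial i ?\<psi> x) =
        x $ j * (\<Sum>i\<in>UNIV. (1 * x $ i + 0 $ i) * partial i \<phi> x) + x $ j * \<phi> x" for x
      unfolding partial_coord_mult(1)[OF t] by (simp add: distrib_left sum.distrib)
    have "(A + n * 1 * B) * (X * y) = ((X * A + X * B) + n * 1 * (X * B)) * y - X * B * y" for A B n X y :: real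
      by (simp add: algebra_simps)
    then have e: "((\<Sum>i\<in>UNIV. (1 * x $ i + 0 $ i) * partial i \<phi> x) + real CARD('n) * 1 * \<phi> x) * (x $ j * f x)
       = ?X x - ?\<psi> x * f x" for x
      unfolding s .
    have i1: "integrable lborel (\<lambda>x. ?\<psi> x * f x)" by (rule loc_integrable_test_function[OF f \<psi>])
    have tX: "test_function (\<lambda>x. (x $ i) * partial i ?\<psi> x)" for i
      by (rule test_function_mult[OF test_function_partial[OF \<psi>] Ck_coord])
    have "integrable lborel (\<lambda>x. (\<Sum>i\<in>UNIV. (x $ i * partial i ?\<psi> x) * f x) + real CARD('n) * (?\<psi> x * f x))"
      by (intro Bochner_Integration.integrable_add Bochner_Integration.integrable_sum integrable_mult_right i1 loc_integrable_test_function[OF f tX])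
    then have i2: "integrable lborel ?X" by (simp add: sum_distrib_right distrib_right mult.assoc)
    have "?lhs = (LINT x|lborel. ?X x) - (LINT x|lborel. ?\<psi> x * f x)"
      unfolding e by (rule Bochner_Integration.integral_diff[OF i2 i1])
    also have "(LINT x|lborel. ?X x) = - (LINT x|lborel. ?\<psi> x * G x)"
      using w \<psi> unfolding weak_derivative_along_def by blast
    also have "- (LINT x|lborel. ?\<psi> x * G x) - (LINT x|lborel. ?\<psi> x * f x) = - (LINT x|lborel. ?\<psi> x * G x + ?\<psi> x * f x)"
      by (subst Bochner_Integration.integral_add[OF loc_integrable_test_function[OF G \<psi>] i1]) simp
    also have "(\<lambda>x. ?\<psi> x * G x + ?\<psi> x * f x) = (\<lambda>x. \<phi> x * (x $ j * G x + x $ j * f x))"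
      by (simp add: algebra_simps)
    finally show ?thesis .
  qed
  then show ?thesis using fj Gj loc_integrable_add[OF Gj fj] unfolding weak_derivative_along_def by blast
qed

lemma weak_derivative_along_sum:
  fixes f :: "'i \<Rightarrow> real^'n \<Rightarrow> real"
  assumes w: "\<And>j. j \<in> A \<Longrightarrow> weak_derivative_along 1 0 (f j) (G j)"
  shows "weak_derivative_along 1 0 (\<lambda>x. \<Sum>j\<in>A. f j x) (\<lambda>x. \<Sum>j\<in>A. G j x)"
proof -
  have f: "loc_integrable (f j)" and G: "loc_integrable (G j)" if "j \<in> A" for j
    using w[OF that] by (auto simp: weak_derivative_along_def)
  have "(LINT x|lborel. ((\<Sum>i\<in>UNIV. (1 * x $ i + 0 $ i) * partial i \<phi> x) + real CARD('n) * 1 * \<phi> x) * (\<Sum>j\<in>A. f j x))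
      = - (LINT x|lborel. \<phi> x * (\<Sum>j\<in>A. G j x))" if t: "test_function \<phi>" for \<phi>
  proof -
    let ?X = "\<lambda>x. (\<Sum>i\<in>UNIV. (1 * x $ i + 0 $ i) * partial i \<phi> x) + real CARD('n) * 1 * \<phi> x"
    have i: "integrable lborel (\<lambda>x. ?X x * f j x)" if j: "j \<in> A" for j
    proof -
      have "integrable lborel (\<lambda>x. (\<Sum>i\<in>UNIV. (x $ i * partial i \<phi> x) * f j x) + real CARD('n) * (\<phi> x * f j x))"
        by (intro Bochner_Integration.integrable_add Bochner_Integration.integrable_sum integrable_mult_right
            loc_integrable_test_function[OF f[OF j]] t test_function_mult[OF test_function_partial[OF t] Ck_coord])
      then show ?thesis by (simp add: sum_distrib_right distrib_right mult.assoc)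
    qed
    have "(LINT x|lborel. ?X x * (\<Sum>j\<in>A. f j x)) = (\<Sum>j\<in>A. LINT x|lborel. ?X x * f j x)"
      unfolding sum_distrib_left by (rule Bochner_Integration.integral_sum[OF i])
    also have "\<dots> = (\<Sum>j\<in>A. - (LINT x|lborel. \<phi> x * G j x))"
      using w t unfolding weak_derivative_along_def by (intro sum.cong) blast+
    also have "\<dots> = - (LINT x|lborel. \<phi> x * (\<Sum>j\<in>A. G j x))"
      unfolding sum_distrib_left sum_negf
      by (subst Bochner_Integration.integral_sum[OF loc_integrable_test_function[OF G t]]) auto
    finally show ?thesis .
  qed
  moreover have "loc_integrable (\<lambda>x. \<Sum>j\<in>A. f j x)" "loc_integrable (\<lambda>x. \<Sum>j\<in>A. G j x)"
    by (rule loc_integrable_sum, erule f, rule loc_integrable_sum, erule G)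
  ultimately show ?thesis unfolding weak_derivative_along_def by blast
qed

text \<open>Applying the Euler operator twice gives the Hessian form plus one more Euler derivative, because
  it also differentiates the factor \<open>x $ j\<close>.\<close>

lemma euler_hessian:
  fixes g :: "'n \<Rightarrow> real^'n \<Rightarrow> real"
  assumes w: "\<And>i j. borel_weak_partial i (g j) (H i j)"
  shows "weak_derivative_along 1 0 (\<lambda>x. \<Sum>j\<in>UNIV. x $ j * g j x)
    (\<lambda>x. (\<Sum>i\<in>UNIV. x $ i * (\<Sum>j\<in>UNIV. H i j x * x $ j)) + (\<Sum>j\<in>UNIV. x $ j * g j x))"
proof -
  have "weak_derivative_along 1 0 (\<lambda>x. \<Sum>j\<in>UNIV. x $ j * g j x)
     (\<lambda>x. \<Sum>j\<in>UNIV. x $ j * (\<Sum>i\<in>UNIV. x $ i * H i j x) + x $ j * g j x)"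
    by (intro weak_derivative_along_sum weak_derivative_along_coord_mult euler_gradient w)
  also have "(\<lambda>x. \<Sum>j\<in>UNIV. x $ j * (\<Sum>i\<in>UNIV. x $ i * H i j x) + x $ j * g j x) =
    (\<lambda>x. (\<Sum>i\<in>UNIV. x $ i * (\<Sum>j\<in>UNIV. H i j x * x $ j)) + (\<Sum>j\<in>UNIV. x $ j * g j x))"
  proof
    fix x :: "real^'n"
    have "(\<Sum>j\<in>UNIV. x $ j * (\<Sum>i\<in>UNIV. x $ i * H i j x)) = (\<Sum>j\<in>UNIV. \<Sum>i\<in>UNIV. x $ i * (H i j x * x $ j))"
      by (simp add: sum_distrib_left mult_ac)
    also have "\<dots> = (\<Sum>i\<in>UNIV. \<Sum>j\<in>UNIV. x $ i * (H i j x * x $ j))" by (rule sum.swap)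
    also have "\<dots> = (\<Sum>i\<in>UNIV. x $ i * (\<Sum>j\<in>UNIV. H i j x * x $ j))" by (simp add: sum_distrib_left)
    finally show "(\<Sum>j\<in>UNIV. x $ j * (\<Sum>i\<in>UNIV. x $ i * H i j x) + x $ j * g j x) =
      (\<Sum>i\<in>UNIV. x $ i * (\<Sum>j\<in>UNIV. H i j x * x $ j)) + (\<Sum>j\<in>UNIV. x $ j * g j x)"
      by (simp add: sum.distrib)
  qed
  finally show ?thesis .
qed

text \<open>The function \<open>g\<close> is subtracted inside the time integral, whose length is \<open>1\<close>. With \<open>g = 0\<close> this is a bound
  of first order, and with \<open>g\<close> the derivative at time \<open>0\<close> it is the step to second order.\<close>

lemma flow_pairing:
  fixes f G g S :: "real^'n \<Rightarrow> real"
  assumes w: "weak_derivative_along c 0 f G" and [measurable]: "S \<in> borel_measurable borel" "g \<in> borel_measurable borel"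
    and S: "\<And>x. 0 \<le> S x"
  shows "(\<integral>\<^sup>+x. ennreal (S x * \<bar>f (exp c *\<^sub>R x) - f x - g x\<bar>) \<partial>lborel) \<le>
    (\<integral>\<^sup>+s. ennreal (indicator {0..1} s) * (\<integral>\<^sup>+x. ennreal (S x * \<bar>G (exp (c * s) *\<^sub>R x) - g x\<bar>) \<partial>lborel) \<partial>lborel)"
proof -
  have [measurable]: "G \<in> borel_measurable borel"
    using w by (auto simp: weak_derivative_along_def intro: loc_integrable_measurable)
  have "(\<integral>\<^sup>+x. ennreal (S x * \<bar>f (exp c *\<^sub>R x) - f x - g x\<bar>) \<partial>lborel) \<le>
     (\<integral>\<^sup>+x. \<integral>\<^sup>+s. ennreal (indicator {0..1} s) * ennreal (S x * \<bar>G (exp (c * s) *\<^sub>R x) - g x\<bar>) \<partial>lborel \<partial>lborel)"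
  proof (rule nn_integral_mono_AE)
    show "AE x in lborel. ennreal (S x * \<bar>f (exp c *\<^sub>R x) - f x - g x\<bar>) \<le>
      (\<integral>\<^sup>+s. ennreal (indicator {0..1} s) * ennreal (S x * \<bar>G (exp (c * s) *\<^sub>R x) - g x\<bar>) \<partial>lborel)"
      using weak_flow[OF w disjI2[OF refl]]
    proof eventually_elim
      case (elim x)
      let ?G = "\<lambda>s. G (exp (c * s) *\<^sub>R x)"
      have fl: "flow c 0 s x = exp (c * s) *\<^sub>R x" for s by (simp add: flow_def)
      have I: "set_integrable lborel {0..1::real} ?G" "f (exp c *\<^sub>R x) - f x = (LINT s:{0..1}|lborel. ?G s)"
        using elim by (simp_all add: fl)
      have gi: "set_integrable lborel {0..1::real} (\<lambda>s. g x)" by (simp add: set_integrable_def)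
      have "(LINT s:{0..1::real}|lborel. g x) = g x" by (simp add: set_lebesgue_integral_def)
      with I(2) have "f (exp c *\<^sub>R x) - f x - g x = (LINT s:{0..1}|lborel. ?G s - g x)"
        by (simp add: set_integral_diff(2)[OF I(1) gi])
      then have "ennreal \<bar>f (exp c *\<^sub>R x) - f x - g x\<bar> \<le> (\<integral>\<^sup>+s. ennreal (norm (indicator {0..1} s *\<^sub>R (?G s - g x))) \<partial>lborel)"
        using integral_norm_bound_ennreal[of lborel "\<lambda>s. indicator {0..1} s *\<^sub>R (?G s - g x)"] set_integral_diff(1)[OF I(1) gi]
        by (simp add: set_integrable_def set_lebesgue_integral_def)
      then have "ennreal (S x) * ennreal \<bar>f (exp c *\<^sub>R x) - f x - g x\<bar> \<le>
         ennreal (S x) * (\<integral>\<^sup>+s. ennreal (norm (indicator {0..1} s *\<^sub>R (?G s - g x))) \<partial>lborel)"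
        by (rule mult_left_mono) simp
      also have "\<dots> = (\<integral>\<^sup>+s. ennreal (S x) * ennreal (norm (indicator {0..1} s *\<^sub>R (?G s - g x))) \<partial>lborel)"
        by (rule nn_integral_cmult[symmetric]) measurable
      also have "\<dots> = (\<integral>\<^sup>+s. ennreal (indicator {0..1} s) * ennreal (S x * \<bar>?G s - g x\<bar>) \<partial>lborel)"
        using S by (intro nn_integral_cong) (auto simp: ennreal_mult[symmetric] split: split_indicator)
      finally show ?case using S by (simp add: ennreal_mult)
    qed
  qed
  also have "\<dots> = (\<integral>\<^sup>+s. \<integral>\<^sup>+x. ennreal (indicator {0..1} s) * ennreal (S x * \<bar>G (exp (c * s) *\<^sub>R x) - g x\<bar>) \<partial>lborel \<partial>lborel)"
    by (rule lborel_pair.Fubini') (unfold case_prod_beta, measurable)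
  also have "\<dots> = (\<integral>\<^sup>+s. ennreal (indicator {0..1} s) * (\<integral>\<^sup>+x. ennreal (S x * \<bar>G (exp (c * s) *\<^sub>R x) - g x\<bar>) \<partial>lborel) \<partial>lborel)"
    by (intro nn_integral_cong nn_integral_cmult) measurable
  finally show ?thesis .
qed

lemma nn_integral_unit_interval_le:
  assumes "\<And>s. s \<in> {0..1} \<Longrightarrow> F s \<le> C"
  shows "(\<integral>\<^sup>+s. ennreal (indicator {0..1::real} s) * F s \<partial>lborel) \<le> C"
proof -
  have "(\<integral>\<^sup>+s. ennreal (indicator {0..1::real} s) * F s \<partial>lborel) \<le> (\<integral>\<^sup>+s. C * indicator {0..1::real} s \<partial>lborel)"
    using assms by (intro nn_integral_mono) (auto split: split_indicator)
  also have "\<dots> = C" by (subst nn_integral_cmult_indicator) auto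
  finally show ?thesis .
qed

lemma dilation_taylor:
  fixes f D D2 S :: "real^'n \<Rightarrow> real"
  assumes f: "weak_derivative_along 1 0 f D" and D: "weak_derivative_along 1 0 D D2"
    and Sm: "S \<in> borel_measurable borel" and S: "\<And>x. 0 \<le> S x" and M: "M \<ge> 0"
    and bound: "\<And>a. \<bar>a\<bar> \<le> \<bar>t\<bar> \<Longrightarrow> (\<integral>\<^sup>+x. ennreal (S x * \<bar>D2 (exp a *\<^sub>R x)\<bar>) \<partial>lborel) \<le> ennreal M"
  shows "(\<integral>\<^sup>+x. ennreal (S x * \<bar>f (exp t *\<^sub>R x) - f x - t * D x\<bar>) \<partial>lborel) \<le> ennreal (t\<^sup>2 * M)"
proof -
  have [measurable]: "D \<in> borel_measurable borel" "D2 \<in> borel_measurable borel" "S \<in> borel_measurable borel"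
    using D Sm by (auto simp: weak_derivative_along_def intro: loc_integrable_measurable)
  have first: "(\<integral>\<^sup>+x. ennreal (S x * \<bar>D (exp a *\<^sub>R x) - D x\<bar>) \<partial>lborel) \<le> ennreal (\<bar>t\<bar> * M)" if a: "\<bar>a\<bar> \<le> \<bar>t\<bar>" for a
  proof -
    have "(\<integral>\<^sup>+x. ennreal (S x * \<bar>D (exp a *\<^sub>R x) - D x - 0\<bar>) \<partial>lborel) \<le>
       (\<integral>\<^sup>+s. ennreal (indicator {0..1} s) * (\<integral>\<^sup>+x. ennreal (S x * \<bar>a * D2 (exp (a * s) *\<^sub>R x) - 0\<bar>) \<partial>lborel) \<partial>lborel)"
      by (rule flow_pairing[OF weak_derivative_along_scale[OF D]]) (use Sm S in auto)
    also have "\<dots> \<le> ennreal (\<bar>t\<bar> * M)"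
    proof (rule nn_integral_unit_interval_le)
      fix s :: real assume s: "s \<in> {0..1}"
      have "\<bar>a * s\<bar> \<le> \<bar>a\<bar>" using s by (simp add: abs_mult mult_left_le)
      with a have as: "\<bar>a * s\<bar> \<le> \<bar>t\<bar>" by linarith
      have "(\<integral>\<^sup>+x. ennreal (S x * \<bar>a * D2 (exp (a * s) *\<^sub>R x) - 0\<bar>) \<partial>lborel)
        = (\<integral>\<^sup>+x. ennreal \<bar>a\<bar> * ennreal (S x * \<bar>D2 (exp (a * s) *\<^sub>R x)\<bar>) \<partial>lborel)"
        using S by (intro nn_integral_cong) (simp add: ennreal_mult[symmetric] abs_mult mult_ac)
      also have "\<dots> = ennreal \<bar>a\<bar> * (\<integral>\<^sup>+x. ennreal (S x * \<bar>D2 (exp (a * s) *\<^sub>R x)\<bar>) \<partial>lborel)"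
        by (rule nn_integral_cmult) measurable
      also have "\<dots> \<le> ennreal \<bar>t\<bar> * ennreal M"
        using a by (intro mult_mono bound[OF as] ennreal_leI) auto
      finally show "(\<integral>\<^sup>+x. ennreal (S x * \<bar>a * D2 (exp (a * s) *\<^sub>R x) - 0\<bar>) \<partial>lborel) \<le> ennreal (\<bar>t\<bar> * M)"
        using M by (simp add: ennreal_mult)
    qed
    finally show ?thesis by simp
  qed
  have "(\<integral>\<^sup>+x. ennreal (S x * \<bar>f (exp t *\<^sub>R x) - f x - t * D x\<bar>) \<partial>lborel) \<le>
     (\<integral>\<^sup>+s. ennreal (indicator {0..1} s) * (\<integral>\<^sup>+x. ennreal (S x * \<bar>t * D (exp (t * s) *\<^sub>R x) - t * D x\<bar>) \<partial>lborel) \<partial>lborel)"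
    by (rule flow_pairing[OF weak_derivative_along_scale[OF f]]) (use Sm S in auto)
  also have "\<dots> \<le> ennreal (t\<^sup>2 * M)"
  proof (rule nn_integral_unit_interval_le)
    fix s :: real assume s: "s \<in> {0..1}"
    have ts: "\<bar>t * s\<bar> \<le> \<bar>t\<bar>" using s by (simp add: abs_mult mult_left_le)
    have "(\<integral>\<^sup>+x. ennreal (S x * \<bar>t * D (exp (t * s) *\<^sub>R x) - t * D x\<bar>) \<partial>lborel)
      = (\<integral>\<^sup>+x. ennreal \<bar>t\<bar> * ennreal (S x * \<bar>D (exp (t * s) *\<^sub>R x) - D x\<bar>) \<partial>lborel)"
    proof (intro nn_integral_cong)
      fix x
      have "\<bar>t * D (exp (t * s) *\<^sub>R x) - t * D x\<bar> = \<bar>t\<bar> * \<bar>D (exp (t * s) *\<^sub>R x) - D x\<bar>"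
        by (simp add: abs_mult[symmetric] right_diff_distrib)
      then show "ennreal (S x * \<bar>t * D (exp (t * s) *\<^sub>R x) - t * D x\<bar>) = ennreal \<bar>t\<bar> * ennreal (S x * \<bar>D (exp (t * s) *\<^sub>R x) - D x\<bar>)"
        using S by (simp add: ennreal_mult[symmetric] mult_ac)
    qed
    also have "\<dots> = ennreal \<bar>t\<bar> * (\<integral>\<^sup>+x. ennreal (S x * \<bar>D (exp (t * s) *\<^sub>R x) - D x\<bar>) \<partial>lborel)"
      by (rule nn_integral_cmult) measurable
    also have "\<dots> \<le> ennreal \<bar>t\<bar> * ennreal (\<bar>t\<bar> * M)" by (intro mult_left_mono first ts) simp
    also have "\<dots> = ennreal (t\<^sup>2 * M)" using M by (simp add: ennreal_mult[symmetric] power2_eq_square mult.assoc[symmetric])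
    finally show "(\<integral>\<^sup>+x. ennreal (S x * \<bar>t * D (exp (t * s) *\<^sub>R x) - t * D x\<bar>) \<partial>lborel) \<le> ennreal (t\<^sup>2 * M)" .
  qed
  finally show ?thesis .
qed

lemma has_weak_partial_weak_partial:
  "\<exists>g. has_weak_partial i f g \<Longrightarrow> has_weak_partial i f (weak_partial i f)"
  unfolding weak_partial_def[of i f] by (erule someI_ex)

abbreviation pairing_const :: "real \<Rightarrow> (real^3 \<Rightarrow> complex) \<Rightarrow> real" where
  "pairing_const p u \<equiv> newton_const * ((Lnorm 2 u)\<^sup>2 + (Lnorm (p + 1) u)\<^sup>2)"

lemma pairing_const_nonneg: "pairing_const p u \<ge> 0"
  using newton_const_pos by (intro mult_nonneg_nonneg) auto

lemma integral_bound_of_nn_integral: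
  assumes m: "F \<in> borel_measurable M" and b: "B \<ge> 0" "(\<integral>\<^sup>+x. ennreal \<bar>F x\<bar> \<partial>M) \<le> ennreal B"
  shows "integrable M F" "\<bar>LINT x|M. F x\<bar> \<le> B"
proof -
  have "(\<integral>\<^sup>+x. ennreal (norm (F x)) \<partial>M) < \<infinity>" using b(2) by (simp add: le_less_trans)
  with m show i: "integrable M F" by (intro integrableI_bounded)
  have "ennreal \<bar>LINT x|M. F x\<bar> \<le> ennreal B"
    using integral_norm_bound_ennreal[OF i] b(2) by simp
  then show "\<bar>LINT x|M. F x\<bar> \<le> B" using b(1) by (simp add: ennreal_le_iff)
qed

lemma dilated_norm_bound:
  fixes h :: "real^3 \<Rightarrow> real"
  assumes h: "h \<in> borel_measurable borel" and r: "r > 0"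
    and b: "b \<ge> 0" "(\<integral>\<^sup>+x. ennreal (\<bar>h x\<bar> powr (6/5)) \<partial>lborel) \<le> ennreal (b powr (6/5))"
  shows "(\<integral>\<^sup>+x. ennreal (\<bar>h (r *\<^sub>R x)\<bar> powr (6/5)) \<partial>lborel) \<le> ennreal ((r powr (- 5/2) * b) powr (6/5))"
proof -
  have [measurable]: "h \<in> borel_measurable borel" by fact
  have "(\<integral>\<^sup>+x. ennreal (\<bar>h (r *\<^sub>R x + 0)\<bar> powr (6/5)) \<partial>lborel) = ennreal (1 / \<bar>r\<bar> ^ CARD(3)) * (\<integral>\<^sup>+x. ennreal (\<bar>h x\<bar> powr (6/5)) \<partial>lborel)"
    using r by (intro nn_integral_affine[where f="\<lambda>x. ennreal (\<bar>h x\<bar> powr (6/5))"]) auto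
  also have "\<dots> \<le> ennreal (1 / \<bar>r\<bar> ^ CARD(3)) * ennreal (b powr (6/5))"
    by (intro mult_left_mono b) simp
  also have "\<dots> = ennreal (1 / \<bar>r\<bar> ^ CARD(3) * b powr (6/5))" by (simp add: ennreal_mult[symmetric])
  also have "1 / \<bar>r\<bar> ^ CARD(3) * b powr (6/5) = (r powr (- 5/2) * b) powr (6/5)"
  proof -
    have "(r powr (- 5/2)) powr (6/5) = r powr - 3" by (simp add: powr_powr)
    also have "\<dots> = 1 / \<bar>r\<bar> ^ CARD(3)" using r by (simp add: powr_minus divide_inverse)
    finally show ?thesis using b by (simp add: powr_mult)
  qed
  finally show ?thesis by simp
qed

lemma Lnorm_representative:
  fixes f :: "real^3 \<Rightarrow> real"
  assumes f: "f \<in> Lp (6/5)" and eq: "AE x in lebesgue. f x = f' x"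
  shows "(\<integral>\<^sup>+x. ennreal (\<bar>f' x\<bar> powr (6/5)) \<partial>lborel) \<le> ennreal (Lnorm (6/5) f powr (6/5))"
proof -
  have "(\<integral>\<^sup>+x. ennreal (\<bar>f' x\<bar> powr (6/5)) \<partial>lborel) = (\<integral>\<^sup>+x. ennreal (\<bar>f' x\<bar> powr (6/5)) \<partial>lebesgue)"
    by (rule nn_integral_completion[symmetric])
  also have "\<dots> = (\<integral>\<^sup>+x. ennreal (norm (f x) powr (6/5)) \<partial>lebesgue)"
    using eq by (intro nn_integral_cong_AE) (auto elim!: eventually_mono)
  also have "\<dots> = ennreal (Lnorm (6/5) f powr (6/5))"
    using nn_integral_Lnorm[OF f] by (simp add: nn_integral_completion)
  finally show ?thesis by simp
qed

text \<open>Here \<open>m r\<close> is the pairing of \<open>S0 u\<close> with \<open>x \<mapsto> \<rho> (r x)\<close>, and \<open>m1\<close> is its derivative at \<open>r = 1\<close>. A dilation by \<open>r\<close>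
  multiplies the norm with exponent \<open>6/5\<close> by \<open>r powr (- 5/2)\<close>.\<close>

lemma doping_dilation:
  assumes p: "2 < p" "p < 5" and u: "u \<in> H1" and \<rho>: "doping_profile \<rho>"
  obtains m :: "real \<Rightarrow> real" and m1 :: real where
    "\<And>l. l > 0 \<Longrightarrow> (LINT x|lebesgue. S0 u (l *\<^sub>R x) * \<rho> x) = m (1 / l) / l ^ 3"
    "(LINT x|lebesgue. S0 u x * x_grad \<rho> x) = m1"
    "\<And>r. r > 0 \<Longrightarrow> \<bar>m r\<bar> \<le> r powr (- 5/2) * (pairing_const p u * N_fun \<rho>)"
    "\<bar>m1\<bar> \<le> pairing_const p u * N_fun \<rho>"
    "\<And>t. \<bar>m (exp t) - m 1 - t * m1\<bar> \<le> t\<^sup>2 * (exp (5/2 * \<bar>t\<bar>) * (pairing_const p u * N_fun \<rho>))"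
proof -
  define K where "K = pairing_const p u"
  have K: "K \<ge> 0" unfolding K_def by (rule pairing_const_nonneg)
  have um: "u \<in> borel_measurable lebesgue" using u by (simp add: H1_def Lp_def)
  have Sm [measurable]: "S0 u \<in> borel_measurable borel" by (rule S0_measurable[OF um])
  have L: "\<rho> \<in> Lp (6/5)" "x_grad \<rho> \<in> Lp (6/5)" "x_hess_x \<rho> \<in> Lp (6/5)" using \<rho> by (auto simp: doping_profile_def)
  define g where "g i = weak_partial i \<rho>" for i
  define H where "H i j = weak_partial i (weak_partial j \<rho>)" for i j
  have g: "has_weak_partial i \<rho> (g i)" for i
    unfolding g_def using \<rho> by (intro has_weak_partial_weak_partial) (simp add: doping_profile_def)
  have H: "has_weak_partial i (g j) (H i j)" for i j
    unfolding H_def g_def using \<rho> by (intro has_weak_partial_weak_partial) (simp add: doping_profile_def)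
  have loc: "\<rho> \<in> borel_measurable lebesgue" "g i \<in> borel_measurable lebesgue" "H i j \<in> borel_measurable lebesgue" for i j
    using g H Lp_loc_D(1) unfolding has_weak_partial_def by blast+
  obtain r0 where r0: "r0 \<in> borel_measurable borel" "AE x in lebesgue. \<rho> x = r0 x"
    using borel_representative[OF loc(1)] by blast
  have rep: "\<exists>h'. h' \<in> borel_measurable borel \<and> (AE x in lebesgue. h x = h' x)"
    if "h \<in> borel_measurable lebesgue" for h :: "real^3 \<Rightarrow> real"
    using borel_representative[OF that] by blast
  have "\<forall>i. \<exists>h. h \<in> borel_measurable borel \<and> (AE x in lebesgue. g i x = h x)"
    by (intro allI rep loc)
  then obtain gb where gb: "\<And>i. gb i \<in> borel_measurable borel" "\<And>i. AE x in lebesgue. g i x = gb i x" by metis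
  have "\<forall>i j. \<exists>h. h \<in> borel_measurable borel \<and> (AE x in lebesgue. H i j x = h x)"
    by (intro allI rep loc)
  then obtain Hb where Hb: "\<And>i j. Hb i j \<in> borel_measurable borel" "\<And>i j. AE x in lebesgue. H i j x = Hb i j x" by metis
  have [measurable]: "r0 \<in> borel_measurable borel" "\<And>i. gb i \<in> borel_measurable borel" "\<And>i j. Hb i j \<in> borel_measurable borel"
    by fact+
  define D where "D x = (\<Sum>i\<in>UNIV. x $ i * gb i x)" for x
  define Hx where "Hx x = (\<Sum>i\<in>UNIV. x $ i * (\<Sum>j\<in>UNIV. Hb i j x * x $ j))" for x
  have Dm [measurable]: "D \<in> borel_measurable borel" unfolding D_def[abs_def] by measurable
  have Hxm [measurable]: "Hx \<in> borel_measurable borel" unfolding Hx_def[abs_def] by measurable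
  have gbi: "AE x in lebesgue. \<forall>i. g i x = gb i x" by (intro eventually_all_finite gb)
  have D: "AE x in lebesgue. x_grad \<rho> x = D x"
    using gbi
    by eventually_elim (simp add: x_grad_def weak_grad_def inner_vec_def D_def g_def[symmetric])
  have "AE x in lebesgue. \<forall>i j. H i j x = Hb i j x"
    by (intro eventually_all_finite Hb)
  then have Hx: "AE x in lebesgue. x_hess_x \<rho> x = Hx x"
    by eventually_elim (simp add: x_hess_x_def weak_hess_def inner_vec_def matrix_vector_mult_def Hx_def H_def[symmetric])
  have wf: "weak_derivative_along 1 0 r0 D"
    unfolding D_def[abs_def] by (rule euler_gradient) (rule borel_weak_partialI[OF g r0 gb])
  have wD: "weak_derivative_along 1 0 D (\<lambda>x. Hx x + D x)"
    unfolding D_def[abs_def] Hx_def[abs_def] by (rule euler_hessian) (rule borel_weak_partialI[OF H gb Hb])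
  define b0 b1 b2 where "b0 = Lnorm (6/5) \<rho>" and "b1 = Lnorm (6/5) (x_grad \<rho>)" and "b2 = Lnorm (6/5) (x_hess_x \<rho>)"
  have b: "b0 \<ge> 0" "b1 \<ge> 0" "b2 \<ge> 0" by (simp_all add: b0_def b1_def b2_def Lnorm_nonneg)
  have N: "N_fun \<rho> = b0 + b1 + b2" by (simp add: N_fun_def b0_def b1_def b2_def)
  note B0 = Lnorm_representative[OF L(1) r0(2), folded b0_def]
    and B1 = Lnorm_representative[OF L(2) D, folded b1_def]
    and B2 = Lnorm_representative[OF L(3) Hx, folded b2_def]
  have pair: "(\<integral>\<^sup>+x. ennreal (S0 u x * \<bar>h (r *\<^sub>R x)\<bar>) \<partial>lborel) \<le> ennreal (r powr (- 5/2) * (K * c))"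
    if "h \<in> borel_measurable borel" "c \<ge> 0" "r > 0"
      "(\<integral>\<^sup>+x. ennreal (\<bar>h x\<bar> powr (6/5)) \<partial>lborel) \<le> ennreal (c powr (6/5))" for h :: "real^3 \<Rightarrow> real" and c r
  proof -
    have [measurable]: "h \<in> borel_measurable borel" by fact
    have "(\<integral>\<^sup>+x. ennreal (S0 u x * \<bar>h (r *\<^sub>R x)\<bar>) \<partial>lborel) \<le> ennreal (K * (r powr (- 5/2) * c))"
      unfolding K_def
      by (rule S0_pairing[OF p u, of "\<lambda>x. h (r *\<^sub>R x)"])
        (use that dilated_norm_bound[OF that(1,3,2,4)] in auto)
    then show ?thesis by (simp add: mult.left_commute)
  qed
  have pair_int: "integrable lborel (\<lambda>x. S0 u x * h (r *\<^sub>R x))"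
      "\<bar>LINT x|lborel. S0 u x * h (r *\<^sub>R x)\<bar> \<le> r powr (- 5/2) * (K * c)"
    if "h \<in> borel_measurable borel" "c \<ge> 0" "r > 0"
      "(\<integral>\<^sup>+x. ennreal (\<bar>h x\<bar> powr (6/5)) \<partial>lborel) \<le> ennreal (c powr (6/5))" for h :: "real^3 \<Rightarrow> real" and c r
  proof -
    have [measurable]: "h \<in> borel_measurable borel" by fact
    have m: "(\<lambda>x. S0 u x * h (r *\<^sub>R x)) \<in> borel_measurable lborel" by measurable
    have "(\<integral>\<^sup>+x. ennreal \<bar>S0 u x * h (r *\<^sub>R x)\<bar> \<partial>lborel) \<le> ennreal (r powr (- 5/2) * (K * c))"
      using pair[OF that] by (simp add: abs_mult S0_nonneg)
    moreover have "0 \<le> r powr (- 5/2) * (K * c)" using K that by simp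
    ultimately show "integrable lborel (\<lambda>x. S0 u x * h (r *\<^sub>R x))"
      "\<bar>LINT x|lborel. S0 u x * h (r *\<^sub>R x)\<bar> \<le> r powr (- 5/2) * (K * c)"
      using integral_bound_of_nn_integral[OF m] by blast+
  qed
  define m where "m r = (LINT x|lborel. S0 u x * r0 (r *\<^sub>R x))" for r
  define m1 where "m1 = (LINT x|lborel. S0 u x * D x)"
  have KN: "K * b0 \<le> K * N_fun \<rho>" "K * b1 \<le> K * N_fun \<rho>" "K * (b1 + b2) \<le> K * N_fun \<rho>"
    using K b unfolding N by (auto intro!: mult_left_mono)
  have int1: "integrable lborel (\<lambda>x. S0 u x * D x)" using pair_int(1)[OF Dm b(2) zero_less_one B1] by simp
  show ?thesis
  proof (rule that[of m m1], unfold K_def[symmetric])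
    fix l :: real assume l: "l > 0"
    have "(LINT x|lebesgue. S0 u (l *\<^sub>R x) * \<rho> x) = (LINT x|lborel. S0 u (l *\<^sub>R x) * r0 x)"
      by (rule LINT_representative[OF loc(1) r0]) measurable
    also have "\<dots> = (LINT x|lborel. S0 u (l *\<^sub>R x + 0) * r0 ((1 / l) *\<^sub>R (l *\<^sub>R x + 0)))" using l by simp
    also have "\<dots> = (1 / \<bar>l\<bar> ^ CARD(3)) *\<^sub>R (LINT x|lborel. S0 u x * r0 ((1 / l) *\<^sub>R x))"
      by (rule integral_affine[OF pair_int(1)[OF r0(1) b(1) _ B0]]) (use l in auto)
    finally show "(LINT x|lebesgue. S0 u (l *\<^sub>R x) * \<rho> x) = m (1 / l) / l ^ 3"
      using l by (simp add: m_def)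
  next
    show "(LINT x|lebesgue. S0 u x * x_grad \<rho> x) = m1"
      unfolding m1_def using L(2) by (intro LINT_representative[OF _ Dm D] Sm) (simp add: Lp_def)
    show "\<bar>m1\<bar> \<le> K * N_fun \<rho>"
      using pair_int(2)[OF Dm b(2) zero_less_one B1] KN(2) by (simp add: m1_def)
    fix r :: real assume r: "r > 0"
    have "\<bar>m r\<bar> \<le> r powr (- 5/2) * (K * b0)" unfolding m_def by (rule pair_int(2)[OF r0(1) b(1) r B0])
    also have "\<dots> \<le> r powr (- 5/2) * (K * N_fun \<rho>)" by (intro mult_left_mono KN) simp
    finally show "\<bar>m r\<bar> \<le> r powr (- 5/2) * (K * N_fun \<rho>)" .
  next
    fix t :: real
    define M where "M = exp (5/2 * \<bar>t\<bar>) * (K * N_fun \<rho>)"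
    have KN0: "K * N_fun \<rho> \<ge> 0" using K b unfolding N by simp
    have M: "M \<ge> 0" using KN0 by (simp add: M_def)
    have bound: "(\<integral>\<^sup>+x. ennreal (S0 u x * \<bar>Hx (exp a *\<^sub>R x) + D (exp a *\<^sub>R x)\<bar>) \<partial>lborel) \<le> ennreal M"
      if a: "\<bar>a\<bar> \<le> \<bar>t\<bar>" for a
    proof -
      have e: "exp a powr (- 5/2) \<le> exp (5/2 * \<bar>t\<bar>)" using a by (simp add: exp_powr_real)
      have "(\<integral>\<^sup>+x. ennreal (S0 u x * \<bar>Hx (exp a *\<^sub>R x) + D (exp a *\<^sub>R x)\<bar>) \<partial>lborel) \<le>
        (\<integral>\<^sup>+x. ennreal (S0 u x * \<bar>Hx (exp a *\<^sub>R x)\<bar>) + ennreal (S0 u x * \<bar>D (exp a *\<^sub>R x)\<bar>) \<partial>lborel)"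
      proof (rule nn_integral_mono)
        fix x
        have "S0 u x * \<bar>Hx (exp a *\<^sub>R x) + D (exp a *\<^sub>R x)\<bar> \<le> S0 u x * \<bar>Hx (exp a *\<^sub>R x)\<bar> + S0 u x * \<bar>D (exp a *\<^sub>R x)\<bar>"
          unfolding distrib_left[symmetric] by (intro mult_left_mono S0_nonneg abs_triangle_ineq)
        then have "ennreal (S0 u x * \<bar>Hx (exp a *\<^sub>R x) + D (exp a *\<^sub>R x)\<bar>) \<le> ennreal (S0 u x * \<bar>Hx (exp a *\<^sub>R x)\<bar> + S0 u x * \<bar>D (exp a *\<^sub>R x)\<bar>)"
          by (rule ennreal_leI)
        then show "ennreal (S0 u x * \<bar>Hx (exp a *\<^sub>R x) + D (exp a *\<^sub>R x)\<bar>) \<le> ennreal (S0 u x * \<bar>Hx (exp a *\<^sub>R x)\<bar>) + ennreal (S0 u x * \<bar>D (exp a *\<^sub>R x)\<bar>)"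
          by (simp add: S0_nonneg)
      qed
      also have "\<dots> = (\<integral>\<^sup>+x. ennreal (S0 u x * \<bar>Hx (exp a *\<^sub>R x)\<bar>) \<partial>lborel) + (\<integral>\<^sup>+x. ennreal (S0 u x * \<bar>D (exp a *\<^sub>R x)\<bar>) \<partial>lborel)"
        by (rule nn_integral_add) measurable
      also have "\<dots> \<le> ennreal (exp a powr (- 5/2) * (K * b2)) + ennreal (exp a powr (- 5/2) * (K * b1))"
        by (intro add_mono pair Hxm Dm b B1 B2 exp_gt_zero)
      also have "\<dots> = ennreal (exp a powr (- 5/2) * (K * (b1 + b2)))"
        using K b by (subst ennreal_plus[symmetric]) (auto simp: algebra_simps)
      also have "\<dots> \<le> ennreal M"
        unfolding M_def using e KN(3) K b by (intro ennreal_leI mult_mono) (auto simp: N)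
      finally show ?thesis .
    qed
    have T: "(\<integral>\<^sup>+x. ennreal (S0 u x * \<bar>r0 (exp t *\<^sub>R x) - r0 x - t * D x\<bar>) \<partial>lborel) \<le> ennreal (t\<^sup>2 * M)"
      by (rule dilation_taylor[OF wf wD Sm S0_nonneg M bound])
    have i0: "integrable lborel (\<lambda>x. S0 u x * r0 (exp t *\<^sub>R x))" by (rule pair_int(1)[OF r0(1) b(1) exp_gt_zero B0])
    have i1: "integrable lborel (\<lambda>x. S0 u x * r0 x)" using pair_int(1)[OF r0(1) b(1) zero_less_one B0] by simp
    have "m (exp t) - m 1 - t * m1 = (LINT x|lborel. S0 u x * r0 (exp t *\<^sub>R x) - S0 u x * r0 x - t * (S0 u x * D x))"
      using i0 i1 int1 by (simp add: m_def m1_def)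
    also have "\<dots> = (LINT x|lborel. S0 u x * (r0 (exp t *\<^sub>R x) - r0 x - t * D x))"
      by (intro Bochner_Integration.integral_cong) (auto simp: algebra_simps)
    also have "\<bar>\<dots>\<bar> \<le> t\<^sup>2 * M"
    proof (rule integral_bound_of_nn_integral(2))
      show "(\<integral>\<^sup>+x. ennreal \<bar>S0 u x * (r0 (exp t *\<^sub>R x) - r0 x - t * D x)\<bar> \<partial>lborel) \<le> ennreal (t\<^sup>2 * M)"
        using T by (simp add: abs_mult S0_nonneg)
    qed (use M in \<open>measurable, simp\<close>)
    finally show "\<bar>m (exp t) - m 1 - t * m1\<bar> \<le> t\<^sup>2 * (exp (5/2 * \<bar>t\<bar>) * (K * N_fun \<rho>))"
      by (simp add: M_def)
  qed
qed

section \<open>Scaling laws\<close>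

lemma lebesgue_dilation:
  fixes f :: "real^3 \<Rightarrow> 'b::{banach,second_countable_topology}"
  assumes f: "f \<in> borel_measurable lebesgue" and l: "l > 0"
  shows "(\<lambda>x. f (l *\<^sub>R x)) \<in> borel_measurable lebesgue"
    and "integrable lebesgue (\<lambda>x. f (l *\<^sub>R x)) \<longleftrightarrow> integrable lebesgue f"
    and "(LINT x|lebesgue. f (l *\<^sub>R x)) = (1 / l ^ 3) *\<^sub>R (LINT x|lebesgue. f x)"
proof -
  let ?T = "\<lambda>x::real^3. 0 + (\<Sum>j\<in>Basis. (l * (x \<bullet> j)) *\<^sub>R j)"
  have T: "?T x = l *\<^sub>R x" for x
    by (simp add: scaleR_scaleR[symmetric] scaleR_sum_right[symmetric] euclidean_representation del: scaleR_scaleR)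
  have m [measurable]: "(\<lambda>x. l *\<^sub>R x) \<in> (lebesgue :: (real^3) measure) \<rightarrow>\<^sub>M lebesgue"
    using lebesgue_affine_measurable[of "\<lambda>_. l" "0::real^3"] l unfolding T by simp
  have leb: "(lebesgue :: (real^3) measure) = density (distr lebesgue lebesgue (\<lambda>x. l *\<^sub>R x)) (\<lambda>_. ennreal (l ^ 3))"
    using lebesgue_affine_euclidean[of "\<lambda>_. l" "0::real^3"] l unfolding T by simp
  show fm: "(\<lambda>x. f (l *\<^sub>R x)) \<in> borel_measurable lebesgue" using measurable_compose[OF m f] .
  have "integrable lebesgue f \<longleftrightarrow> integrable (density (distr lebesgue lebesgue (\<lambda>x. l *\<^sub>R x)) (\<lambda>_. ennreal (l ^ 3))) f"
    using leb by simp
  also have "\<dots> \<longleftrightarrow> integrable lebesgue (\<lambda>x. l ^ 3 *\<^sub>R f (l *\<^sub>R x))"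
    using l f m by (subst integrable_density) (auto simp: integrable_distr_eq)
  also have "\<dots> \<longleftrightarrow> integrable lebesgue (\<lambda>x. f (l *\<^sub>R x))"
  proof
    assume "integrable lebesgue (\<lambda>x. l ^ 3 *\<^sub>R f (l *\<^sub>R x))"
    then have "integrable lebesgue (\<lambda>x. (1 / l ^ 3) *\<^sub>R (l ^ 3 *\<^sub>R f (l *\<^sub>R x)))" by (rule integrable_scaleR_right)
    then show "integrable lebesgue (\<lambda>x. f (l *\<^sub>R x))" using l by simp
  qed simp
  finally show "integrable lebesgue (\<lambda>x. f (l *\<^sub>R x)) \<longleftrightarrow> integrable lebesgue f" ..
  have "(LINT x|lebesgue. f x) = (LINT x|density (distr lebesgue lebesgue (\<lambda>x. l *\<^sub>R x)) (\<lambda>_. ennreal (l ^ 3)). f x)"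
    using leb by simp
  also have "\<dots> = l ^ 3 *\<^sub>R (LINT x|lebesgue. f (l *\<^sub>R x))"
    using l f m by (subst integral_density) (auto simp: integral_distr)
  finally show "(LINT x|lebesgue. f (l *\<^sub>R x)) = (1 / l ^ 3) *\<^sub>R (LINT x|lebesgue. f x)" using l by simp
qed

lemma Lp_loc_dilation:
  fixes f :: "real^3 \<Rightarrow> 'b::{banach,second_countable_topology}"
  assumes f: "f \<in> Lp_loc 1" and l: "l > 0"
  shows "(\<lambda>x. a *\<^sub>R f (l *\<^sub>R x)) \<in> Lp_loc 1"
  unfolding Lp_loc_def
proof (intro CollectI allI impI)
  fix S :: "(real^3) set" assume S: "compact S"
  define F where "F y = indicat_real ((\<lambda>x. l *\<^sub>R x) ` S) y *\<^sub>R f y" for y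
  have "compact ((\<lambda>x. l *\<^sub>R x) ` S)" using S by (rule compact_scaling)
  with f have F: "F \<in> borel_measurable lebesgue" "integrable lebesgue (\<lambda>x. norm (F x) powr 1)"
    by (auto simp: Lp_loc_def Lp_def F_def[abs_def])
  have ind: "l *\<^sub>R x \<in> (\<lambda>x. l *\<^sub>R x) ` S \<longleftrightarrow> x \<in> S" for x using l by auto
  have eq: "indicat_real S x *\<^sub>R (a *\<^sub>R f (l *\<^sub>R x)) = a *\<^sub>R F (l *\<^sub>R x)" for x
    unfolding F_def indicator_def ind by simp
  have m: "(\<lambda>x. F (l *\<^sub>R x)) \<in> borel_measurable lebesgue" by (rule lebesgue_dilation(1)[OF F(1) l])
  have "(\<lambda>x. norm (F x) powr 1) \<in> borel_measurable lebesgue" using F(2) by (rule borel_measurable_integrable)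
  from lebesgue_dilation(2)[OF this l] F(2)
  have "integrable lebesgue (\<lambda>x. norm (F (l *\<^sub>R x)) powr 1)" by simp
  then have "integrable lebesgue (\<lambda>x. \<bar>a\<bar> * norm (F (l *\<^sub>R x)) powr 1)" by (rule integrable_mult_right)
  then have "integrable lebesgue (\<lambda>x. norm (a *\<^sub>R F (l *\<^sub>R x)) powr 1)" by simp
  with m show "(\<lambda>x. indicat_real S x *\<^sub>R (a *\<^sub>R f (l *\<^sub>R x))) \<in> Lp 1"
    unfolding eq Lp_def by (auto intro!: borel_measurable_scaleR)
qed

lemma has_weak_partial_dilation:
  fixes f :: "real^3 \<Rightarrow> 'b::{banach,second_countable_topology}"
  assumes w: "has_weak_partial i f g" and l: "l > 0"
  shows "has_weak_partial i (\<lambda>x. a *\<^sub>R f (l *\<^sub>R x)) (\<lambda>x. (a * l) *\<^sub>R g (l *\<^sub>R x))"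
proof -
  have L: "f \<in> Lp_loc 1" "g \<in> Lp_loc 1" using w by (auto simp: has_weak_partial_def)
  have "(LINT x|lebesgue. partial i \<phi> x *\<^sub>R (a *\<^sub>R f (l *\<^sub>R x))) = - (LINT x|lebesgue. \<phi> x *\<^sub>R ((a * l) *\<^sub>R g (l *\<^sub>R x)))"
    if t: "test_function \<phi>" for \<phi>
  proof -
    define \<psi> where "\<psi> y = \<phi> ((1 / l) *\<^sub>R y + 0)" for y
    have \<psi>: "test_function \<psi>" unfolding \<psi>_def[abs_def] using l by (intro test_function_affine t) simp
    have "partial i \<psi> y = 1 / l * partial i \<phi> ((1 / l) *\<^sub>R y + 0)" for y
      unfolding \<psi>_def[abs_def] by (rule partial_affine(2)[OF test_function_D(1)[OF t]])
    then have p: "partial i \<phi> x = l * partial i \<psi> (l *\<^sub>R x)" for x using l by simp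
    have q: "\<phi> x = \<psi> (l *\<^sub>R x)" for x using l by (simp add: \<psi>_def)
    have i1: "integrable lebesgue (\<lambda>y. partial i \<psi> y *\<^sub>R f y)" by (rule Lp_loc_test_integrable[OF L(1) test_function_partial[OF \<psi>]])
    have i2: "integrable lebesgue (\<lambda>y. \<psi> y *\<^sub>R g y)" by (rule Lp_loc_test_integrable[OF L(2) \<psi>])
    have "(LINT x|lebesgue. partial i \<phi> x *\<^sub>R (a *\<^sub>R f (l *\<^sub>R x))) = (LINT x|lebesgue. (a * l) *\<^sub>R (partial i \<psi> (l *\<^sub>R x) *\<^sub>R f (l *\<^sub>R x)))"
      unfolding p by (simp add: mult_ac)
    also have "\<dots> = (a * l) *\<^sub>R (1 / l ^ 3) *\<^sub>R (LINT y|lebesgue. partial i \<psi> y *\<^sub>R f y)"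
      by (simp only: integral_scaleR_right lebesgue_dilation(3)[OF borel_measurable_integrable[OF i1] l])
    also have "(LINT y|lebesgue. partial i \<psi> y *\<^sub>R f y) = - (LINT y|lebesgue. \<psi> y *\<^sub>R g y)"
      using w \<psi> by (simp add: has_weak_partial_def)
    also have "(a * l) *\<^sub>R (1 / l ^ 3) *\<^sub>R - (LINT y|lebesgue. \<psi> y *\<^sub>R g y) = - (LINT x|lebesgue. (a * l) *\<^sub>R (\<psi> (l *\<^sub>R x) *\<^sub>R g (l *\<^sub>R x)))"
      by (simp only: integral_scaleR_right lebesgue_dilation(3)[OF borel_measurable_integrable[OF i2] l] scaleR_minus_right)
    also have "(\<lambda>x. (a * l) *\<^sub>R (\<psi> (l *\<^sub>R x) *\<^sub>R g (l *\<^sub>R x))) = (\<lambda>x. \<phi> x *\<^sub>R ((a * l) *\<^sub>R g (l *\<^sub>R x)))"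
      by (rule ext) (simp add: q mult_ac)
    finally show ?thesis .
  qed
  with Lp_loc_dilation[OF L(1) l] Lp_loc_dilation[OF L(2) l] show ?thesis by (simp add: has_weak_partial_def)
qed

lemma Lnorm_powr:
  fixes f :: "real^'n \<Rightarrow> 'b::real_normed_vector"
  assumes "r > 0" shows "Lnorm r f powr r = (LINT x|lebesgue. norm (f x) powr r)"
  using assms by (simp add: Lnorm_def powr_powr Bochner_Integration.integral_nonneg)

lemma Lnorm_2_sq:
  fixes f :: "real^'n \<Rightarrow> 'b::real_normed_vector"
  shows "(Lnorm 2 f)\<^sup>2 = (LINT x|lebesgue. norm (f x) powr 2)"
  using Lnorm_powr[of 2 f] Lnorm_nonneg[of 2 f] by simp

lemma power_integral_scaled:
  assumes um: "u \<in> borel_measurable lebesgue" and l: "l > 0"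
  shows "(LINT x|lebesgue. norm (scaled l u x) powr r) = l powr (2 * r - 3) * (LINT x|lebesgue. norm (u x) powr r)"
proof -
  have l2: "(l\<^sup>2) powr r = l powr (2 * r)" using l by (simp add: powr_powr flip: powr_numeral)
  have m: "(\<lambda>x. norm (u x) powr r) \<in> borel_measurable lebesgue" using um by measurable
  have "(LINT x|lebesgue. norm (scaled l u x) powr r) = (LINT x|lebesgue. l powr (2 * r) * norm (u (l *\<^sub>R x)) powr r)"
    using l by (simp add: scaled_def powr_mult l2)
  also have "\<dots> = l powr (2 * r) * (1 / l ^ 3 * (LINT x|lebesgue. norm (u x) powr r))"
    using lebesgue_dilation(3)[OF m l] by simp
  also have "l powr (2 * r) * (1 / l ^ 3 * (LINT x|lebesgue. norm (u x) powr r)) = l powr (2 * r - 3) * (LINT x|lebesgue. norm (u x) powr r)"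
    using l by (simp add: powr_diff)
  finally show ?thesis .
qed

lemma H1_weak_partial:
  assumes "u \<in> H1"
  shows "has_weak_partial i u (weak_partial i u)"
proof (rule has_weak_partial_weak_partial)
  from assms have "\<exists>g\<in>Lp 2. has_weak_partial i u g" by (simp add: H1_def)
  then show "\<exists>g. has_weak_partial i u g" by blast
qed

lemma A_fun_scaled:
  assumes u: "u \<in> H1" and l: "l > 0"
  shows "A_fun (scaled l u) = l ^ 3 * A_fun u"
proof -
  let ?g = "\<lambda>i. weak_partial i u"
  have g: "has_weak_partial i u (?g i)" for i by (rule H1_weak_partial[OF u])
  have w: "has_weak_partial i (scaled l u) (\<lambda>x. (l\<^sup>2 * l) *\<^sub>R ?g i (l *\<^sub>R x))" for i
    unfolding scaled_def[abs_def] by (rule has_weak_partial_dilation[OF g l])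
  have w': "has_weak_partial i (scaled l u) (weak_partial i (scaled l u))" for i
    by (intro has_weak_partial_weak_partial exI) (rule w)
  have ae: "AE x in lebesgue. \<forall>i. weak_partial i (scaled l u) x = (l\<^sup>2 * l) *\<^sub>R ?g i (l *\<^sub>R x)"
    by (intro eventually_all_finite weak_partial_unique[OF w' w])
  have norm: "norm (weak_grad v x) powr 2 = (\<Sum>i\<in>UNIV. (cmod (weak_partial i v x))\<^sup>2)" for v :: "real^3 \<Rightarrow> complex" and x
    by (simp add: norm_vec_def weak_grad_def L2_set_def sum_nonneg)
  have [measurable]: "?g i \<in> borel_measurable lebesgue" "weak_partial i (scaled l u) \<in> borel_measurable lebesgue" for i
    using g w' Lp_loc_D(1) unfolding has_weak_partial_def by blast+
  have gm: "(\<lambda>x. \<Sum>i\<in>UNIV. (cmod (?g i x))\<^sup>2) \<in> borel_measurable lebesgue" by measurable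
  have gm': "(\<lambda>x. \<Sum>i\<in>UNIV. (cmod (?g i (l *\<^sub>R x)))\<^sup>2) \<in> borel_measurable lebesgue"
    using lebesgue_dilation(1)[OF gm l] .
  have "A_fun (scaled l u) = (LINT x|lebesgue. (\<Sum>i\<in>UNIV. (cmod (weak_partial i (scaled l u) x))\<^sup>2))"
    unfolding A_fun_def Lnorm_2_sq norm ..
  also have "\<dots> = (LINT x|lebesgue. l ^ 6 * (\<Sum>i\<in>UNIV. (cmod (?g i (l *\<^sub>R x)))\<^sup>2))"
  proof (rule integral_cong_AE)
    show "AE x in lebesgue. (\<Sum>i\<in>UNIV. (cmod (weak_partial i (scaled l u) x))\<^sup>2) = l ^ 6 * (\<Sum>i\<in>UNIV. (cmod (?g i (l *\<^sub>R x)))\<^sup>2)"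
      using ae
    proof eventually_elim
      case (elim x)
      have "(\<bar>l\<^sup>2 * l\<bar> * y)\<^sup>2 = l ^ 6 * y\<^sup>2" for y
        by (simp add: power_mult_distrib abs_mult power_abs[symmetric] flip: power_mult power_add)
      then show ?case using elim by (simp add: sum_distrib_left)
    qed
  qed (use gm' in measurable)
  also have "\<dots> = l ^ 6 * (1 / l ^ 3 * (LINT x|lebesgue. (\<Sum>i\<in>UNIV. (cmod (?g i x))\<^sup>2)))"
    using lebesgue_dilation(3)[OF gm l] by simp
  also have "\<dots> = l ^ 3 * (LINT x|lebesgue. (\<Sum>i\<in>UNIV. (cmod (?g i x))\<^sup>2))"
    using l by (simp add: field_simps flip: power_add)
  also have "(LINT x|lebesgue. (\<Sum>i\<in>UNIV. (cmod (?g i x))\<^sup>2)) = A_fun u"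
    unfolding A_fun_def Lnorm_2_sq norm ..
  finally show ?thesis .
qed

lemma S0_scaled:
  assumes um: "u \<in> borel_measurable lebesgue" and l: "l > 0"
  shows "S0 (scaled l u) x = l\<^sup>2 * S0 u (l *\<^sub>R x)"
proof -
  define F where "F z = 1 / (8 * pi * norm (l *\<^sub>R x - z)) * (cmod (u z))\<^sup>2" for z
  have k: "(\<lambda>z. 1 / (8 * pi * norm (l *\<^sub>R x - z))) \<in> borel_measurable lebesgue"
    by (rule lebesgue_of_borel) measurable
  have Fm: "F \<in> borel_measurable lebesgue"
    unfolding F_def[abs_def] using k um by measurable
  have "1 / (8 * pi * norm (x - y)) * (cmod (scaled l u y))\<^sup>2 = l ^ 5 * F (l *\<^sub>R y)" for y
  proof -
    have "norm (l *\<^sub>R x - l *\<^sub>R y) = l * norm (x - y)"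
      using l by (metis abs_of_pos norm_scaleR scaleR_diff_right)
    then show ?thesis using l
      by (simp add: F_def scaled_def power_mult_distrib field_simps eval_nat_numeral)
  qed
  then have "S0 (scaled l u) x = (LINT y|lebesgue. l ^ 5 * F (l *\<^sub>R y))"
    unfolding S0_def conv_def by simp
  also have "\<dots> = l ^ 5 * (1 / l ^ 3 * (LINT z|lebesgue. F z))"
    using lebesgue_dilation(3)[OF Fm l] by simp
  also have "(LINT z|lebesgue. F z) = S0 u (l *\<^sub>R x)" by (simp add: S0_def conv_def F_def)
  finally show ?thesis using l by (simp add: field_simps eval_nat_numeral)
qed

lemma D_fun_scaled:
  assumes um: "u \<in> borel_measurable lebesgue" and l: "l > 0"
  shows "D_fun (scaled l u) = l ^ 3 * D_fun u"
proof -
  have m: "(\<lambda>x. S0 u x * (cmod (u x))\<^sup>2) \<in> borel_measurable lebesgue"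
    using lebesgue_of_borel[OF S0_measurable[OF um]] um by measurable
  have "S0 (scaled l u) x * (cmod (scaled l u x))\<^sup>2 = l ^ 6 * (S0 u (l *\<^sub>R x) * (cmod (u (l *\<^sub>R x)))\<^sup>2)" for x
    using l by (simp add: S0_scaled[OF um l] scaled_def power_mult_distrib eval_nat_numeral)
  then have "D_fun (scaled l u) = 1/4 * (l ^ 6 * (1 / l ^ 3 * (LINT x|lebesgue. S0 u x * (cmod (u x))\<^sup>2)))"
    using lebesgue_dilation(3)[OF m l] by (simp add: D_fun_def)
  then show ?thesis using l by (simp add: D_fun_def field_simps eval_nat_numeral)
qed

lemma I_fun_zero: "I_fun p \<omega> e \<rho> (\<lambda>x. 0) = 0"
proof -
  have z: "(\<lambda>x. 0) \<in> (Lp_loc 1 :: (real^3 \<Rightarrow> complex) set)" by (simp add: Lp_loc_def Lp_def)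
  have w: "has_weak_partial i (\<lambda>x::real^3. 0::complex) (\<lambda>x. 0)" for i using z by (simp add: has_weak_partial_def)
  have w': "has_weak_partial i (\<lambda>x::real^3. 0::complex) (weak_partial i (\<lambda>x. 0))" for i
    by (intro has_weak_partial_weak_partial exI) (rule w)
  have "AE x in lebesgue. \<forall>i. weak_partial i (\<lambda>x::real^3. 0::complex) x = 0"
    by (intro eventually_all_finite weak_partial_unique[OF w' w])
  then have "AE x in lebesgue. norm (weak_grad (\<lambda>x::real^3. 0::complex) x) powr 2 = 0"
    by eventually_elim (simp add: weak_grad_def norm_vec_def L2_set_def)
  then have "A_fun (\<lambda>x. 0) = 0" unfolding A_fun_def Lnorm_2_sq by (rule integral_eq_zero_AE)
  moreover have "S0 (\<lambda>x. 0) x = 0" for x by (simp add: S0_def conv_def)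
  ultimately show ?thesis
    by (simp add: I_fun_def B_fun_def C_fun_def D_fun_def E1_fun_def Lnorm_def)
qed

section \<open>Elementary inequalities in the scaling parameter\<close>

lemma powr_taylor_1:
  fixes a s :: real
  assumes "s > 0" "s \<noteq> 1"
  obtains t where "min s 1 < t" "t < max s 1" "s powr a = 1 + a * (s - 1) + a * (a - 1) * t powr (a - 2) / 2 * (s - 1)\<^sup>2"
proof -
  define df where "df m t = (if m = 0 then t powr a else if m = 1 then a * t powr (a - 1) else a * (a - 1) * t powr (a - 2))"
    for m :: nat and t :: real
  have "\<exists>t. (if s < 1 then s < t \<and> t < 1 else 1 < t \<and> t < s) \<and>
      s powr a = (\<Sum>m<2. df m 1 / fact m * (s - 1) ^ m) + df 2 t / fact 2 * (s - 1) ^ 2"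
  proof (rule Taylor[where a="min s 1" and b="max s 1"])
    show "\<forall>m t. m < 2 \<and> min s 1 \<le> t \<and> t \<le> max s 1 \<longrightarrow> (df m has_real_derivative df (Suc m) t) (at t)"
    proof (intro allI impI)
      fix m :: nat and t assume mt: "m < 2 \<and> min s 1 \<le> t \<and> t \<le> max s 1"
      then have t: "t > 0" using assms by (auto simp: min_def split: if_splits)
      from mt have "m = 0 \<or> m = 1" by auto
      then show "(df m has_real_derivative df (Suc m) t) (at t)"
      proof
        assume "m = 0"
        moreover have "((\<lambda>t. t powr a) has_real_derivative a * t powr (a - 1)) (at t)"
          using t by (rule has_real_derivative_powr)
        ultimately show ?thesis by (simp add: df_def[abs_def])
      next
        assume "m = 1"
        moreover have "((\<lambda>t. a * t powr (a - 1)) has_real_derivative a * ((a - 1) * t powr (a - 1 - 1))) (at t)"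
          by (intro DERIV_cmult has_real_derivative_powr t)
        moreover have "a - 1 - 1 = a - 2" by simp
        ultimately show ?thesis by (simp add: df_def[abs_def] mult.assoc)
      qed
    qed
  qed (use assms in \<open>auto simp: df_def\<close>)
  then obtain t where t: "if s < 1 then s < t \<and> t < 1 else 1 < t \<and> t < s"
    and eq: "s powr a = (\<Sum>m<2. df m 1 / fact m * (s - 1) ^ m) + df 2 t / fact 2 * (s - 1) ^ 2" by blast
  show ?thesis
  proof (rule that[of t])
    show "min s 1 < t" "t < max s 1" using t assms by (auto split: if_splits)
    show "s powr a = 1 + a * (s - 1) + a * (a - 1) * t powr (a - 2) / 2 * (s - 1)\<^sup>2"
      using eq by (simp add: df_def numeral_2_eq_2 lessThan_Suc)
  qed
qed

text \<open>The gap in Bernoulli's inequality is quadratic, uniformly on bounded intervals: near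
  \<open>1\<close> by Taylor's formula, and near \<open>0\<close>, where the second derivative may degenerate, because the
  gap decreases up to \<open>1\<close>.\<close>

lemma bernoulli_gap:
  fixes a U :: real
  assumes a: "a > 1" and U: "U \<ge> 1"
  obtains c where "c > 0" "\<And>s. 0 \<le> s \<Longrightarrow> s \<le> U \<Longrightarrow> s powr a - 1 - a * (s - 1) \<ge> c * (s - 1)\<^sup>2"
proof -
  define k where "k = min ((1/2) powr (a - 2)) (U powr (a - 2))"
  have k: "k > 0" using U by (simp add: k_def)
  have kt: "k \<le> t powr (a - 2)" if "1/2 \<le> t" "t \<le> U" for t
  proof (cases "a \<ge> 2")
    case True
    then have "(1/2) powr (a - 2) \<le> t powr (a - 2)" using that by (intro powr_mono2) auto
    then show ?thesis by (simp add: k_def)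
  next
    case False
    then have "U powr (a - 2) \<le> t powr (a - 2)" using that by (intro powr_mono2') auto
    then show ?thesis by (simp add: k_def)
  qed
  define c1 where "c1 = a * (a - 1) * k / 2"
  have c1: "c1 > 0" using a k by (simp add: c1_def)
  have mid: "s powr a - 1 - a * (s - 1) \<ge> c1 * (s - 1)\<^sup>2" if s: "1/2 \<le> s" "s \<le> U" for s
  proof (cases "s = 1")
    case False
    obtain t where t: "min s 1 < t" "t < max s 1" "s powr a = 1 + a * (s - 1) + a * (a - 1) * t powr (a - 2) / 2 * (s - 1)\<^sup>2"
      using powr_taylor_1[of s a] s False by auto
    have "1/2 \<le> t" "t \<le> U" using t s U by (auto simp: min_def max_def split: if_splits)
    then have "a * (a - 1) * k / 2 * (s - 1)\<^sup>2 \<le> a * (a - 1) * t powr (a - 2) / 2 * (s - 1)\<^sup>2"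
      using a kt by (intro mult_right_mono divide_right_mono mult_left_mono) auto
    then show ?thesis using t(3) by (simp add: c1_def)
  qed simp
  define c where "c = min (c1 / 4) (a - 1)"
  show ?thesis
  proof (rule that[of c])
    show "c > 0" using c1 a by (simp add: c_def)
    fix s :: real assume s: "0 \<le> s" "s \<le> U"
    consider "s = 0" | "0 < s" "s < 1/2" | "1/2 \<le> s" using s by linarith
    then show "s powr a - 1 - a * (s - 1) \<ge> c * (s - 1)\<^sup>2"
    proof cases
      case 1
      then show ?thesis by (simp add: c_def)
    next
      case 2
      have "(1/2) powr a - 1 - a * (1/2 - 1) \<le> s powr a - 1 - a * (s - 1)"
      proof (rule DERIV_nonpos_imp_nonincreasing[of s "1/2" "\<lambda>s. s powr a - 1 - a * (s - 1)"])
        show "s \<le> 1/2" using 2 by simp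
        fix x assume x: "s \<le> x" "x \<le> 1/2"
        then have x0: "x > 0" using 2 by simp
        have "((\<lambda>s. s powr a - 1 - a * (s - 1)) has_real_derivative a * x powr (a - 1) - 0 - a * (1 - 0)) (at x)"
          using x0 by (intro derivative_intros DERIV_cmult has_real_derivative_powr DERIV_diff DERIV_ident DERIV_const)
        moreover have "x powr (a - 1) \<le> 1 powr (a - 1)" using x x0 a by (intro powr_mono2) auto
        then have "a * x powr (a - 1) - 0 - a * (1 - 0) \<le> 0" using a by simp
        ultimately show "\<exists>y. ((\<lambda>s. s powr a - 1 - a * (s - 1)) has_real_derivative y) (at x) \<and> y \<le> 0" by blast
      qed
      moreover have "c1 / 4 \<le> (1/2) powr a - 1 - a * (1/2 - 1)" using mid[of "1/2"] U by (simp add: power2_eq_square)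
      moreover have "c * (s - 1)\<^sup>2 \<le> c1 / 4"
      proof -
        have "(1 - s)\<^sup>2 \<le> 1\<^sup>2" using 2 by (intro power_mono) auto
        then have "(s - 1)\<^sup>2 \<le> 1" by (simp add: power2_commute)
        then have "c * (s - 1)\<^sup>2 \<le> c * 1" using c1 a by (intro mult_left_mono) (auto simp: c_def)
        then show ?thesis by (simp add: c_def)
      qed
      ultimately show ?thesis by linarith
    next
      case 3
      have "c * (s - 1)\<^sup>2 \<le> c1 * (s - 1)\<^sup>2" using c1 by (intro mult_right_mono) (auto simp: c_def)
      then show ?thesis using mid[OF 3 s(2)] by linarith
    qed
  qed
qed

abbreviation power_gap :: "real \<Rightarrow> real \<Rightarrow> real" where
  "power_gap p l \<equiv> l powr (2 * p - 1) - 1 + (2 * p - 1) / 3 * (1 - l ^ 3)"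

text \<open>For \<open>l \<ge> T\<close> the condition on \<open>T\<close> makes the leading term at least \<open>3 l\<^sup>3\<close>, while the subtracted term is
  \<open>(2 p - 1) / 3\<close> times \<open>l\<^sup>3\<close>, and \<open>(2 p - 1) / 3 < 3\<close> because \<open>p < 5\<close>.\<close>

lemma power_gap_lower:
  fixes p T :: real
  assumes p: "2 < p" "p < 5" and T: "4 \<le> T" "3 \<le> T powr (2 * p - 4)"
  obtains \<alpha> where "\<alpha> > 0"
    "\<And>l. 0 \<le> l \<Longrightarrow> l \<le> T \<Longrightarrow> power_gap p l \<ge> \<alpha> / 6 * (1 - l)\<^sup>2"
    "\<And>l. T \<le> l \<Longrightarrow> power_gap p l \<ge> \<alpha> / 12 * (1 - l)\<^sup>2 + \<alpha> / 6 * l ^ 3"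
proof -
  define a where "a = (2 * p - 1) / 3"
  have a: "1 < a" "a < 3" using p by (auto simp: a_def)
  have "T ^ 3 \<ge> 1" using T by (intro one_le_power) simp
  then obtain c where c: "c > 0" "\<And>s. 0 \<le> s \<Longrightarrow> s \<le> T ^ 3 \<Longrightarrow> s powr a - 1 - a * (s - 1) \<ge> c * (s - 1)\<^sup>2"
    using bernoulli_gap[OF a(1)] by blast
  define \<alpha> where "\<alpha> = min (6 * c) (3 - a)"
  have \<alpha>: "\<alpha> > 0" "\<alpha> \<le> 6 * c" "\<alpha> \<le> 3 - a" using c a by (auto simp: \<alpha>_def)
  show ?thesis
  proof (rule that[OF \<alpha>(1)])
    fix l :: real assume l: "0 \<le> l" "l \<le> T"
    have pw: "l powr (2 * p - 1) = (l ^ 3) powr a"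
    proof (cases "l = 0")
      case False
      then have "l ^ 3 = l powr 3" using l by simp
      then have "(l ^ 3) powr a = l powr (3 * a)" by (simp only: powr_powr)
      moreover have "3 * a = 2 * p - 1" by (simp add: a_def)
      ultimately show ?thesis by simp
    qed simp
    have "l ^ 3 \<le> T ^ 3" using l by (intro power_mono)
    then have "c * (l ^ 3 - 1)\<^sup>2 \<le> (l ^ 3) powr a - 1 - a * (l ^ 3 - 1)" using l by (intro c(2)) auto
    moreover have "(1 - l)\<^sup>2 \<le> (l ^ 3 - 1)\<^sup>2"
    proof -
      have e: "l ^ 3 - 1 = (l - 1) * (l\<^sup>2 + l + 1)" by (simp add: power2_eq_square power3_eq_cube algebra_simps)
      have "1\<^sup>2 \<le> (l\<^sup>2 + l + 1)\<^sup>2" using l by (intro power_mono) auto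
      then have "(l - 1)\<^sup>2 * 1 \<le> (l - 1)\<^sup>2 * (l\<^sup>2 + l + 1)\<^sup>2" by (intro mult_left_mono) auto
      then show ?thesis unfolding e power_mult_distrib by (simp add: power2_commute)
    qed
    then have "c * (1 - l)\<^sup>2 \<le> c * (l ^ 3 - 1)\<^sup>2" using c by (intro mult_left_mono) auto
    moreover have "\<alpha> / 6 * (1 - l)\<^sup>2 \<le> c * (1 - l)\<^sup>2" using \<alpha> by (intro mult_right_mono) auto
    moreover have "power_gap p l = (l ^ 3) powr a - 1 - a * (l ^ 3 - 1)"
      unfolding pw a_def[symmetric] by (simp add: algebra_simps)
    ultimately show "\<alpha> / 6 * (1 - l)\<^sup>2 \<le> power_gap p l" by linarith
  next
    fix l :: real assume l: "T \<le> l"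
    with T have l4: "l \<ge> 4" by simp
    have "T powr (2 * p - 4) \<le> l powr (2 * p - 4)" using l T p by (intro powr_mono2) auto
    with T have "3 \<le> l powr (2 * p - 4)" by linarith
    then have "l ^ 3 * 3 \<le> l ^ 3 * l powr (2 * p - 4)" using l4 by (intro mult_left_mono) auto
    also have "l ^ 3 * l powr (2 * p - 4) = l powr (2 * p - 1)"
    proof -
      have "l ^ 3 = l powr 3" using l4 by simp
      then have "l ^ 3 * l powr (2 * p - 4) = l powr (3 + (2 * p - 4))" by (simp only: powr_add)
      then show ?thesis by (simp add: algebra_simps)
    qed
    finally have "power_gap p l \<ge> 3 * l ^ 3 - 1 + a * (1 - l ^ 3)" by (simp add: a_def)
    moreover have "3 * l ^ 3 - 1 + a * (1 - l ^ 3) = (3 - a) * l ^ 3 + (a - 1)" by (simp add: algebra_simps)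
    moreover have "\<alpha> * l ^ 3 \<le> (3 - a) * l ^ 3" using \<alpha> l4 by (intro mult_right_mono) auto
    moreover have "\<alpha> / 12 * (1 - l)\<^sup>2 \<le> \<alpha> / 12 * l ^ 3"
    proof (rule mult_left_mono)
      have "(l - 1)\<^sup>2 \<le> l\<^sup>2" using l4 by (intro power_mono) auto
      moreover have "l\<^sup>2 * 1 \<le> l\<^sup>2 * l" using l4 by (intro mult_left_mono) auto
      ultimately show "(1 - l)\<^sup>2 \<le> l ^ 3" unfolding power2_commute[of 1 l] by (simp add: power2_eq_square power3_eq_cube)
    qed (use \<alpha> in simp)
    moreover have "\<alpha> * l ^ 3 \<ge> 0" using \<alpha> l4 by simp
    ultimately show "\<alpha> / 12 * (1 - l)\<^sup>2 + \<alpha> / 6 * l ^ 3 \<le> power_gap p l" using a by linarith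
  qed
qed

lemma mass_gap_large:
  fixes l T :: real
  assumes "4 \<le> T" "T \<le> l"
  shows "(1 - l)\<^sup>2 / 6 + l ^ 3 / (3 * T) \<le> (1 - l)\<^sup>2 * (l + 2) / 6"
proof -
  have l: "l \<ge> 4" using assms by simp
  have "l ^ 3 / (3 * T) \<le> l ^ 3 / 12" using assms l by (intro divide_left_mono) auto
  moreover have "l ^ 3 / 2 \<le> (1 - l)\<^sup>2 * (l + 1)"
  proof -
    have "4 * l\<^sup>2 \<le> l * l\<^sup>2" "4 * l \<le> l * l" using l by (auto intro!: mult_right_mono)
    moreover have "l * l\<^sup>2 = l ^ 3" "l * l = l\<^sup>2" by (simp_all add: power2_eq_square power3_eq_cube)
    moreover have "(1 - l)\<^sup>2 * (l + 1) = l ^ 3 - l\<^sup>2 - l + 1"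
      by (simp add: power2_eq_square power3_eq_cube algebra_simps)
    ultimately show ?thesis using l by linarith
  qed
  moreover have "(1 - l)\<^sup>2 * (l + 2) / 6 = (1 - l)\<^sup>2 / 6 + (1 - l)\<^sup>2 * (l + 1) / 6"
    by (simp add: algebra_simps add_divide_distrib[symmetric])
  ultimately show ?thesis by linarith
qed

text \<open>Half of the second-order remainder at \<open>l = 1\<close> of \<open>F l = m (1 / l) / l\<close> in the variable \<open>l ^ 3\<close>, where
  \<open>- (m 1 + m1)\<close> is the derivative of \<open>F\<close> at \<open>1\<close>.\<close>

definition remainder :: "(real \<Rightarrow> real) \<Rightarrow> real \<Rightarrow> real \<Rightarrow> real" where
  "remainder m m1 l = 1/2 * ((if l = 0 then 0 else m (1 / l) / l) - m 1 + (l ^ 3 - 1) / 3 * (m 1 + m1))"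

abbreviation remainder_const :: "real \<Rightarrow> real" where
  "remainder_const T \<equiv> 8 * T powr (5/2) + 2 * T + 20"

lemma quotient_le:
  fixes Q l :: real
  assumes m: "\<bar>m (1 / l)\<bar> \<le> (1 / l) powr (- 5/2) * Q" and l: "l > 0"
  shows "\<bar>m (1 / l) / l\<bar> \<le> l powr (3/2) * Q"
proof -
  have "\<bar>m (1 / l) / l\<bar> = \<bar>m (1 / l)\<bar> / l" using l by simp
  also have "\<dots> \<le> (1 / l) powr (- 5/2) * Q / l" using m l by (intro divide_right_mono) auto
  also have "(1 / l) powr (- 5/2) = l powr (5/2)" using l by (simp add: powr_divide powr_minus)
  also have "l powr (5/2) * Q / l = l powr (3/2) * Q"
  proof -
    have "l powr (5/2) = l powr (3/2) * l powr 1" by (subst powr_add[symmetric]) simp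
    then show ?thesis using l by simp
  qed
  finally show ?thesis .
qed

lemma half_sum_bound:
  fixes x y z k :: real
  assumes "\<bar>x\<bar> \<le> k" "\<bar>z\<bar> \<le> 2 * k" "\<bar>y\<bar> \<le> k"
  shows "\<bar>1/2 * (x - y + z)\<bar> \<le> 2 * k"
proof -
  have "\<bar>x - y + z\<bar> \<le> 4 * k" using assms by linarith
  then show ?thesis by (simp add: abs_mult)
qed

text \<open>Taylor's formula is used for \<open>1/2 \<le> l \<le> T\<close>, where \<open>ln l\<close> is comparable with \<open>l - 1\<close>. For smaller \<open>l\<close> the
  factor \<open>(1 - l)\<^sup>2\<close> is bounded below, and for larger \<open>l\<close> every term is at most a multiple of \<open>l\<^sup>3\<close>, so there
  the terms are bounded one by one.\<close>

lemma remainder_bounds: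
  fixes m :: "real \<Rightarrow> real" and m1 Q T l :: real
  assumes Q: "Q \<ge> 0" and T: "T \<ge> 4" and l: "l \<ge> 0"
    and m: "\<And>r. r > 0 \<Longrightarrow> \<bar>m r\<bar> \<le> r powr (- 5/2) * Q" and m1: "\<bar>m1\<bar> \<le> Q"
    and taylor: "\<And>t. \<bar>m (exp t) - m 1 - t * m1\<bar> \<le> t\<^sup>2 * (exp (5/2 * \<bar>t\<bar>) * Q)"
  shows "l \<le> T \<Longrightarrow> \<bar>remainder m m1 l\<bar> \<le> remainder_const T * (1 - l)\<^sup>2 * Q"
    and "T \<le> l \<Longrightarrow> \<bar>remainder m m1 l\<bar> \<le> remainder_const T * l ^ 3 * Q"
proof -
  have m1': "\<bar>m 1\<bar> \<le> Q" using m[of 1] by simp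
  have RC: "remainder_const T \<ge> 20" using T by simp
  have F: "\<bar>m (1 / l) / l\<bar> \<le> l powr (3/2) * Q" if "l > 0" using m[of "1 / l"] that by (intro quotient_le) auto
  {
    assume lT: "l \<le> T"
    show "\<bar>remainder m m1 l\<bar> \<le> remainder_const T * (1 - l)\<^sup>2 * Q"
    proof (cases "l < 1/2")
      case True
      have "\<bar>if l = 0 then 0 else m (1 / l) / l\<bar> \<le> Q"
      proof (cases "l = 0")
        case False
        then have l0: "l > 0" using l by simp
        have "l powr (3/2) \<le> 1 powr (3/2)" using True l by (intro powr_mono2) auto
        then have "l powr (3/2) * Q \<le> 1 * Q" using Q by (intro mult_right_mono) auto
        with F[OF l0] False show ?thesis by simp
      qed (use Q in simp)
      moreover have "\<bar>(l ^ 3 - 1) / 3 * (m 1 + m1)\<bar> \<le> 1 * (2 * Q)"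
      proof -
        have "l ^ 3 \<le> 1 ^ 3" using True l by (intro power_mono) auto
        moreover have "l ^ 3 \<ge> 0" using l by simp
        ultimately have "\<bar>(l ^ 3 - 1) / 3\<bar> \<le> 1" by (simp add: abs_if)
        moreover have "\<bar>m 1 + m1\<bar> \<le> 2 * Q" using m1 m1' by linarith
        ultimately show ?thesis unfolding abs_mult by (intro mult_mono) auto
      qed
      moreover have "\<bar>1/2 * (x - y + z)\<bar> \<le> 2 * Q" if "\<bar>x\<bar> \<le> Q" "\<bar>z\<bar> \<le> 1 * (2 * Q)" "\<bar>y\<bar> \<le> Q" for x y z :: real
        using half_sum_bound[of x Q z y] that by simp
      ultimately have "\<bar>remainder m m1 l\<bar> \<le> 2 * Q" unfolding remainder_def using m1' by blast
      also have "2 * Q \<le> 20 * (1/4) * Q" using Q by simp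
      also have "\<dots> \<le> remainder_const T * (1 - l)\<^sup>2 * Q"
      proof (intro mult_right_mono mult_mono RC)
        have "(1/2)\<^sup>2 \<le> (1 - l)\<^sup>2" using True by (intro power_mono) auto
        then show "1/4 \<le> (1 - l)\<^sup>2" by (simp add: power2_eq_square)
      qed (use Q T in auto)
      finally show ?thesis .
    next
      case False
      then have l2: "l \<ge> 1/2" by simp
      then have l0: "l > 0" by simp
      define d where "d = (1 - l)\<^sup>2"
      have d: "d \<ge> 0" by (simp add: d_def)
      define t where "t = - ln l"
      have et: "exp t = 1 / l" using l0 by (simp add: t_def exp_minus inverse_eq_divide)
      have up: "ln l \<le> l - 1" using l0 by (rule ln_le_minus_one)
      have low: "1 - 1 / l \<le> ln l"
      proof -
        have "ln (1 / l) \<le> 1 / l - 1" using l0 by (intro ln_le_minus_one) simp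
        then show ?thesis using l0 by (simp add: ln_div)
      qed
      have il: "1 / l \<le> 2" using l2 by (simp add: field_simps)
      have lowd: "(l - 1) - d / l = 1 - 1 / l" using l0 by (simp add: d_def power2_eq_square field_simps)
      have dl: "d / l \<le> 2 * d" using mult_right_mono[OF il d] by simp
      have lnd: "\<bar>ln l - (l - 1)\<bar> \<le> 2 * d" using up low lowd dl by linarith
      have abs_ln: "\<bar>ln l\<bar> \<le> 2 * \<bar>1 - l\<bar>"
      proof (cases "l \<ge> 1")
        case True
        then show ?thesis using up by simp
      next
        case False
        then have "1 / l - 1 \<le> 2 * (1 - l)"
        proof -
          have "1 / l - 1 = (1 / l) * (1 - l)" using l0 by (simp add: field_simps)
          also have "\<dots> \<le> 2 * (1 - l)" using il False by (intro mult_right_mono) auto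
          finally show ?thesis .
        qed
        moreover have "ln l \<le> 0" using False l0 by simp
        ultimately show ?thesis using low False by linarith
      qed
      have t2: "t\<^sup>2 \<le> 4 * d"
      proof -
        have "\<bar>ln l\<bar>\<^sup>2 \<le> (2 * \<bar>1 - l\<bar>)\<^sup>2" using abs_ln by (intro power_mono) auto
        then show ?thesis by (simp add: t_def d_def power_mult_distrib)
      qed
      have ex: "exp (5/2 * \<bar>t\<bar>) \<le> T powr (5/2)"
      proof -
        have "\<bar>t\<bar> \<le> ln T"
        proof (cases "l \<ge> 1")
          case True
          then show ?thesis using lT by (simp add: t_def)
        next
          case False
          then have "1 / l \<le> T" using il T by linarith
          then have "ln (1 / l) \<le> ln T" using l0 by (subst ln_le_cancel_iff) (use T in auto)
          then show ?thesis using False l0 by (simp add: t_def ln_div)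
        qed
        then show ?thesis using T by (simp add: powr_def)
      qed
      define R where "R = m (1 / l) - m 1 + ln l * m1"
      have R: "\<bar>R\<bar> \<le> 4 * d * (T powr (5/2) * Q)"
      proof -
        have "\<bar>R\<bar> \<le> t\<^sup>2 * (exp (5/2 * \<bar>t\<bar>) * Q)" using taylor[of t] unfolding et R_def by (simp add: t_def)
        also have "\<dots> \<le> 4 * d * (T powr (5/2) * Q)" using t2 ex Q d by (intro mult_mono) auto
        finally show ?thesis .
      qed
      have Rl: "\<bar>1 / l * R\<bar> \<le> 8 * T powr (5/2) * d * Q"
      proof -
        have "\<bar>1 / l * R\<bar> = 1 / l * \<bar>R\<bar>" using l0 by (simp add: abs_mult)
        also have "\<dots> \<le> 2 * (4 * d * (T powr (5/2) * Q))" using il R l0 by (intro mult_mono) auto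
        finally show ?thesis by (simp add: mult_ac)
      qed
      have c1: "\<bar>1 / l - 1 + (l ^ 3 - 1) / 3\<bar> \<le> (T + 3) * d"
      proof -
        have "1 / l - 1 + (l ^ 3 - 1) / 3 = d * (1 / l + 1 + (l - 1) / 3)"
          using l0 by (simp add: d_def power2_eq_square power3_eq_cube field_simps)
        moreover have "\<bar>1 / l + 1 + (l - 1) / 3\<bar> \<le> T + 3" 
        proof (rule abs_leI)
          have y: "y + 1 + (l - 1) / 3 \<le> T + 3 \<and> - (y + 1 + (l - 1) / 3) \<le> T + 3" if "0 < y" "y \<le> 2" for y
          proof -
            have "(l - 1) / 3 \<le> T" "- 1 \<le> (l - 1) / 3" using l2 lT T by (simp_all add: field_simps)
            then show ?thesis using that T by (intro conjI) linarith+
          qed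
          show "1 / l + 1 + (l - 1) / 3 \<le> T + 3" "- (1 / l + 1 + (l - 1) / 3) \<le> T + 3"
            using y[of "1 / l"] il l0 by simp_all
        qed
        then have "d * \<bar>1 / l + 1 + (l - 1) / 3\<bar> \<le> d * (T + 3)" using d by (intro mult_left_mono)
        ultimately show ?thesis using d by (simp add: abs_mult mult.commute)
      qed
      have c2: "\<bar>(l ^ 3 - 1) / 3 - ln l / l\<bar> \<le> (T + 8) * d"
      proof -
        have e1: "(l ^ 3 - 1) / 3 - (l - 1) = d * ((l + 2) / 3)"
          by (simp add: d_def power2_eq_square power3_eq_cube field_simps)
        have e2: "ln l / l - (l - 1) = (ln l - (l - 1)) / l - d / l"
          using l0 by (simp add: d_def power2_eq_square field_simps)
        have "\<bar>(ln l - (l - 1)) / l\<bar> \<le> 2 * (2 * d)"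
        proof -
          have "\<bar>(ln l - (l - 1)) / l\<bar> = 1 / l * \<bar>ln l - (l - 1)\<bar>" using l0 by (simp add: abs_divide)
          also have "\<dots> \<le> 2 * (2 * d)" using il lnd l0 by (intro mult_mono) auto
          finally show ?thesis .
        qed
        moreover have "0 \<le> d / l" using d l0 by simp
        ultimately have "\<bar>ln l / l - (l - 1)\<bar> \<le> 6 * d" unfolding e2 using dl by linarith
        moreover have "d * ((l + 2) / 3) \<le> d * (T + 2)" using d lT l2 T by (intro mult_left_mono) auto
        moreover have "0 \<le> d * ((l + 2) / 3)" using d l2 by simp
        moreover have "d * (T + 2) + 6 * d = (T + 8) * d" by (simp add: algebra_simps)
        ultimately show ?thesis using e1 by linarith
      qed
      have "2 * remainder m m1 l = 1 / l * R + (1 / l - 1 + (l ^ 3 - 1) / 3) * m 1 + ((l ^ 3 - 1) / 3 - ln l / l) * m1"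
        using l0 by (simp add: remainder_def R_def field_simps)
      moreover have "\<bar>(1 / l - 1 + (l ^ 3 - 1) / 3) * m 1\<bar> \<le> (T + 3) * d * Q"
        unfolding abs_mult using c1 m1' d T by (intro mult_mono) auto
      moreover have "\<bar>((l ^ 3 - 1) / 3 - ln l / l) * m1\<bar> \<le> (T + 8) * d * Q"
        unfolding abs_mult using c2 m1 d T by (intro mult_mono) auto
      ultimately have "2 * \<bar>remainder m m1 l\<bar> \<le> 8 * T powr (5/2) * d * Q + (T + 3) * d * Q + (T + 8) * d * Q"
        using Rl by linarith
      also have "\<dots> = (8 * T powr (5/2) + 2 * T + 11) * (d * Q)" by (simp add: algebra_simps)
      also have "\<dots> \<le> (2 * remainder_const T) * (d * Q)" using d Q T by (intro mult_right_mono) auto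
      also have "\<dots> = 2 * (remainder_const T * (d * Q))" by (rule mult.assoc)
      finally have "\<bar>remainder m m1 l\<bar> \<le> remainder_const T * (d * Q)" by (rule mult_left_le_imp_le) simp
      then show ?thesis by (simp only: d_def mult.assoc)
    qed
  next
    assume lT: "T \<le> l"
    with T have l4: "l \<ge> 4" by simp
    have l3: "l ^ 3 \<ge> 1" using l4 by (intro one_le_power) simp
    have "l powr (3/2) \<le> l powr 3" using l4 by (intro powr_mono) auto
    then have "l powr (3/2) * Q \<le> l ^ 3 * Q" using l4 Q by (intro mult_right_mono) auto
    then have "\<bar>m (1 / l) / l\<bar> \<le> l ^ 3 * Q" using F l4 by linarith
    moreover have "\<bar>(l ^ 3 - 1) / 3 * (m 1 + m1)\<bar> \<le> l ^ 3 * (2 * Q)"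
    proof -
      have "\<bar>(l ^ 3 - 1) / 3\<bar> \<le> l ^ 3" using l3 by (simp add: abs_if)
      moreover have "\<bar>m 1 + m1\<bar> \<le> 2 * Q" using m1 m1' by linarith
      ultimately show ?thesis unfolding abs_mult using l4 by (intro mult_mono) auto
    qed
    moreover have "Q \<le> l ^ 3 * Q" using mult_right_mono[OF l3 Q] by simp
    moreover have "remainder m m1 l = 1/2 * (m (1 / l) / l - m 1 + (l ^ 3 - 1) / 3 * (m 1 + m1))"
      using l4 by (simp add: remainder_def)
    ultimately have "\<bar>remainder m m1 l\<bar> \<le> 2 * (l ^ 3 * Q)"
      using half_sum_bound[of "m (1 / l) / l" "l ^ 3 * Q" "(l ^ 3 - 1) / 3 * (m 1 + m1)" "m 1"] m1' by simp
    also have "\<dots> \<le> remainder_const T * (l ^ 3 * Q)" using RC Q l4 by (intro mult_right_mono) auto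
    finally show "\<bar>remainder m m1 l\<bar> \<le> remainder_const T * l ^ 3 * Q" by (simp add: mult.assoc)
  }
qed

section \<open>The energy gap\<close>

text \<open>Kinetic and Coulomb self-energy both scale like \<open>l ^ 3\<close> and drop out; the other terms leave
  the three gaps estimated above.\<close>

lemma energy_gap:
  fixes p \<omega> T l e :: real
  assumes p: "2 < p" "p < 5" and T: "4 \<le> T" and u: "u \<in> H1" and \<rho>: "doping_profile \<rho>" and l: "0 \<le> l"
  obtains E where
    "I_fun p \<omega> e \<rho> u - I_fun p \<omega> e \<rho> (scaled l u) - (1 - l^3)/3 * J_fun p \<omega> e \<rho> u =
       \<omega> * ((1 - l)\<^sup>2 * (l + 2) / 6) * (Lnorm 2 u)\<^sup>2
       + power_gap p l / (p + 1) * Lnorm (p + 1) u powr (p + 1) + e\<^sup>2 * E"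
    "l \<le> T \<Longrightarrow> \<bar>E\<bar> \<le> remainder_const T * (1 - l)\<^sup>2 * (pairing_const p u * N_fun \<rho>)"
    "T \<le> l \<Longrightarrow> \<bar>E\<bar> \<le> remainder_const T * l ^ 3 * (pairing_const p u * N_fun \<rho>)"
proof -
  have um: "u \<in> borel_measurable lebesgue" using u by (simp add: H1_def Lp_def)
  obtain m m1 where m:
    "\<And>l. l > 0 \<Longrightarrow> (LINT x|lebesgue. S0 u (l *\<^sub>R x) * \<rho> x) = m (1 / l) / l ^ 3"
    "(LINT x|lebesgue. S0 u x * x_grad \<rho> x) = m1"
    "\<And>r. r > 0 \<Longrightarrow> \<bar>m r\<bar> \<le> r powr (- 5/2) * (pairing_const p u * N_fun \<rho>)"
    "\<bar>m1\<bar> \<le> pairing_const p u * N_fun \<rho>"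
    "\<And>t. \<bar>m (exp t) - m 1 - t * m1\<bar> \<le> t\<^sup>2 * (exp (5/2 * \<bar>t\<bar>) * (pairing_const p u * N_fun \<rho>))"
    using doping_dilation[OF p u \<rho>] by blast
  have Q: "pairing_const p u * N_fun \<rho> \<ge> 0" using m(4) by linarith
  have E1: "E1_fun \<rho> u = - (1/4) * m 1" using m(1)[of 1] by (simp add: E1_fun_def)
  have E2: "E2_fun \<rho> u = 1/2 * m1" using m(2) by (simp add: E2_fun_def)
  define c where "c = 1 / (p + 1)"
  define C where "C = C_fun p u"
  have Cdef: "C = Lnorm (p + 1) u powr (p + 1)" by (simp add: C_def C_fun_def)
  define P where "P = l powr (2 * p - 1)"
  define F where "F = (if l = 0 then 0 else m (1 / l) / l)"
  have J: "J_fun p \<omega> e \<rho> u = 3/2 * A_fun u + \<omega>/2 * B_fun u - (2*p - 1) * c * C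
     + 3 * e\<^sup>2 * D_fun u - 2 * e\<^sup>2 * (- (1/4) * m 1) + e\<^sup>2 * (1/2 * m1)"
    by (simp add: J_fun_def C_def[symmetric] E1 E2 c_def)
  have I: "I_fun p \<omega> e \<rho> u = 1/2 * A_fun u + \<omega>/2 * B_fun u - c * C + e\<^sup>2 * D_fun u + 2 * e\<^sup>2 * (- (1/4) * m 1)"
    by (simp add: I_fun_def C_def[symmetric] E1 c_def)
  have Il: "I_fun p \<omega> e \<rho> (scaled l u) = 1/2 * (l ^ 3 * A_fun u) + \<omega>/2 * (l * B_fun u) - c * (P * C)
     + e\<^sup>2 * (l ^ 3 * D_fun u) + 2 * e\<^sup>2 * (- (1/4) * F)"
  proof (cases "l = 0")
    case True
    then have "scaled l u = (\<lambda>x. 0)" by (rule_tac ext) (simp add: scaled_def)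
    then show ?thesis using True by (simp add: I_fun_zero P_def F_def)
  next
    case False
    then have l0: "l > 0" using l by simp
    have "B_fun (scaled l u) = l * B_fun u"
      using power_integral_scaled[OF um l0, of 2] l0 by (simp add: B_fun_def Lnorm_2_sq)
    moreover have "C_fun p (scaled l u) = P * C"
    proof -
      have "2 * (p + 1) - 3 = 2 * p - 1" by simp
      then show ?thesis using power_integral_scaled[OF um l0, of "p + 1"] p
        by (simp add: C_fun_def C_def P_def Lnorm_powr)
    qed
    moreover have "E1_fun \<rho> (scaled l u) = - (1/4) * F"
    proof -
      have "E1_fun \<rho> (scaled l u) = - (1/4) * (LINT x|lebesgue. l\<^sup>2 * (S0 u (l *\<^sub>R x) * \<rho> x))"
        by (simp add: E1_fun_def S0_scaled[OF um l0] mult.assoc)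
      also have "\<dots> = - (1/4) * (l\<^sup>2 * (m (1 / l) / l ^ 3))" using m(1)[OF l0] by simp
      also have "l\<^sup>2 * (m (1 / l) / l ^ 3) = F" using l0 by (simp add: F_def field_simps power2_eq_square power3_eq_cube)
      finally show ?thesis .
    qed
    ultimately show ?thesis
      by (simp add: I_fun_def A_fun_scaled[OF u l0] D_fun_scaled[OF um l0] c_def)
  qed
  show ?thesis
  proof (rule that[of "remainder m m1 l"])
    have "remainder m m1 l = 1/2 * (F - m 1 + (l ^ 3 - 1) / 3 * (m 1 + m1))" by (simp add: remainder_def F_def)
    moreover have "power_gap p l / (p + 1) * C = (P - 1 + (2 * p - 1) / 3 * (1 - l ^ 3)) * c * C"
      by (simp add: c_def P_def)
    moreover have "(1/2 * A + \<omega>/2 * B - c * C + e\<^sup>2 * D + 2 * e\<^sup>2 * (- (1/4) * m 1))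
      - (1/2 * (l ^ 3 * A) + \<omega>/2 * (l * B) - c * (P * C) + e\<^sup>2 * (l ^ 3 * D) + 2 * e\<^sup>2 * (- (1/4) * F))
      - (1 - l^3)/3 * (3/2 * A + \<omega>/2 * B - (2*p - 1) * c * C + 3 * e\<^sup>2 * D - 2 * e\<^sup>2 * (- (1/4) * m 1) + e\<^sup>2 * (1/2 * m1))
      = \<omega> * ((1 - l)\<^sup>2 * (l + 2) / 6) * B + (P - 1 + (2 * p - 1) / 3 * (1 - l ^ 3)) * c * C
       + e\<^sup>2 * (1/2 * (F - m 1 + (l ^ 3 - 1) / 3 * (m 1 + m1)))" for A B D
      by (simp add: field_simps power2_eq_square power3_eq_cube)
    ultimately show "I_fun p \<omega> e \<rho> u - I_fun p \<omega> e \<rho> (scaled l u) - (1 - l^3)/3 * J_fun p \<omega> e \<rho> u =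
       \<omega> * ((1 - l)\<^sup>2 * (l + 2) / 6) * (Lnorm 2 u)\<^sup>2
       + power_gap p l / (p + 1) * Lnorm (p + 1) u powr (p + 1) + e\<^sup>2 * remainder m m1 l"
      unfolding I J Il Cdef[symmetric] B_fun_def[symmetric] by simp
  qed (use remainder_bounds[of "pairing_const p u * N_fun \<rho>" T l m m1] Q T l m in auto)
qed

theorem lemma3p7:
  fixes p \<omega> T :: real
  assumes "2 < p" and "p < 5" and "0 < \<omega>" and "4 \<le> T" and "3 \<le> T powr (2*p - 4)"
  shows "\<exists>\<alpha>>0. \<exists>\<beta>>0.
    (\<forall>(e::real)>0. \<forall>\<rho> u. doping_profile \<rho> \<longrightarrow> u \<in> H1 \<longrightarrow>
      (\<forall>l::real. 0 \<le> l \<and> l \<le> T \<longrightarrow>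
        I_fun p \<omega> e \<rho> u - I_fun p \<omega> e \<rho> (scaled l u) - (1 - l^3)/3 * J_fun p \<omega> e \<rho> u
        \<ge> (1 - l)\<^sup>2 * \<omega> / 3 * (Lnorm 2 u)\<^sup>2
          + \<alpha> / (6 * (p + 1)) * (1 - l)\<^sup>2 * Lnorm (p + 1) u powr (p + 1)
          - \<beta> * (1 - l)\<^sup>2 * e\<^sup>2 * N_fun \<rho> * ((Lnorm 2 u)\<^sup>2 + (Lnorm (p + 1) u)\<^sup>2)) \<and>
      (\<forall>l::real. T \<le> l \<longrightarrow>
        I_fun p \<omega> e \<rho> u - I_fun p \<omega> e \<rho> (scaled l u) - (1 - l^3)/3 * J_fun p \<omega> e \<rho> u
        \<ge> (1 - l)\<^sup>2 * \<omega> / 6 * (Lnorm 2 u)\<^sup>2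
          + l^3 * \<omega> / (3 * T) * (Lnorm 2 u)\<^sup>2
          + \<alpha> / (12 * (p + 1)) * (1 - l)\<^sup>2 * Lnorm (p + 1) u powr (p + 1)
          + \<alpha> / (6 * (p + 1)) * l^3 * Lnorm (p + 1) u powr (p + 1)
          - \<beta> * l^3 * e\<^sup>2 * N_fun \<rho> * ((Lnorm 2 u)\<^sup>2 + (Lnorm (p + 1) u)\<^sup>2))) \<and>
    (\<forall>\<delta>>0. \<exists>\<rho>\<^sub>0>0. \<forall>(e::real)>0. \<forall>\<rho> u. doping_profile \<rho> \<longrightarrow> u \<in> H1 \<longrightarrow>
      Lnorm (p + 1) u \<ge> \<delta> \<longrightarrow> e\<^sup>2 * N_fun \<rho> \<le> \<rho>\<^sub>0 \<longrightarrow>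
      (\<forall>l::real. l > 0 \<longrightarrow>
        I_fun p \<omega> e \<rho> u - I_fun p \<omega> e \<rho> (scaled l u) - (1 - l^3)/3 * J_fun p \<omega> e \<rho> u
        \<ge> (1 - l)\<^sup>2 * \<omega> / 6 * (Lnorm 2 u)\<^sup>2
          + \<alpha> * \<delta> powr (p - 1) / (12 * (p + 1)) * (1 - l)\<^sup>2 * (Lnorm (p + 1) u)\<^sup>2))"
proof -
  obtain \<alpha> where \<alpha>: "\<alpha> > 0"
    and gap1: "\<And>l. 0 \<le> l \<Longrightarrow> l \<le> T \<Longrightarrow> power_gap p l \<ge> \<alpha> / 6 * (1 - l)\<^sup>2"
    and gap2: "\<And>l. T \<le> l \<Longrightarrow> power_gap p l \<ge> \<alpha> / 12 * (1 - l)\<^sup>2 + \<alpha> / 6 * l ^ 3"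
    using power_gap_lower[OF assms(1,2,4,5)] by blast
  define \<beta> where "\<beta> = newton_const * remainder_const T"
  have \<beta>: "\<beta> > 0" unfolding \<beta>_def using newton_const_pos assms(4) by (intro mult_pos_pos add_nonneg_pos) auto
  have p1: "p + 1 > 0" using assms(1) by simp
  define gap where "gap e \<rho> u l = I_fun p \<omega> e \<rho> u - I_fun p \<omega> e \<rho> (scaled l u) - (1 - l^3)/3 * J_fun p \<omega> e \<rho> u" for e \<rho> u l
  have small: "gap e \<rho> u l \<ge> (1 - l)\<^sup>2 * \<omega> / 3 * (Lnorm 2 u)\<^sup>2
          + \<alpha> / (6 * (p + 1)) * (1 - l)\<^sup>2 * Lnorm (p + 1) u powr (p + 1)
          - \<beta> * (1 - l)\<^sup>2 * e\<^sup>2 * N_fun \<rho> * ((Lnorm 2 u)\<^sup>2 + (Lnorm (p + 1) u)\<^sup>2)"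
    if \<rho>: "doping_profile \<rho>" and u: "u \<in> H1" and l: "0 \<le> l" "l \<le> T" for e \<rho> u l
  proof -
    obtain E where E: "gap e \<rho> u l = \<omega> * ((1 - l)\<^sup>2 * (l + 2) / 6) * (Lnorm 2 u)\<^sup>2
        + power_gap p l / (p + 1) * Lnorm (p + 1) u powr (p + 1) + e\<^sup>2 * E"
      and Eb: "\<bar>E\<bar> \<le> remainder_const T * (1 - l)\<^sup>2 * (pairing_const p u * N_fun \<rho>)"
      unfolding gap_def by (rule energy_gap[OF assms(1,2,4) u \<rho> l(1), of \<omega> e]) (use l in auto)
    have "\<omega> * ((1 - l)\<^sup>2 * (l + 2) / 6) * (Lnorm 2 u)\<^sup>2 \<ge> \<omega> * ((1 - l)\<^sup>2 * 2 / 6) * (Lnorm 2 u)\<^sup>2"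
      using assms(3) l by (intro mult_right_mono mult_left_mono divide_right_mono) auto
    moreover have "power_gap p l / (p + 1) * Lnorm (p + 1) u powr (p + 1) \<ge>
        \<alpha> / 6 * (1 - l)\<^sup>2 / (p + 1) * Lnorm (p + 1) u powr (p + 1)"
      using p1 gap1[OF l] by (intro mult_right_mono divide_right_mono) auto
    moreover have "e\<^sup>2 * E \<ge> - (e\<^sup>2 * (remainder_const T * (1 - l)\<^sup>2 * (pairing_const p u * N_fun \<rho>)))"
    proof -
      have "e\<^sup>2 * - E \<le> e\<^sup>2 * (remainder_const T * (1 - l)\<^sup>2 * (pairing_const p u * N_fun \<rho>))"
        using Eb by (intro mult_left_mono) auto
      then show ?thesis by simp
    qed
    moreover have "e\<^sup>2 * (remainder_const T * (1 - l)\<^sup>2 * (pairing_const p u * N_fun \<rho>)) =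
        \<beta> * (1 - l)\<^sup>2 * e\<^sup>2 * N_fun \<rho> * ((Lnorm 2 u)\<^sup>2 + (Lnorm (p + 1) u)\<^sup>2)"
      unfolding \<beta>_def by (simp only: mult_ac)
    moreover have "\<omega> * ((1 - l)\<^sup>2 * 2 / 6) * (Lnorm 2 u)\<^sup>2 = (1 - l)\<^sup>2 * \<omega> / 3 * (Lnorm 2 u)\<^sup>2" by simp
    moreover have "\<alpha> / 6 * (1 - l)\<^sup>2 / (p + 1) * Lnorm (p + 1) u powr (p + 1) =
        \<alpha> / (6 * (p + 1)) * (1 - l)\<^sup>2 * Lnorm (p + 1) u powr (p + 1)" by simp
    ultimately show ?thesis unfolding E by linarith
  qed
  have large: "gap e \<rho> u l \<ge> (1 - l)\<^sup>2 * \<omega> / 6 * (Lnorm 2 u)\<^sup>2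
          + l^3 * \<omega> / (3 * T) * (Lnorm 2 u)\<^sup>2
          + \<alpha> / (12 * (p + 1)) * (1 - l)\<^sup>2 * Lnorm (p + 1) u powr (p + 1)
          + \<alpha> / (6 * (p + 1)) * l^3 * Lnorm (p + 1) u powr (p + 1)
          - \<beta> * l^3 * e\<^sup>2 * N_fun \<rho> * ((Lnorm 2 u)\<^sup>2 + (Lnorm (p + 1) u)\<^sup>2)"
    if \<rho>: "doping_profile \<rho>" and u: "u \<in> H1" and l: "T \<le> l" for e \<rho> u l
  proof -
    have l0: "0 \<le> l" using l assms(4) by simp
    obtain E where E: "gap e \<rho> u l = \<omega> * ((1 - l)\<^sup>2 * (l + 2) / 6) * (Lnorm 2 u)\<^sup>2
        + power_gap p l / (p + 1) * Lnorm (p + 1) u powr (p + 1) + e\<^sup>2 * E"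
      and Eb: "\<bar>E\<bar> \<le> remainder_const T * l ^ 3 * (pairing_const p u * N_fun \<rho>)"
      unfolding gap_def by (rule energy_gap[OF assms(1,2,4) u \<rho> l0, of \<omega> e]) (use l in auto)
    have "\<omega> * ((1 - l)\<^sup>2 * (l + 2) / 6) * (Lnorm 2 u)\<^sup>2 \<ge> \<omega> * ((1 - l)\<^sup>2 / 6 + l ^ 3 / (3 * T)) * (Lnorm 2 u)\<^sup>2"
      using assms(3) mass_gap_large[OF assms(4) l] by (intro mult_right_mono mult_left_mono) auto
    moreover have "power_gap p l / (p + 1) * Lnorm (p + 1) u powr (p + 1) \<ge>
        (\<alpha> / 12 * (1 - l)\<^sup>2 + \<alpha> / 6 * l ^ 3) / (p + 1) * Lnorm (p + 1) u powr (p + 1)"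
      using p1 gap2[OF l] by (intro mult_right_mono divide_right_mono) auto
    moreover have "e\<^sup>2 * E \<ge> - (e\<^sup>2 * (remainder_const T * l ^ 3 * (pairing_const p u * N_fun \<rho>)))"
    proof -
      have "e\<^sup>2 * - E \<le> e\<^sup>2 * (remainder_const T * l ^ 3 * (pairing_const p u * N_fun \<rho>))"
        using Eb by (intro mult_left_mono) auto
      then show ?thesis by simp
    qed
    moreover have "e\<^sup>2 * (remainder_const T * l ^ 3 * (pairing_const p u * N_fun \<rho>)) =
        \<beta> * l^3 * e\<^sup>2 * N_fun \<rho> * ((Lnorm 2 u)\<^sup>2 + (Lnorm (p + 1) u)\<^sup>2)"
      unfolding \<beta>_def by (simp only: mult_ac)
    moreover have "\<omega> * ((1 - l)\<^sup>2 / 6 + l ^ 3 / (3 * T)) * (Lnorm 2 u)\<^sup>2 =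
        (1 - l)\<^sup>2 * \<omega> / 6 * (Lnorm 2 u)\<^sup>2 + l^3 * \<omega> / (3 * T) * (Lnorm 2 u)\<^sup>2"
      by (simp add: distrib_left distrib_right mult_ac)
    moreover have "(\<alpha> / 12 * (1 - l)\<^sup>2 + \<alpha> / 6 * l ^ 3) / (p + 1) * Lnorm (p + 1) u powr (p + 1) =
        \<alpha> / (12 * (p + 1)) * (1 - l)\<^sup>2 * Lnorm (p + 1) u powr (p + 1) + \<alpha> / (6 * (p + 1)) * l^3 * Lnorm (p + 1) u powr (p + 1)"
      by (simp add: add_divide_distrib distrib_right)
    ultimately show ?thesis unfolding E by linarith
  qed
  have third: "\<exists>\<rho>\<^sub>0>0. \<forall>(e::real)>0. \<forall>\<rho> u. doping_profile \<rho> \<longrightarrow> u \<in> H1 \<longrightarrow>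
      Lnorm (p + 1) u \<ge> \<delta> \<longrightarrow> e\<^sup>2 * N_fun \<rho> \<le> \<rho>\<^sub>0 \<longrightarrow>
      (\<forall>l::real. l > 0 \<longrightarrow> gap e \<rho> u l
        \<ge> (1 - l)\<^sup>2 * \<omega> / 6 * (Lnorm 2 u)\<^sup>2
          + \<alpha> * \<delta> powr (p - 1) / (12 * (p + 1)) * (1 - l)\<^sup>2 * (Lnorm (p + 1) u)\<^sup>2)"
    if \<delta>: "\<delta> > 0" for \<delta>
  proof -
    define k where "k = \<alpha> * \<delta> powr (p - 1) / (12 * (p + 1))"
    \<comment> \<open>The threshold lets the doping term consume at most half of the available mass and power terms, for
      \<open>l \<le> T\<close> as well as for \<open>l \<ge> T\<close>.\<close>
    define \<kappa> where "\<kappa> = min (\<omega> / (6 * T)) k"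
    have k: "k > 0" using \<alpha> \<delta> p1 by (simp add: k_def)
    have \<kappa>: "\<kappa> > 0" "\<kappa> \<le> \<omega> / (6 * T)" "\<kappa> \<le> k" using k assms(3,4) by (auto simp: \<kappa>_def)
    have \<omega>T: "\<omega> / (6 * T) \<le> \<omega> / 6" using assms(3,4) by (simp add: field_simps)
    have "gap e \<rho> u l \<ge> (1 - l)\<^sup>2 * \<omega> / 6 * (Lnorm 2 u)\<^sup>2 + k * (1 - l)\<^sup>2 * (Lnorm (p + 1) u)\<^sup>2"
      if \<rho>: "doping_profile \<rho>" and u: "u \<in> H1" and d: "Lnorm (p + 1) u \<ge> \<delta>" and s: "e\<^sup>2 * N_fun \<rho> \<le> \<kappa> / \<beta>" and l: "l > 0"
      for e \<rho> u l
    proof -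
      define B P C where "B = (Lnorm 2 u)\<^sup>2" and "P = (Lnorm (p + 1) u)\<^sup>2" and "C = Lnorm (p + 1) u powr (p + 1)"
      have BP: "B \<ge> 0" "P \<ge> 0" by (simp_all add: B_def P_def)
      have CP: "2 * k * P \<le> \<alpha> / (6 * (p + 1)) * C"
      proof -
        have n0: "Lnorm (p + 1) u > 0" using d \<delta> by simp
        have "C = Lnorm (p + 1) u powr (p - 1) * Lnorm (p + 1) u powr 2"
          unfolding C_def by (subst powr_add[symmetric]) (simp add: add.commute)
        then have C: "C = Lnorm (p + 1) u powr (p - 1) * P" using n0 by (simp add: P_def)
        have "\<delta> powr (p - 1) \<le> Lnorm (p + 1) u powr (p - 1)" using \<delta> d assms(1) by (intro powr_mono2) auto
        then have "\<delta> powr (p - 1) * P \<le> C" unfolding C using BP by (intro mult_right_mono)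
        then have "\<alpha> / (6 * (p + 1)) * (\<delta> powr (p - 1) * P) \<le> \<alpha> / (6 * (p + 1)) * C"
          using \<alpha> p1 by (intro mult_left_mono) auto
        moreover have "\<alpha> / (6 * (p + 1)) * (\<delta> powr (p - 1) * P) = 2 * k * P"
        proof -
          have "\<alpha> / (6 * q) * (y * P) = 2 * (\<alpha> * y / (12 * q)) * P" for y q by simp
          then show ?thesis unfolding k_def .
        qed
        ultimately show ?thesis by simp
      qed
      have N: "\<beta> * (e\<^sup>2 * N_fun \<rho>) * (B + P) \<le> \<kappa> * (B + P)"
      proof (rule mult_right_mono)
        have "\<beta> * (e\<^sup>2 * N_fun \<rho>) \<le> \<beta> * (\<kappa> / \<beta>)" using s \<beta> by (intro mult_left_mono) auto
        then show "\<beta> * (e\<^sup>2 * N_fun \<rho>) \<le> \<kappa>" using \<beta> by simp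
      qed (use BP in simp)
      have \<kappa>B: "\<kappa> * B \<le> \<omega> / (6 * T) * B" "\<kappa> * P \<le> k * P" 
        by (rule mult_right_mono[OF \<kappa>(2) BP(1)], rule mult_right_mono[OF \<kappa>(3) BP(2)])
      have \<omega>TB: "\<omega> / (6 * T) * B \<le> \<omega> / 6 * B" using \<omega>T BP by (intro mult_right_mono)
      show ?thesis
      proof (cases "l \<le> T")
        case True
        have "\<omega> / 6 * B + k * P \<le> \<omega> / 3 * B + \<alpha> / (6 * (p + 1)) * C - \<beta> * (e\<^sup>2 * N_fun \<rho>) * (B + P)"
          using CP N \<kappa>B \<omega>TB unfolding distrib_left by linarith
        then have "(1 - l)\<^sup>2 * (\<omega> / 6 * B + k * P) \<le> (1 - l)\<^sup>2 * (\<omega> / 3 * B + \<alpha> / (6 * (p + 1)) * C - \<beta> * (e\<^sup>2 * N_fun \<rho>) * (B + P))"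
          by (rule mult_left_mono) simp
        also have "\<dots> = (1 - l)\<^sup>2 * \<omega> / 3 * B + \<alpha> / (6 * (p + 1)) * (1 - l)\<^sup>2 * C - \<beta> * (1 - l)\<^sup>2 * e\<^sup>2 * N_fun \<rho> * (B + P)"
          by (simp add: right_diff_distrib distrib_left mult_ac)
        also have "\<dots> \<le> gap e \<rho> u l" using small[OF \<rho> u _ True] l by (simp add: B_def P_def C_def)
        finally show ?thesis by (simp add: B_def P_def distrib_left mult_ac)
      next
        case False
        then have lT: "T \<le> l" by simp
        have "0 \<le> \<omega> / (3 * T) * B + \<alpha> / (6 * (p + 1)) * C - \<beta> * (e\<^sup>2 * N_fun \<rho>) * (B + P)"
        proof -
          have "\<omega> / (3 * T) * B = 2 * (\<omega> / (6 * T) * B)" by simp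
          moreover have "0 \<le> \<omega> / (6 * T) * B" "0 \<le> k * P" using assms(3,4) BP k by auto
          ultimately show ?thesis using CP N \<kappa>B unfolding distrib_left by linarith
        qed
        then have "0 \<le> l^3 * (\<omega> / (3 * T) * B + \<alpha> / (6 * (p + 1)) * C - \<beta> * (e\<^sup>2 * N_fun \<rho>) * (B + P))"
          using l by (intro mult_nonneg_nonneg) auto
        also have "\<dots> = l^3 * \<omega> / (3 * T) * B + \<alpha> / (6 * (p + 1)) * l^3 * C - \<beta> * l^3 * e\<^sup>2 * N_fun \<rho> * (B + P)"
          by (simp add: right_diff_distrib distrib_left mult_ac)
        finally have 1: "0 \<le> l^3 * \<omega> / (3 * T) * B + \<alpha> / (6 * (p + 1)) * l^3 * C - \<beta> * l^3 * e\<^sup>2 * N_fun \<rho> * (B + P)" .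
        have e1: "k * (1 - l)\<^sup>2 * P = 1/2 * ((1 - l)\<^sup>2 * (2 * k * P))" by simp
        have e2: "\<alpha> / (12 * q) * (1 - l)\<^sup>2 * C = 1/2 * ((1 - l)\<^sup>2 * (\<alpha> / (6 * q) * C))" for q by simp
        have "(1 - l)\<^sup>2 * (2 * k * P) \<le> (1 - l)\<^sup>2 * (\<alpha> / (6 * (p + 1)) * C)" by (rule mult_left_mono[OF CP]) simp
        then have 2: "k * (1 - l)\<^sup>2 * P \<le> \<alpha> / (12 * (p + 1)) * (1 - l)\<^sup>2 * C"
          unfolding e1 e2 by (rule mult_left_mono) simp
        show ?thesis using large[OF \<rho> u lT, of e] 1 2 unfolding B_def[symmetric] P_def[symmetric] C_def[symmetric] by linarith
      qed
    qed
    moreover have "\<kappa> / \<beta> > 0" using \<kappa> \<beta> by simp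
    ultimately show ?thesis unfolding k_def by blast
  qed
  show ?thesis
  proof (rule exI[of _ \<alpha>], rule conjI[OF \<alpha>], rule exI[of _ \<beta>], rule conjI[OF \<beta>], rule conjI, goal_cases)
    case 1
    show ?case
    proof (intro allI impI conjI, goal_cases)
      case (1 e \<rho> u l)
      then show ?case using small[of \<rho> u l e] unfolding gap_def by simp
    next
      case (2 e \<rho> u l)
      then show ?case using large[of \<rho> u l e] unfolding gap_def by simp
    qed
  next
    case 2
    show ?case by (intro allI impI third[unfolded gap_def])
  qed
qed

end
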